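(* Let $a\in\mathbb R$, $b>0$, $\rho>0$, $\bar d>0$ be constants, and set $$r_6=\frac1{b^2}\Big[-(a-\bar d)-\sqrt{(a-\bar d)^2+2\rho b^2}\Big]<0,\qquad r_8=\frac1{b^2}\Big[-(a-\bar d)-\sqrt{(a-\bar d)^2+4\rho b^2}\Big]<0.$$ Assume $\frac{\bar d}{\rho}+\frac1{r_6}<0$. Then there exists $\tilde\varepsilon>0$ such that, if the risk aversion $\gamma>0$ satisfies $\gamma<\tilde\varepsilon$, then paying dividends at the maximum rate $\bar d$ is a time-consistent equilibrium dividend strategy (that is, $d^*(x)=\bar d$ for all $x>0$). Moreover, $G(x)=\mathbb E_x(Y_0^* )$ and $H(x)=\mathbb E_x((Y_0^* )^2)$ are given by $$G(x)=\frac{\bar d}{\rho}\big(1-e^{r_6x}\big),\qquad H(x)=\Big(\frac{\bar d}{\rho}\Big)^2\big(1-2e^{r_6x}+e^{r_8x}\big),$$ and the equilibrium value function equals $V(x)=G(x)-\frac{\gamma}{2}\big(H(x)-G^2(x)\big)$.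
   Context: Setting. $B=(B_t)_{t\ge0}$ is a standard one-dimensional Brownian motion on a filtered probability space $(\Omega,\mathcal F,(\mathcal F_t)_{t\ge0},\mathbb P)$ with its natural filtration. A dividend strategy is a feedback function $\delta:\mathbb R_+^2\to\mathbb R_+$, $(x,t)\mapsto \delta(x,t)$ (the dividend rate at time $t$ when the surplus is $x$). It is called admissible if it is a deterministic, Borel-measurable function taking values in $[0,\bar d]$. The controlled surplus $X=X^\delta$ satisfies $dX_t=(a-\delta(X_t,t))\,dt+b\,dB_t$, and the ruin time is $\tau=\tau^\delta=\inf\{t\ge0:X_t<0\}$. The discounted dividends from time $t$ to ruin are $$Y_t=Y_t^\delta=\int_t^\tau e^{-\rho(s-t)}\delta(X_s,s)\,ds,\qquad Y_t=0\text{ if }t\ge\tau.$$ $\mathbb E_{x,t}$ and $\mathbb{V}\mathrm{ar}_{x,t}$ denote expectation and variance conditional on $X_t=x\ge0$ and $\tau>t$; $\mathbb E_x=\mathbb E_{x,0}$; $Y^*=Y^{d^*}$. The mean-variance objective is $$J(x,t;\delta)=\mathbb E_{x,t}(Y_t)-\frac{\gamma}{2}\mathbb{V}\mathrm{ar}_{x,t}(Y_t).$$ Equilibrium. Let $d^*$ be an admissible strategy. For $t\ge0$, $\varepsilon>0$ and a constant $d\in[0,\bar d]$, the perturbed strategy $d^\varepsilon$ is defined for $s\ge t$ by $d^\varepsilon(X_s,s)=d$ for $t\le s<(t+\varepsilon)\wedge\tau$ and $d^\varepsilon(X_s,s)=d^*(X_s,s)$ for $s\ge(t+\varepsilon)\wedge\tau$,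 where $X=X^{d^\varepsilon}$ and $\tau=\tau^{d^\varepsilon}$. The strategy $d^*$ is a time-consistent equilibrium dividend strategy if for all $(x,t)\in\mathbb R_+^2$ (and all $d\in[0,\bar d]$) $$\liminf_{\varepsilon\to0^+}\frac{J(x,t;d^* )-J(x,t;d^\varepsilon)}{\varepsilon}\ge0,$$ and then $V(x,t)=J(x,t;d^* )$ is called the equilibrium value function; it is written $V(x)$ when it does not depend on $t$. *)

theory Defs
  imports "HOL-Probability.Probability"
begin

definition standard_brownian_motion :: "'w measure \<Rightarrow> (real \<Rightarrow> 'w \<Rightarrow> real) \<Rightarrow> bool" where
  "standard_brownian_motion M B \<longleftrightarrow>
     prob_space M \<and>
     (\<forall>t\<ge>0. B t \<in> borel_measurable M) \<and>
     (AE \<omega> in M. B 0 \<omega> = 0) \<and>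
     (\<forall>s t. 0 \<le> s \<and> s < t \<longrightarrow>
        distributed M lborel (\<lambda>\<omega>. B t \<omega> - B s \<omega>) (normal_density 0 (sqrt (t - s)))) \<and>
     (\<forall>(n::nat) (u::nat \<Rightarrow> real). 0 \<le> u 0 \<and> mono u \<longrightarrow>
        prob_space.indep_vars M (\<lambda>_. borel) (\<lambda>i \<omega>. B (u (Suc i)) \<omega> - B (u i) \<omega>) {..<n}) \<and>
     (AE \<omega> in M. continuous_on {0..} (\<lambda>t. B t \<omega>))"

text \<open>The natural filtration of \<open>B\<close>, augmented by the null sets of \<open>M\<close>.\<close>

definition natural_filtration :: "'w measure \<Rightarrow> (real \<Rightarrow> 'w \<Rightarrow> real) \<Rightarrow> real \<Rightarrow> 'w measure" where
  "natural_filtration M B s =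
     sigma (space M)
       ({B u -` A \<inter> space M | u A. 0 \<le> u \<and> u \<le> s \<and> A \<in> sets borel} \<union> null_sets M)"

text \<open>A strategy is written \<open>\<delta> x t\<close> with surplus \<open>x\<close> and time \<open>t\<close>. It is a function on the
  closed quadrant; its values elsewhere never enter any definition below.\<close>

definition admissible :: "real \<Rightarrow> (real \<Rightarrow> real \<Rightarrow> real) \<Rightarrow> bool" where
  "admissible dbar \<delta> \<longleftrightarrow>
     (\<lambda>(x, t). \<delta> x t) \<in> borel_measurable (restrict_space borel ({0..} \<times> {0..})) \<and>
     (\<forall>x\<ge>0. \<forall>t\<ge>0. 0 \<le> \<delta> x t \<and> \<delta> x t \<le> dbar)"

text \<open>Ruin time of a surplus path observed from time \<open>t\<close> on; it is \<open>\<infinity>\<close> if there is no ruin.\<close>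

definition ruin_time :: "real \<Rightarrow> (real \<Rightarrow> 'w \<Rightarrow> real) \<Rightarrow> 'w \<Rightarrow> ereal" where
  "ruin_time t X \<omega> = Inf (ereal ` {s. t \<le> s \<and> X s \<omega> < 0})"

text \<open>\<open>X\<close> solves \<open>dX = (a - \<delta>(X, s)) ds + b dB\<close> from the initial value \<open>x\<close> at time \<open>t\<close>. The
  diffusion coefficient is constant, so the stochastic integral is \<open>b (B s - B t)\<close>. As \<open>\<delta>\<close> is
  defined for nonnegative surplus only, the equation is imposed up to and including ruin.\<close>

definition is_surplus ::
  "'w measure \<Rightarrow> (real \<Rightarrow> 'w \<Rightarrow> real) \<Rightarrow> real \<Rightarrow> real \<Rightarrow> (real \<Rightarrow> real \<Rightarrow> real) \<Rightarrow> real \<Rightarrow> real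
    \<Rightarrow> (real \<Rightarrow> 'w \<Rightarrow> real) \<Rightarrow> bool" where
  "is_surplus M B a b \<delta> x t X \<longleftrightarrow>
     (\<forall>s\<ge>t. X s \<in> borel_measurable (natural_filtration M B s)) \<and>
     (\<forall>\<omega>\<in>space M. continuous_on {t..} (\<lambda>s. X s \<omega>)) \<and>
     (AE \<omega> in M. \<forall>s\<ge>t. ereal s \<le> ruin_time t X \<omega> \<longrightarrow>
        X s \<omega> = x + (LINT u:{t..s}|lborel. a - \<delta> (X u \<omega>) u) + b * (B s \<omega> - B t \<omega>))"

text \<open>The controlled surplus started from \<open>x\<close> at time \<open>t\<close>. It is determined by the equation only
  up to null sets and up to ruin, whence the choice operator. Conditioning on \<open>X t = x\<close>
  and survival up to \<open>t\<close> is rendered throughout by restarting the dynamics in this way.\<close>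

definition surplus ::
  "'w measure \<Rightarrow> (real \<Rightarrow> 'w \<Rightarrow> real) \<Rightarrow> real \<Rightarrow> real \<Rightarrow> (real \<Rightarrow> real \<Rightarrow> real) \<Rightarrow> real \<Rightarrow> real
    \<Rightarrow> real \<Rightarrow> 'w \<Rightarrow> real" where
  "surplus M B a b \<delta> x t = (SOME X. is_surplus M B a b \<delta> x t X)"

definition discounted_dividends ::
  "real \<Rightarrow> (real \<Rightarrow> real \<Rightarrow> real) \<Rightarrow> real \<Rightarrow> (real \<Rightarrow> 'w \<Rightarrow> real) \<Rightarrow> 'w \<Rightarrow> real" where
  "discounted_dividends \<rho> \<delta> t X \<omega> =
     (LINT s:{s. t \<le> s \<and> ereal s < ruin_time t X \<omega>}|lborel. exp (- \<rho> * (s - t)) * \<delta> (X s \<omega>) s)"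

text \<open>\<open>Y_t\<close> given \<open>X_t = x\<close>; its expectation and variance under \<open>M\<close> are those subscripted by
  \<open>x, t\<close>.\<close>

definition payoff ::
  "'w measure \<Rightarrow> (real \<Rightarrow> 'w \<Rightarrow> real) \<Rightarrow> real \<Rightarrow> real \<Rightarrow> real \<Rightarrow> (real \<Rightarrow> real \<Rightarrow> real)
    \<Rightarrow> real \<Rightarrow> real \<Rightarrow> 'w \<Rightarrow> real" where
  "payoff M B a b \<rho> \<delta> x t = discounted_dividends \<rho> \<delta> t (surplus M B a b \<delta> x t)"

definition mv_objective ::
  "'w measure \<Rightarrow> (real \<Rightarrow> 'w \<Rightarrow> real) \<Rightarrow> real \<Rightarrow> real \<Rightarrow> real \<Rightarrow> real
    \<Rightarrow> real \<Rightarrow> real \<Rightarrow> (real \<Rightarrow> real \<Rightarrow> real) \<Rightarrow> real" where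
  "mv_objective M B a b \<rho> \<gamma> x t \<delta> =
     prob_space.expectation M (payoff M B a b \<rho> \<delta> x t)
       - \<gamma> / 2 * prob_space.variance M (payoff M B a b \<rho> \<delta> x t)"

text \<open>The constant \<open>d\<close> is paid during \<open>[t, t + \<epsilon>)\<close>. No minimum with the ruin time is needed,
  since strategies are not evaluated after ruin.\<close>

definition perturbed ::
  "(real \<Rightarrow> real \<Rightarrow> real) \<Rightarrow> real \<Rightarrow> real \<Rightarrow> real \<Rightarrow> real \<Rightarrow> real \<Rightarrow> real" where
  "perturbed \<delta> d t \<epsilon> = (\<lambda>y s. if t \<le> s \<and> s < t + \<epsilon> then d else \<delta> y s)"

definition equilibrium_strategy ::
  "'w measure \<Rightarrow> (real \<Rightarrow> 'w \<Rightarrow> real) \<Rightarrow> real \<Rightarrow> real \<Rightarrow> real \<Rightarrow> real \<Rightarrow> real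
    \<Rightarrow> (real \<Rightarrow> real \<Rightarrow> real) \<Rightarrow> bool" where
  "equilibrium_strategy M B a b \<rho> \<gamma> dbar \<delta> \<longleftrightarrow>
     admissible dbar \<delta> \<and>
     (\<forall>x\<ge>0. \<forall>t\<ge>0. \<forall>d\<in>{0..dbar}.
        Liminf (at_right 0)
          (\<lambda>\<epsilon>. ereal ((mv_objective M B a b \<rho> \<gamma> x t \<delta>
                      - mv_objective M B a b \<rho> \<gamma> x t (perturbed \<delta> d t \<epsilon>)) / \<epsilon>)) \<ge> 0)"

end

theory Submission
  imports Defs "HOL-Real_Asymp.Real_Asymp"
begin

text \<open>Under \<open>d\<^sup>*\<close>, and under its perturbations, the surplus is a Brownian motion with piecewise constant
  drift until it first reaches zero. It becomes negative immediately afterwards: with \<open>r\<close> very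
  negative, \<open>exp (r X - (s - t))\<close> is a submartingale even if the drift is raised by a bounded amount
  from the hitting time on, and optional stopping leaves no room for a delay. Hence the arbitrary
  value of the strategy at surplus zero is irrelevant, and the payoff is a function of the ruin time
  alone. Optional stopping of the martingale \<open>exp (r X - \<lambda> (s - t) - r (dbar - d) min (s - t) \<epsilon>)\<close>
  gives the Laplace transform of the ruin time of the perturbed surplus up to the probability \<open>p\<close> of
  ruin during the perturbation, and \<open>p = o(\<epsilon>)\<close> for positive initial surplus by choosing
  \<open>r = - 1 / sqrt \<epsilon>\<close> in the same formula. So the objective is explicit up to \<open>o(\<epsilon>)\<close>, and its
  derivative at \<open>\<epsilon> = 0\<close> is \<open>- (dbar - d)\<close> times
  \<open>1 + (dbar/\<rho>) r6 exp (r6 x) + (\<gamma>/2) (dbar/\<rho>)\<^sup>2 (r8 exp (r8 x) - 2 r6 exp (2 r6 x))\<close>, which is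
  nonnegative for small \<open>\<gamma>\<close> because \<open>1 + (dbar/\<rho>) r6 > 0\<close>.\<close>

section \<open>Increments of Brownian motion\<close>

text \<open>The obstacle is that \<open>surplus\<close> is an unspecified choice among solutions,
  and that solutions may separate at surplus zero, where the rate is free. The chosen solution is
  therefore never identified with the explicit process \<open>Z\<close>; it is shown to become
  negative at the same time as \<open>Z\<close> and to be positive before. A solution can outrun
  \<open>Z\<close> after its first zero by at most \<open>dbar\<close> per unit of time, and for
  this reason the crossing result is proved for a raised drift. Ruin is the entry into an open half
  line, which suits approximation of stopping times on grids from the right. Each estimate is an
  explicit value up to a multiple of \<open>p\<close>. For an empty perturbation
  \<open>p = 0\<close>, so the same lemmas give G and H exactly. At initial surplus zero
  \<open>p\<close> is not small, but there ruin is immediate and every payoff vanishes.\<close>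

lemma space_natural_filtration [simp]: "space (natural_filtration M B s) = space M"
  unfolding natural_filtration_def by (rule space_measure_of_conv)

lemma sets_natural_filtration:
  "sets (natural_filtration M B s) = sigma_sets (space M)
     ({B u -` A \<inter> space M | u A. 0 \<le> u \<and> u \<le> s \<and> A \<in> sets borel} \<union> null_sets M)"
  unfolding natural_filtration_def
  by (rule sets_measure_of) (use sets.sets_into_space in \<open>fastforce simp: null_sets_def\<close>)

lemma natural_filtration_mono:
  assumes "s \<le> s'"
  shows "sets (natural_filtration M B s) \<subseteq> sets (natural_filtration M B s')"
  unfolding sets_natural_filtration
  by (rule sigma_sets_mono') (use assms in \<open>auto intro: order_trans\<close>)

lemma subalgebra_natural_filtration:
  assumes "\<And>u. 0 \<le> u \<Longrightarrow> B u \<in> borel_measurable M"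
  shows "subalgebra M (natural_filtration M B s)"
  unfolding subalgebra_def sets_natural_filtration
  using assms by (auto intro!: sets.sigma_sets_subset)

lemma borel_measurable_natural_filtration:
  assumes "0 \<le> s"
  shows "B s \<in> borel_measurable (natural_filtration M B s)"
proof (rule measurableI)
  fix A :: "real set" assume "A \<in> sets borel"
  then show "B s -` A \<inter> space (natural_filtration M B s) \<in> sets (natural_filtration M B s)"
    unfolding sets_natural_filtration using assms by (auto intro!: sigma_sets.Basic)
qed auto

text \<open>Because null sets belong to every stage, altering \<open>B\<close> on a null set keeps
  it adapted; \<open>brownian_version\<close> relies on this to make all paths continuous.\<close>

lemma null_set_natural_filtration: "N \<in> null_sets M \<Longrightarrow> N \<in> sets (natural_filtration M B s)"
  unfolding sets_natural_filtration by (auto intro!: sigma_sets.Basic)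

text \<open>The definition of Brownian motion speaks only of increments along a mesh. Sorting
  \<open>0\<close>, \<open>s\<close> and the times in \<open>U\<close> produces such a mesh,
  extended by \<open>s'\<close>; past values are partial sums of its increments up to
  \<open>B 0\<close>, which vanishes almost surely.\<close>

lemma (in prob_space) brownian_cylinder_indep:
  assumes bm: "standard_brownian_motion M B"
    and s: "0 \<le> s" "s < s'"
    and U: "finite U" "U \<subseteq> {0..s}" and A: "\<And>u. u \<in> U \<Longrightarrow> A u \<in> sets borel"
    and D: "D \<in> sets borel"
  shows "prob ({\<omega>\<in>space M. \<forall>u\<in>U. B u \<omega> \<in> A u} \<inter> {\<omega>\<in>space M. B s' \<omega> - B s \<omega> \<in> D})
       = prob {\<omega>\<in>space M. \<forall>u\<in>U. B u \<omega> \<in> A u} * prob {\<omega>\<in>space M. B s' \<omega> - B s \<omega> \<in> D}"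
proof -
  have meas[measurable]: "B u \<in> borel_measurable M" if "0 \<le> u" for u
    using bm that by (auto simp: standard_brownian_motion_def)
  have B0: "AE \<omega> in M. B 0 \<omega> = 0" using bm by (auto simp: standard_brownian_motion_def)
  define l where "l = sorted_list_of_set (insert 0 (insert s U))"
  define m where "m = length l - 1"
  have setl: "set l = insert 0 (insert s U)" and sl: "sorted l"
    unfolding l_def using U(1) by (simp_all del: sorted_list_of_set_insert_remove)
  have lne: "l \<noteq> []" using setl by auto
  then have len: "length l = Suc m" by (cases l) (auto simp: m_def)
  have rng: "0 \<le> l ! i \<and> l ! i \<le> s" if "i \<le> m" for i
  proof -
    have "l ! i \<in> set l" using that len by auto
    then show ?thesis using setl U s by auto
  qed
  have l0: "l ! 0 = 0"
  proof -
    obtain i where "i < length l" "l ! i = 0" using setl by (metis in_set_conv_nth insertI1)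
    then have "l ! 0 \<le> 0" using sorted_nth_mono[OF sl, of 0 i] by auto
    then show ?thesis using rng[of 0] by auto
  qed
  have lm: "l ! m = s"
  proof -
    obtain i where i: "i < length l" "l ! i = s" using setl by (metis in_set_conv_nth insertI1 insertI2)
    then have "s \<le> l ! m" using sorted_nth_mono[OF sl, of i m] len by auto
    then show ?thesis using rng[of m] by auto
  qed
  \<comment> \<open>The hypothesis wants a monotone sequence on all naturals, so the mesh stays at
    \<open>s'\<close> after index \<open>m\<close>; increment number \<open>m\<close> is then the
    one from \<open>s\<close> to \<open>s'\<close>.\<close>
  define v where "v i = (if i \<le> m then l ! i else s')" for i
  have v: "0 \<le> v 0" "mono v" "\<And>i. 0 \<le> v i"
  proof -
    show "0 \<le> v 0" by (simp add: v_def l0)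
    have "l ! i \<le> s'" if "i \<le> m" for i using rng[OF that] s by linarith
    then show "mono v"
      using sorted_nth_mono[OF sl] len by (auto intro!: monoI simp: v_def)
    show "\<And>i. 0 \<le> v i" using rng s by (auto simp: v_def)
  qed
  define X where "X i \<omega> = B (v (Suc i)) \<omega> - B (v i) \<omega>" for i \<omega>
  have ind: "indep_vars (\<lambda>_. borel) X {..<Suc m}"
    using bm v by (auto simp: standard_brownian_motion_def X_def[abs_def])
  have tel: "(\<Sum>j<i. X j \<omega>) = B (v i) \<omega> - B 0 \<omega>" for i \<omega>
    unfolding X_def using sum_lessThan_telescope[of "\<lambda>i. B (v i) \<omega>" i] by (simp add: v_def l0)
  have Xm: "X m \<omega> = B s' \<omega> - B s \<omega>" for \<omega> by (simp add: X_def v_def lm)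
  have "\<exists>i\<le>m. v i = u" if "u \<in> U" for u
  proof -
    have "u \<in> set l" using that setl by auto
    then obtain i where "i < length l" "l ! i = u" by (metis in_set_conv_nth)
    then show ?thesis using len by (auto simp: v_def intro!: exI[of _ i])
  qed
  then obtain ix where ix: "\<And>u. u \<in> U \<Longrightarrow> ix u \<le> m" "\<And>u. u \<in> U \<Longrightarrow> v (ix u) = u" by metis
  define E where "E = {f\<in>space (PiM {..<m} (\<lambda>_. borel :: real measure)). \<forall>u\<in>U. (\<Sum>j<ix u. f j) \<in> A u}"
  define C where "C = {f\<in>space (PiM {m} (\<lambda>_. borel :: real measure)). f m \<in> D}"
  have E: "E \<in> sets (PiM {..<m} (\<lambda>_. borel))"
  proof -
    have [measurable]: "(\<lambda>f. \<Sum>j<ix u. f j) \<in> borel_measurable (PiM {..<m} (\<lambda>_. borel :: real measure))" if "u \<in> U" for u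
      using ix[OF that] by (intro borel_measurable_sum measurable_component_singleton) auto
    show ?thesis unfolding E_def using U(1) A by measurable
  qed
  have C: "C \<in> sets (PiM {m} (\<lambda>_. borel))" unfolding C_def using D by measurable
  let ?a = "\<lambda>\<omega>. restrict (\<lambda>i. X i \<omega>) {..<m}" and ?b = "\<lambda>\<omega>. restrict (\<lambda>i. X i \<omega>) {m}"
  have "indep_var (PiM {..<m} (\<lambda>_. borel)) ?a (PiM {m} (\<lambda>_. borel)) ?b"
    using ind by (intro indep_var_restrict[where I="{..<Suc m}"]) auto
  from indep_varD[OF this E C]
  have *: "prob ((\<lambda>x. (?a x, ?b x)) -` (E \<times> C) \<inter> space M) = prob (?a -` E \<inter> space M) * prob (?b -` C \<inter> space M)" .
  define E' where "E' = {\<omega>\<in>space M. \<forall>u\<in>U. B u \<omega> - B 0 \<omega> \<in> A u}"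
  define C' where "C' = {\<omega>\<in>space M. B s' \<omega> - B s \<omega> \<in> D}"
  have sum_res: "(\<Sum>j<ix u. ?a \<omega> j) = B u \<omega> - B 0 \<omega>" if "u \<in> U" for u \<omega>
  proof -
    have "(\<Sum>j<ix u. ?a \<omega> j) = (\<Sum>j<ix u. X j \<omega>)"
      using ix[OF that] by (intro sum.cong) auto
    then show ?thesis using ix[OF that] by (simp add: tel)
  qed
  have aE: "?a -` E \<inter> space M = E'"
    using sum_res by (auto simp: E_def E'_def space_PiM)
  have bC: "?b -` C \<inter> space M = C'"
    by (auto simp: C_def C'_def space_PiM Xm)
  have "(\<lambda>x. (?a x, ?b x)) -` (E \<times> C) \<inter> space M = E' \<inter> C'"
    using aE bC by blast
  with * aE bC have indE: "prob (E' \<inter> C') = prob E' * prob C'" by simp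
  let ?E = "{\<omega>\<in>space M. \<forall>u\<in>U. B u \<omega> \<in> A u}"
  have U0: "0 \<le> u" if "u \<in> U" for u using U that by auto
  have mA: "{\<omega>\<in>space M. B u \<omega> \<in> A u} \<in> events" "{\<omega>\<in>space M. B u \<omega> - B 0 \<omega> \<in> A u} \<in> events"
    if "u \<in> U" for u using A[OF that] U0[OF that] by measurable
  have meE: "?E \<in> events" "E' \<in> events"
    unfolding E'_def using U(1) mA by (auto intro!: sets.sets_Collect_finite_All)
  have "0 \<le> s'" using s by simp
  with s(1) have "(\<lambda>\<omega>. B s' \<omega> - B s \<omega>) \<in> borel_measurable M" by measurable
  from measurable_sets_Collect[OF this, of "\<lambda>y. y \<in> D"]
  have meC: "C' \<in> events" unfolding C'_def using D by simp
  have "prob (?E \<inter> C') = prob (E' \<inter> C')"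
    using B0 meE meC by (intro finite_measure_eq_AE) (auto simp: E'_def)
  moreover have "prob ?E = prob E'"
    using B0 meE by (intro finite_measure_eq_AE) (auto simp: E'_def)
  ultimately show ?thesis using indE by (simp add: C'_def)
qed

text \<open>Dynkin's argument: cylinder events together with the null sets form an
  intersection-stable generator of the augmented filtration. Null sets satisfy the product formula
  trivially, cylinder events by \<open>brownian_cylinder_indep\<close>.\<close>

lemma (in prob_space) natural_filtration_indep:
  assumes bm: "standard_brownian_motion M B" and s: "0 \<le> s" "s < s'"
  shows "indep_set (sets (natural_filtration M B s))
           {(\<lambda>\<omega>. B s' \<omega> - B s \<omega>) -` D \<inter> space M | D. D \<in> sets borel}"
proof -
  have meas[measurable]: "B u \<in> borel_measurable M" if "0 \<le> u" for u
    using bm that by (auto simp: standard_brownian_motion_def)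
  define Cyl where "Cyl = {{\<omega>\<in>space M. \<forall>u\<in>U. B u \<omega> \<in> A u} | U A.
    finite U \<and> U \<subseteq> {0..s} \<and> (\<forall>u. A u \<in> sets (borel :: real measure))}"
  let ?C = "{(\<lambda>\<omega>. B s' \<omega> - B s \<omega>) -` D \<inter> space M | D. D \<in> sets borel}"
  have Cyl_ev: "Cyl \<subseteq> events"
  proof
    fix E assume "E \<in> Cyl"
    then obtain U A where E: "E = {\<omega>\<in>space M. \<forall>u\<in>U. B u \<omega> \<in> A u}" "finite U" "U \<subseteq> {0..s}"
      "\<And>u. A u \<in> sets borel" by (auto simp: Cyl_def)
    have "{\<omega>\<in>space M. B u \<omega> \<in> A u} \<in> events" if "u \<in> U" for u
      using that E(3) E(4)[of u] by (intro measurable_sets_Collect[OF meas]) auto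
    then show "E \<in> events" unfolding E(1) using E(2) by (auto intro!: sets.sets_Collect_finite_All)
  qed
  have stable: "Int_stable (Cyl \<union> null_sets M)"
  proof (rule Int_stableI)
    fix a b assume ab: "a \<in> Cyl \<union> null_sets M" "b \<in> Cyl \<union> null_sets M"
    show "a \<inter> b \<in> Cyl \<union> null_sets M"
    proof (cases "a \<in> null_sets M \<or> b \<in> null_sets M")
      case True
      moreover have "a \<in> events" "b \<in> events" using ab Cyl_ev by auto
      ultimately show ?thesis by (auto intro: null_set_Int1 null_set_Int2)
    next
      case False
      with ab have "a \<in> Cyl" "b \<in> Cyl" by auto
      then obtain U1 A1 U2 A2 where
        1: "a = {\<omega>\<in>space M. \<forall>u\<in>U1. B u \<omega> \<in> A1 u}" "finite U1" "U1 \<subseteq> {0..s}" "\<And>u. A1 u \<in> sets borel" and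
        2: "b = {\<omega>\<in>space M. \<forall>u\<in>U2. B u \<omega> \<in> A2 u}" "finite U2" "U2 \<subseteq> {0..s}" "\<And>u. A2 u \<in> sets borel"
        by (auto simp: Cyl_def)
      let ?A = "\<lambda>u. (if u \<in> U1 then A1 u else UNIV) \<inter> (if u \<in> U2 then A2 u else UNIV)"
      have "a \<inter> b = {\<omega>\<in>space M. \<forall>u\<in>U1 \<union> U2. B u \<omega> \<in> ?A u}"
        unfolding 1 2 by (auto split: if_splits)
      moreover have "\<forall>u. ?A u \<in> sets borel" using 1 2 by auto
      ultimately have "a \<inter> b \<in> Cyl" unfolding Cyl_def
        using 1(2,3) 2(2,3) by (intro CollectI exI[of _ "U1 \<union> U2"] exI[of _ ?A]) auto
      then show ?thesis by auto
    qed
  qed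
  have "indep_set (Cyl \<union> null_sets M) ?C"
  proof (rule indep_setI)
    show "Cyl \<union> null_sets M \<subseteq> events" using Cyl_ev by auto
    have "0 \<le> s'" using s by simp
    then have "(\<lambda>\<omega>. B s' \<omega> - B s \<omega>) \<in> borel_measurable M" using s by measurable
    then show C_ev: "?C \<subseteq> events" by (auto intro: measurable_sets)
    fix a c assume a: "a \<in> Cyl \<union> null_sets M" and c: "c \<in> ?C"
    then obtain D where D: "D \<in> sets borel" "c = {\<omega>\<in>space M. B s' \<omega> - B s \<omega> \<in> D}" by auto
    show "prob (a \<inter> c) = prob a * prob c"
    proof (cases "a \<in> Cyl")
      case True
      then show ?thesis using brownian_cylinder_indep[OF bm s] D by (auto simp: Cyl_def)
    next
      case False
      then have "a \<in> null_sets M" using a by auto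
      moreover then have "a \<inter> c \<in> null_sets M" using c C_ev by (intro null_set_Int2) auto
      ultimately show ?thesis by (simp add: measure_eq_0_null_sets)
    qed
  qed
  then have "indep_set (sigma_sets (space M) (Cyl \<union> null_sets M)) (sigma_sets (space M) ?C)"
    using stable
  proof (rule indep_set_sigma_sets)
    show "Int_stable ?C"
    proof (rule Int_stableI)
      fix a b assume "a \<in> ?C" "b \<in> ?C"
      then obtain D1 D2 where "a = (\<lambda>\<omega>. B s' \<omega> - B s \<omega>) -` D1 \<inter> space M" "D1 \<in> sets borel"
        "b = (\<lambda>\<omega>. B s' \<omega> - B s \<omega>) -` D2 \<inter> space M" "D2 \<in> sets borel" by auto
      then show "a \<inter> b \<in> ?C" by (intro CollectI exI[of _ "D1 \<inter> D2"]) auto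
    qed
  qed
  moreover have "sets (natural_filtration M B s) \<subseteq> sigma_sets (space M) (Cyl \<union> null_sets M)"
    unfolding sets_natural_filtration
  proof (rule sigma_sets_mono', rule Un_mono)
    show "{B u -` A \<inter> space M | u A. 0 \<le> u \<and> u \<le> s \<and> A \<in> sets borel} \<subseteq> Cyl"
    proof safe
      fix u :: real and A :: "real set" assume "0 \<le> u" "u \<le> s" "A \<in> sets borel"
      then show "B u -` A \<inter> space M \<in> Cyl" unfolding Cyl_def
        by (intro CollectI exI[of _ "{u}"] exI[of _ "\<lambda>_. A"]) auto
    qed
  qed auto
  moreover have "?C \<subseteq> sigma_sets (space M) ?C" by auto
  ultimately show ?thesis unfolding indep_sets2_eq by blast
qed

text \<open>Exponential tilting: completing the square turns the weighted density into a multiple of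
  a shifted normal density, whose total mass is one.\<close>

lemma normal_density_mgf:
  fixes \<sigma> :: real assumes "0 < \<sigma>"
  shows "normal_density 0 \<sigma> x * exp (\<theta> * x) = exp (\<theta>\<^sup>2 * \<sigma>\<^sup>2 / 2) * normal_density (\<theta> * \<sigma>\<^sup>2) \<sigma> x"
proof -
  have "- (x - 0)\<^sup>2 / (2 * \<sigma>\<^sup>2) + \<theta> * x = \<theta>\<^sup>2 * \<sigma>\<^sup>2 / 2 + - (x - \<theta> * \<sigma>\<^sup>2)\<^sup>2 / (2 * \<sigma>\<^sup>2)"
    using assms by (simp add: field_simps power2_eq_square)
  then show ?thesis unfolding normal_density_def by (simp add: exp_add[symmetric] mult.assoc mult.left_commute)
qed

lemma (in prob_space) normal_mgf:
  assumes "0 < \<sigma>" and X: "distributed M lborel X (normal_density 0 \<sigma>)"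
  shows "integrable M (\<lambda>\<omega>. exp (\<theta> * X \<omega>))" "expectation (\<lambda>\<omega>. exp (\<theta> * X \<omega>)) = exp (\<theta>\<^sup>2 * \<sigma>\<^sup>2 / 2)"
proof -
  show "integrable M (\<lambda>\<omega>. exp (\<theta> * X \<omega>))"
    by (subst distributed_integrable[OF X, symmetric])
       (use assms in \<open>auto simp: normal_density_mgf\<close>)
  have "expectation (\<lambda>\<omega>. exp (\<theta> * X \<omega>)) = (\<integral>x. normal_density 0 \<sigma> x * exp (\<theta> * x) \<partial>lborel)"
    by (subst distributed_integral[OF X, symmetric]) auto
  then show "expectation (\<lambda>\<omega>. exp (\<theta> * X \<omega>)) = exp (\<theta>\<^sup>2 * \<sigma>\<^sup>2 / 2)"
    using assms by (simp add: normal_density_mgf)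
qed

section \<open>Submartingales and discrete optional stopping\<close>

text \<open>Abstracts from \<open>B\<close> and its natural filtration. Paths are continuous
  everywhere, not merely almost everywhere, so that limits along grids exist at every outcome and
  yield measurability directly.\<close>

locale brownian_filtration = prob_space M for M :: "'w measure" +
  fixes F :: "real \<Rightarrow> 'w measure" and W :: "real \<Rightarrow> 'w \<Rightarrow> real"
  assumes subalg: "0 \<le> s \<Longrightarrow> subalgebra M (F s)"
    and filt_mono: "0 \<le> s \<Longrightarrow> s \<le> s' \<Longrightarrow> sets (F s) \<subseteq> sets (F s')"
    and adapted: "0 \<le> s \<Longrightarrow> W s \<in> borel_measurable (F s)"
    and cont: "\<omega> \<in> space M \<Longrightarrow> continuous_on {0..} (\<lambda>s. W s \<omega>)"
    and indep: "0 \<le> s \<Longrightarrow> s < s' \<Longrightarrow>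
      indep_set (sets (F s)) {(\<lambda>\<omega>. W s' \<omega> - W s \<omega>) -` D \<inter> space M | D. D \<in> sets borel}"
    and normal: "0 \<le> s \<Longrightarrow> s < s' \<Longrightarrow>
      distributed M lborel (\<lambda>\<omega>. W s' \<omega> - W s \<omega>) (normal_density 0 (sqrt (s' - s)))"
begin

lemma space_F [simp]: "0 \<le> s \<Longrightarrow> space (F s) = space M"
  using subalg by (auto simp: subalgebra_def)

lemma F_events: "0 \<le> s \<Longrightarrow> A \<in> sets (F s) \<Longrightarrow> A \<in> events"
  using subalg by (auto simp: subalgebra_def)

lemma F_measurable: "0 \<le> s \<Longrightarrow> f \<in> borel_measurable (F s) \<Longrightarrow> f \<in> borel_measurable M"
  by (rule measurable_from_subalg[OF subalg])

lemma F_measurable_mono: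
  assumes "0 \<le> s" "s \<le> s'" "f \<in> borel_measurable (F s)"
  shows "f \<in> borel_measurable (F s')"
  using assms filt_mono[OF assms(1,2)] by (auto simp: measurable_def)

lemma W_measurable [measurable]: "0 \<le> s \<Longrightarrow> W s \<in> borel_measurable M"
  using F_measurable adapted by blast

text \<open>Replaces conditioning on \<open>F s\<close>: the preimages under \<open>f\<close> lie in
  \<open>F s\<close>, so \<open>f\<close> is independent of the increment and the expectation
  factorises.\<close>

lemma expectation_times_incr:
  fixes f :: "'w \<Rightarrow> real" and g :: "real \<Rightarrow> real"
  assumes s: "0 \<le> s" "s < s'" and f: "f \<in> borel_measurable (F s)" "integrable M f"
    and g: "g \<in> borel_measurable borel" "integrable M (\<lambda>\<omega>. g (W s' \<omega> - W s \<omega>))"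
  shows "integrable M (\<lambda>\<omega>. f \<omega> * g (W s' \<omega> - W s \<omega>))" (is ?int)
    "expectation (\<lambda>\<omega>. f \<omega> * g (W s' \<omega> - W s \<omega>)) = expectation f * expectation (\<lambda>\<omega>. g (W s' \<omega> - W s \<omega>))"
    (is ?eq)
proof -
  let ?D = "\<lambda>\<omega>. W s' \<omega> - W s \<omega>"
  let ?C = "\<lambda>h. {h -` A \<inter> space M | A. A \<in> sets (borel :: real measure)}"
  have "0 \<le> s'" using s by simp
  with s(1) have dist_meas: "?D \<in> borel_measurable M" by measurable
  have st: "Int_stable (?C h)" for h :: "'w \<Rightarrow> real"
  proof (rule Int_stableI)
    fix a b assume "a \<in> ?C h" "b \<in> ?C h"
    then obtain A B where "a = h -` A \<inter> space M" "A \<in> sets borel" "b = h -` B \<inter> space M" "B \<in> sets borel"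
      by auto
    then show "a \<inter> b \<in> ?C h" by (intro CollectI exI[of _ "A \<inter> B"]) auto
  qed
  have sub: "?C f \<subseteq> sets (F s)"
  proof safe
    fix A :: "real set" assume "A \<in> sets borel"
    from measurable_sets[OF f(1) this] show "f -` A \<inter> space M \<in> sets (F s)" using s by simp
  qed
  have "indep_set (?C f) (?C ?D)"
  proof (rule indep_setI)
    show "?C f \<subseteq> events" using sub F_events[OF s(1)] by (meson subset_eq)
    show "?C ?D \<subseteq> events" by (rule indep_setD_ev2[OF indep[OF s]])
    show "prob (a \<inter> b) = prob a * prob b" if "a \<in> ?C f" "b \<in> ?C ?D" for a b
      by (rule indep_setD[OF indep[OF s] subsetD[OF sub that(1)] that(2)])
  qed
  then have "indep_set (sigma_sets (space M) (?C f)) (sigma_sets (space M) (?C ?D))"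
    using st by (intro indep_set_sigma_sets)
  then have "indep_var borel f borel ?D"
    unfolding indep_var_eq using F_measurable[OF s(1) f(1)] dist_meas by (intro conjI)
  from indep_var_compose[OF this measurable_ident g(1)]
  have "indep_var borel f borel (\<lambda>\<omega>. g (?D \<omega>))" by (simp add: comp_def id_def)
  then show ?int ?eq using f(2) g(2) by (auto intro: indep_var_integrable indep_var_lebesgue_integral)
qed

lemma exp_incr:
  assumes "0 \<le> s" "s \<le> s'"
  shows "integrable M (\<lambda>\<omega>. exp (\<theta> * (W s' \<omega> - W s \<omega>)))"
    "expectation (\<lambda>\<omega>. exp (\<theta> * (W s' \<omega> - W s \<omega>))) = exp (\<theta>\<^sup>2 / 2 * (s' - s))"
proof -
  have "integrable M (\<lambda>\<omega>. exp (\<theta> * (W s' \<omega> - W s \<omega>))) \<and>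
    expectation (\<lambda>\<omega>. exp (\<theta> * (W s' \<omega> - W s \<omega>))) = exp (\<theta>\<^sup>2 / 2 * (s' - s))"
  proof (cases "s = s'")
    case True
    then show ?thesis by (simp add: prob_space)
  next
    case False
    then have "s < s'" using assms by auto
    with normal_mgf[OF _ normal[OF assms(1) this], of \<theta>] show ?thesis by simp
  qed
  then show "integrable M (\<lambda>\<omega>. exp (\<theta> * (W s' \<omega> - W s \<omega>)))"
    "expectation (\<lambda>\<omega>. exp (\<theta> * (W s' \<omega> - W s \<omega>))) = exp (\<theta>\<^sup>2 / 2 * (s' - s))" by auto
qed

text \<open>Testing on events of \<open>F s\<close> avoids conditional expectations. The index set
  is a parameter so that the property passes to finite grids.\<close>

definition submartingale_on :: "real set \<Rightarrow> (real \<Rightarrow> 'w \<Rightarrow> real) \<Rightarrow> bool" where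
  "submartingale_on I N \<longleftrightarrow>
     (\<forall>s\<in>I. N s \<in> borel_measurable (F s) \<and> integrable M (N s)) \<and>
     (\<forall>s\<in>I. \<forall>s'\<in>I. s \<le> s' \<longrightarrow> (\<forall>A\<in>sets (F s).
        expectation (\<lambda>\<omega>. indicator A \<omega> * N s \<omega>) \<le> expectation (\<lambda>\<omega>. indicator A \<omega> * N s' \<omega>)))"

lemma exp_incr_times:
  assumes s: "0 \<le> s" "s \<le> s'" and f: "f \<in> borel_measurable (F s)" "integrable M f"
  shows "integrable M (\<lambda>\<omega>. f \<omega> * exp (\<theta> * (W s' \<omega> - W s \<omega>) - \<theta>\<^sup>2 / 2 * (s' - s)))"
    "expectation (\<lambda>\<omega>. f \<omega> * exp (\<theta> * (W s' \<omega> - W s \<omega>) - \<theta>\<^sup>2 / 2 * (s' - s))) = expectation f"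
proof -
  have "integrable M (\<lambda>\<omega>. f \<omega> * exp (\<theta> * (W s' \<omega> - W s \<omega>) - \<theta>\<^sup>2 / 2 * (s' - s))) \<and>
    expectation (\<lambda>\<omega>. f \<omega> * exp (\<theta> * (W s' \<omega> - W s \<omega>) - \<theta>\<^sup>2 / 2 * (s' - s))) = expectation f"
  proof (cases "s = s'")
    case True
    then show ?thesis using f by simp
  next
    case False
    then have s2: "s < s'" using s by auto
    have eq: "f \<omega> * exp (\<theta> * (W s' \<omega> - W s \<omega>) - \<theta>\<^sup>2 / 2 * (s' - s))
      = (f \<omega> * exp (\<theta> * (W s' \<omega> - W s \<omega>))) * exp (- (\<theta>\<^sup>2 / 2 * (s' - s)))" for \<omega>
      by (simp only: mult.assoc exp_add[symmetric]) (simp add: algebra_simps)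
    have m: "(\<lambda>y. exp (\<theta> * y)) \<in> borel_measurable borel" by measurable
    note * = expectation_times_incr[OF s(1) s2 f m exp_incr(1)[OF s, of \<theta>]]
    show ?thesis unfolding eq
    proof
      show "integrable M (\<lambda>\<omega>. f \<omega> * exp (\<theta> * (W s' \<omega> - W s \<omega>)) * exp (- (\<theta>\<^sup>2 / 2 * (s' - s))))"
        using *(1) by (rule integrable_mult_left)
      show "expectation (\<lambda>\<omega>. f \<omega> * exp (\<theta> * (W s' \<omega> - W s \<omega>)) * exp (- (\<theta>\<^sup>2 / 2 * (s' - s)))) = expectation f"
        unfolding integral_mult_left_zero *(2) exp_incr(2)[OF s, of \<theta>]
        by (simp only: mult.assoc exp_add[symmetric]) simp
    qed
  qed
  then show "integrable M (\<lambda>\<omega>. f \<omega> * exp (\<theta> * (W s' \<omega> - W s \<omega>) - \<theta>\<^sup>2 / 2 * (s' - s)))"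
    "expectation (\<lambda>\<omega>. f \<omega> * exp (\<theta> * (W s' \<omega> - W s \<omega>) - \<theta>\<^sup>2 / 2 * (s' - s))) = expectation f" by auto
qed

text \<open>The exponential factor is the ratio of two values of the Wald martingale and averages to
  one over every event of \<open>F s\<close>, so a pointwise comparison suffices. Equality serves
  martingales, the inequality serves processes whose drift is only bounded.\<close>

lemma submartingale_onI:
  assumes I: "I \<subseteq> {0..}"
    and N: "\<And>s. s \<in> I \<Longrightarrow> N s \<in> borel_measurable (F s)" "\<And>s. s \<in> I \<Longrightarrow> integrable M (N s)"
    and ge: "\<And>s s' \<omega>. s \<in> I \<Longrightarrow> s' \<in> I \<Longrightarrow> s \<le> s' \<Longrightarrow> \<omega> \<in> space M \<Longrightarrow>
      N s \<omega> * exp (\<theta> * (W s' \<omega> - W s \<omega>) - \<theta>\<^sup>2 / 2 * (s' - s)) \<le> N s' \<omega>"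
  shows "submartingale_on I N"
  unfolding submartingale_on_def
proof (intro conjI ballI impI)
  fix s s' A assume s: "s \<in> I" "s' \<in> I" "s \<le> s'" and A: "A \<in> sets (F s)"
  have s0: "0 \<le> s" using s I by auto
  have Am: "A \<in> events" using F_events[OF s0 A] .
  let ?f = "\<lambda>\<omega>. indicator A \<omega> * N s \<omega>"
  have f: "?f \<in> borel_measurable (F s)" "integrable M ?f"
    using A N s Am by (auto intro!: borel_measurable_times borel_measurable_indicator integrable_real_mult_indicator simp: mult.commute[of _ "N s _"])
  have "expectation ?f = expectation (\<lambda>\<omega>. ?f \<omega> * exp (\<theta> * (W s' \<omega> - W s \<omega>) - \<theta>\<^sup>2 / 2 * (s' - s)))"
    using exp_incr_times[OF s0 s(3) f] by simp
  also have "\<dots> \<le> expectation (\<lambda>\<omega>. indicator A \<omega> * N s' \<omega>)"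
  proof (rule integral_mono)
    show "integrable M (\<lambda>\<omega>. ?f \<omega> * exp (\<theta> * (W s' \<omega> - W s \<omega>) - \<theta>\<^sup>2 / 2 * (s' - s)))"
      using exp_incr_times[OF s0 s(3) f] by simp
    show "integrable M (\<lambda>\<omega>. indicator A \<omega> * N s' \<omega>)"
      using N s Am by (auto intro!: integrable_real_mult_indicator simp: mult.commute[of _ "N s' _"])
  qed (use ge s in \<open>auto simp: indicator_def\<close>)
  finally show "expectation ?f \<le> expectation (\<lambda>\<omega>. indicator A \<omega> * N s' \<omega>)" .
qed (use N in auto)

lemma submartingale_on_subset: "submartingale_on I N \<Longrightarrow> J \<subseteq> I \<Longrightarrow> submartingale_on J N"
  unfolding submartingale_on_def by blast

text \<open>The difference of the stopped values telescopes over the events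
  \<open>\<sigma> \<le> i < \<tau>\<close>. Each is decided at time \<open>v i\<close>, so the
  corresponding step has nonnegative mean.\<close>

lemma discrete_optional_stopping:
  fixes v :: "nat \<Rightarrow> real" and \<sigma> \<tau> :: "'w \<Rightarrow> nat"
  assumes sub: "submartingale_on (v ` {..n}) N" and v: "mono v" "0 \<le> v 0"
    and st: "\<And>i. i \<le> n \<Longrightarrow> {\<omega>\<in>space M. \<sigma> \<omega> \<le> i} \<in> sets (F (v i))"
      "\<And>i. i \<le> n \<Longrightarrow> {\<omega>\<in>space M. \<tau> \<omega> \<le> i} \<in> sets (F (v i))"
    and le: "\<And>\<omega>. \<omega> \<in> space M \<Longrightarrow> \<sigma> \<omega> \<le> \<tau> \<omega>" "\<And>\<omega>. \<omega> \<in> space M \<Longrightarrow> \<tau> \<omega> \<le> n"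
  shows "integrable M (\<lambda>\<omega>. N (v (\<sigma> \<omega>)) \<omega>)" "integrable M (\<lambda>\<omega>. N (v (\<tau> \<omega>)) \<omega>)"
    "expectation (\<lambda>\<omega>. N (v (\<sigma> \<omega>)) \<omega>) \<le> expectation (\<lambda>\<omega>. N (v (\<tau> \<omega>)) \<omega>)"
proof -
  have v0: "0 \<le> v i" for i using v monoD[OF v(1), of 0 i] by auto
  have N: "N (v i) \<in> borel_measurable (F (v i))" "integrable M (N (v i))" if "i \<le> n" for i
    using sub that by (auto simp: submartingale_on_def)
  have int: "integrable M (\<lambda>\<omega>. N (v (\<rho> \<omega>)) \<omega>)"
    if "\<And>i. i \<le> n \<Longrightarrow> {\<omega>\<in>space M. \<rho> \<omega> \<le> i} \<in> sets (F (v i))" "\<And>\<omega>. \<omega> \<in> space M \<Longrightarrow> \<rho> \<omega> \<le> n" for \<rho> :: "'w \<Rightarrow> nat"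
  proof -
    have ev: "{\<omega>\<in>space M. \<rho> \<omega> \<le> i} \<in> events" if "i \<le> n" for i
      using F_events v0 \<open>\<And>i. i \<le> n \<Longrightarrow> {\<omega>\<in>space M. \<rho> \<omega> \<le> i} \<in> sets (F (v i))\<close> that by blast
    have ev2: "{\<omega>\<in>space M. \<rho> \<omega> = i} \<in> events" if "i \<le> n" for i
    proof (cases i)
      case 0 then show ?thesis using ev[of 0] by simp
    next
      case (Suc j)
      have "{\<omega>\<in>space M. \<rho> \<omega> = i} = {\<omega>\<in>space M. \<rho> \<omega> \<le> i} - {\<omega>\<in>space M. \<rho> \<omega> \<le> j}" using Suc by auto
      then show ?thesis using ev that Suc by auto
    qed
    have "integrable M (\<lambda>\<omega>. \<Sum>i\<le>n. N (v i) \<omega> * indicator {\<omega>\<in>space M. \<rho> \<omega> = i} \<omega>)"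
      using N ev2 by (intro Bochner_Integration.integrable_sum integrable_real_mult_indicator) auto
    moreover have "(\<Sum>i\<le>n. N (v i) \<omega> * indicator {\<omega>\<in>space M. \<rho> \<omega> = i} \<omega>) = N (v (\<rho> \<omega>)) \<omega>"
      if "\<omega> \<in> space M" for \<omega>
    proof -
      have "(\<Sum>i\<le>n. N (v i) \<omega> * indicator {\<omega>\<in>space M. \<rho> \<omega> = i} \<omega>) = (\<Sum>i\<le>n. if i = \<rho> \<omega> then N (v i) \<omega> else 0)"
        using that by (intro sum.cong) (auto simp: indicator_def)
      also have "\<dots> = N (v (\<rho> \<omega>)) \<omega>"
        using \<open>\<And>\<omega>. \<omega> \<in> space M \<Longrightarrow> \<rho> \<omega> \<le> n\<close>[OF that] by simp
      finally show ?thesis .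
    qed
    ultimately show ?thesis by (simp cong: Bochner_Integration.integrable_cong)
  qed
  show i\<sigma>: "integrable M (\<lambda>\<omega>. N (v (\<sigma> \<omega>)) \<omega>)" using int st le by (meson order_trans)
  show i\<tau>: "integrable M (\<lambda>\<omega>. N (v (\<tau> \<omega>)) \<omega>)" using int st le by blast
  let ?A = "\<lambda>i. {\<omega>\<in>space M. \<sigma> \<omega> \<le> i} - {\<omega>\<in>space M. \<tau> \<omega> \<le> i}"
  have A: "?A i \<in> sets (F (v i))" if "i \<le> n" for i using st that by auto
  have tel: "N (v (\<tau> \<omega>)) \<omega> - N (v (\<sigma> \<omega>)) \<omega>
      = (\<Sum>i<n. indicator (?A i) \<omega> * N (v (Suc i)) \<omega> - indicator (?A i) \<omega> * N (v i) \<omega>)"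
    if w: "\<omega> \<in> space M" for \<omega>
  proof -
    have "(\<Sum>i<n. indicator (?A i) \<omega> * N (v (Suc i)) \<omega> - indicator (?A i) \<omega> * N (v i) \<omega>)
        = (\<Sum>i<n. if i \<in> {\<sigma> \<omega>..<\<tau> \<omega>} then N (v (Suc i)) \<omega> - N (v i) \<omega> else 0)"
      using w by (intro sum.cong) (auto simp: indicator_def)
    also have "\<dots> = (\<Sum>i\<in>{\<sigma> \<omega>..<\<tau> \<omega>}. N (v (Suc i)) \<omega> - N (v i) \<omega>)"
      using le[OF w] by (subst sum.inter_restrict[symmetric]) (auto intro!: sum.cong)
    also have "\<dots> = N (v (\<tau> \<omega>)) \<omega> - N (v (\<sigma> \<omega>)) \<omega>"
      using le(1)[OF w] by (rule sum_Suc_diff')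
    finally show ?thesis by simp
  qed
  have iN: "integrable M (\<lambda>\<omega>. indicator (?A i) \<omega> * N (v j) \<omega>)" if "i \<le> n" "j \<le> n" for i j
    using N(2)[OF that(2)] F_events[OF v0 A[OF that(1)]]
    by (subst mult.commute) (rule integrable_real_mult_indicator)
  have "0 \<le> (\<Sum>i<n. expectation (\<lambda>\<omega>. indicator (?A i) \<omega> * N (v (Suc i)) \<omega>) - expectation (\<lambda>\<omega>. indicator (?A i) \<omega> * N (v i) \<omega>))"
  proof (rule sum_nonneg)
    fix i assume "i \<in> {..<n}"
    then show "0 \<le> expectation (\<lambda>\<omega>. indicator (?A i) \<omega> * N (v (Suc i)) \<omega>) - expectation (\<lambda>\<omega>. indicator (?A i) \<omega> * N (v i) \<omega>)"
      using sub A[of i] monoD[OF v(1), of i "Suc i"] unfolding submartingale_on_def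
      by (auto simp del: sets.Diff)
  qed
  also have "\<dots> = expectation (\<lambda>\<omega>. \<Sum>i<n. indicator (?A i) \<omega> * N (v (Suc i)) \<omega> - indicator (?A i) \<omega> * N (v i) \<omega>)"
    using iN by (simp add: Suc_leI less_imp_le)
  also have "\<dots> = expectation (\<lambda>\<omega>. N (v (\<tau> \<omega>)) \<omega> - N (v (\<sigma> \<omega>)) \<omega>)"
    using tel by (intro Bochner_Integration.integral_cong) auto
  also have "\<dots> = expectation (\<lambda>\<omega>. N (v (\<tau> \<omega>)) \<omega>) - expectation (\<lambda>\<omega>. N (v (\<sigma> \<omega>)) \<omega>)"
    using i\<sigma> i\<tau> by simp
  finally show "expectation (\<lambda>\<omega>. N (v (\<sigma> \<omega>)) \<omega>) \<le> expectation (\<lambda>\<omega>. N (v (\<tau> \<omega>)) \<omega>)" by simp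
qed

end

section \<open>Optional stopping at hitting times\<close>

text \<open>Inserting \<open>T\<close> keeps the infimum nonempty and caps it, so the value
  \<open>T\<close> also covers the case that \<open>P\<close> never occurs.\<close>

definition hit :: "(real \<Rightarrow> 'w \<Rightarrow> bool) \<Rightarrow> real \<Rightarrow> real \<Rightarrow> 'w \<Rightarrow> real" where
  "hit P t T \<omega> = Inf (insert T {s. t \<le> s \<and> s \<le> T \<and> P s \<omega>})"

definition grid :: "real \<Rightarrow> real \<Rightarrow> nat \<Rightarrow> nat \<Rightarrow> real" where
  "grid t T n i = t + (T - t) * real i / real (Suc n)"

text \<open>The last index counts as a stop whether or not \<open>P\<close> holds there, the
  discrete counterpart of the cap at \<open>T\<close>.\<close>

definition grid_index :: "(real \<Rightarrow> 'w \<Rightarrow> bool) \<Rightarrow> real \<Rightarrow> real \<Rightarrow> nat \<Rightarrow> 'w \<Rightarrow> nat" where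
  "grid_index P t T n \<omega> = (LEAST i. i = Suc n \<or> i < Suc n \<and> P (grid t T n i) \<omega>)"

text \<open>Open sublevel sets of continuous paths have this property. It excludes visits that last
  only an instant, which grids could miss.\<close>

definition right_open :: "real \<Rightarrow> real \<Rightarrow> (real \<Rightarrow> bool) \<Rightarrow> bool" where
  "right_open t T P \<longleftrightarrow> (\<forall>s. t \<le> s \<longrightarrow> s < T \<longrightarrow> P s \<longrightarrow> (\<exists>e>0. \<forall>s'. s \<le> s' \<longrightarrow> s' < s + e \<longrightarrow> P s'))"

lemma hit_le: "t \<le> T \<Longrightarrow> hit P t T \<omega> \<le> T"
  unfolding hit_def by (rule cInf_lower) (auto intro!: bdd_belowI[of _ t])

lemma hit_ge: "t \<le> T \<Longrightarrow> t \<le> hit P t T \<omega>"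
  unfolding hit_def by (rule cInf_greatest) auto

lemma hit_lower: "t \<le> s \<Longrightarrow> s \<le> T \<Longrightarrow> P s \<omega> \<Longrightarrow> hit P t T \<omega> \<le> s"
  unfolding hit_def by (rule cInf_lower) (auto intro!: bdd_belowI[of _ t])

lemma hit_lessD:
  assumes "hit P t T \<omega> < c" "c \<le> T"
  obtains s where "t \<le> s" "s < c" "P s \<omega>"
proof -
  from assms(1) have "\<exists>x\<in>insert T {s. t \<le> s \<and> s \<le> T \<and> P s \<omega>}. x < c"
    unfolding hit_def by (rule cInf_lessD[rotated]) simp
  then show ?thesis using that assms by auto
qed

lemma grid_0 [simp]: "grid t T n 0 = t" and grid_Suc [simp]: "grid t T n (Suc n) = T"
  unfolding grid_def by (auto simp del: of_nat_Suc)

lemma grid_mono: "t \<le> T \<Longrightarrow> mono (grid t T n)"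
  unfolding grid_def by (auto intro!: monoI divide_right_mono mult_left_mono)

lemma grid_bounds: "t \<le> T \<Longrightarrow> t \<le> grid t T n i" "t \<le> T \<Longrightarrow> i \<le> Suc n \<Longrightarrow> grid t T n i \<le> T"
  using monoD[OF grid_mono[of t T n], of 0 i] monoD[OF grid_mono[of t T n], of i "Suc n"] by auto

lemma grid_index_le: "grid_index P t T n \<omega> \<le> Suc n"
  unfolding grid_index_def by (rule Least_le) simp

lemma grid_index_cases: "grid_index P t T n \<omega> = Suc n \<or> grid_index P t T n \<omega> < Suc n \<and> P (grid t T n (grid_index P t T n \<omega>)) \<omega>"
  unfolding grid_index_def by (rule LeastI[of _ "Suc n"]) simp

lemma grid_index_lower: "i < Suc n \<Longrightarrow> P (grid t T n i) \<omega> \<Longrightarrow> grid_index P t T n \<omega> \<le> i"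
  unfolding grid_index_def by (rule Least_le) simp

lemma grid_index_antimono:
  assumes "\<And>s. Q s \<omega> \<Longrightarrow> P s \<omega>"
  shows "grid_index P t T n \<omega> \<le> grid_index Q t T n \<omega>"
  using grid_index_cases[of Q t T n \<omega>] grid_index_le[of P t T n \<omega>] grid_index_lower[of _ n P t T \<omega>] assms
  by auto

lemma grid_index_le_iff:
  "grid_index P t T n \<omega> \<le> i \<longleftrightarrow> Suc n \<le> i \<or> (\<exists>j\<le>i. j < Suc n \<and> P (grid t T n j) \<omega>)"
  using grid_index_cases[of P t T n \<omega>] grid_index_le[of P t T n \<omega>] grid_index_lower[of _ n P t T \<omega>]
  by (metis le_trans)

lemma hit_le_grid:
  assumes "t \<le> T"
  shows "hit P t T \<omega> \<le> grid t T n (grid_index P t T n \<omega>)"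
  using grid_index_cases[of P t T n \<omega>] hit_le[OF assms, of P \<omega>]
    hit_lower[of t "grid t T n (grid_index P t T n \<omega>)" T P \<omega>] grid_bounds[OF assms]
  by (metis grid_Suc less_imp_le)

text \<open>A grid stop never precedes the hitting time. Conversely a visit at some \<open>s\<close>
  close to it persists on an interval to the right of \<open>s\<close>, and a sufficiently fine grid
  has a point there.\<close>

lemma grid_tendsto_hit:
  assumes tT: "t \<le> T" and op: "right_open t T (\<lambda>s. P s \<omega>)"
  shows "(\<lambda>n. grid t T n (grid_index P t T n \<omega>)) \<longlonglongrightarrow> hit P t T \<omega>"
proof (rule order_tendstoI)
  fix a assume "a < hit P t T \<omega>"
  then show "\<forall>\<^sub>F n in sequentially. a < grid t T n (grid_index P t T n \<omega>)"
    using hit_le_grid[OF tT, of P \<omega>] by (auto intro: always_eventually less_le_trans)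
next
  fix a assume a: "hit P t T \<omega> < a"
  show "\<forall>\<^sub>F n in sequentially. grid t T n (grid_index P t T n \<omega>) < a"
  proof (cases "a > T")
    case True
    then show ?thesis 
      using grid_bounds(2)[OF tT grid_index_le[of P t T]] by (intro always_eventually allI) (rule le_less_trans)
  next
    case False
    then obtain s where s: "t \<le> s" "s < a" "P s \<omega>" using hit_lessD[OF a] by auto
    then have sT: "s < T" using False by simp
    with s op obtain e where e: "e > 0" "\<And>s'. s \<le> s' \<Longrightarrow> s' < s + e \<Longrightarrow> P s' \<omega>"
      unfolding right_open_def by metis
    define c where "c = min (s + e) a"
    have c: "s < c" "c \<le> T" "c \<le> a" using e s False by (auto simp: c_def)
    have TT: "T - t > 0" using sT s by simp
    have "(\<lambda>n. (T - t) / real (Suc n)) \<longlonglongrightarrow> 0"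
      by (rule LIMSEQ_Suc) (rule lim_const_over_n)
    then have "\<forall>\<^sub>F n in sequentially. (T - t) / real (Suc n) < c - s"
      using c by (auto intro: order_tendstoD)
    then show ?thesis
    proof eventually_elim
      case (elim n)
      \<comment> \<open>First grid point at or after \<open>s\<close>; a mesh smaller than
        \<open>c - s\<close> places it before \<open>c\<close>, hence inside the visit.\<close>
      define i where "i = nat \<lceil>(s - t) * real (Suc n) / (T - t)\<rceil>"
      have pos: "0 \<le> (s - t) * real (Suc n) / (T - t)" using s TT by simp
      have i: "(s - t) * real (Suc n) / (T - t) \<le> real i" "real i < (s - t) * real (Suc n) / (T - t) + 1"
        unfolding i_def using pos by linarith+
      have 1: "s \<le> grid t T n i"
      proof -
        have "(s - t) * real (Suc n) \<le> real i * (T - t)" using i(1) TT by (simp add: pos_divide_le_eq)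
        then have "s - t \<le> (T - t) * real i / real (Suc n)" by (simp add: pos_le_divide_eq mult.commute del: of_nat_Suc)
        then show ?thesis by (simp add: grid_def)
      qed
      have 2: "grid t T n i < c"
      proof -
        have "real i * (T - t) < (s - t) * real (Suc n) + (T - t)"
          using mult_strict_right_mono[OF i(2) TT] TT by (simp add: distrib_right del: of_nat_Suc)
        then have "(T - t) * real i / real (Suc n) < ((s - t) * real (Suc n) + (T - t)) / real (Suc n)"
          by (intro divide_strict_right_mono) (auto simp: mult.commute)
        also have "\<dots> = (s - t) + (T - t) / real (Suc n)" by (simp add: add_divide_distrib del: of_nat_Suc)
        finally show ?thesis using elim by (simp add: grid_def)
      qed
      have "i < Suc n"
      proof (rule ccontr)
        assume "\<not> i < Suc n"
        then have "grid t T n (Suc n) \<le> grid t T n i" by (intro monoD[OF grid_mono[OF tT]]) simp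
        then show False using 2 c by simp
      qed
      moreover have "P (grid t T n i) \<omega>" using e(2) 1 2 by (simp add: c_def)
      ultimately have "grid_index P t T n \<omega> \<le> i" by (rule grid_index_lower)
      then have "grid t T n (grid_index P t T n \<omega>) \<le> grid t T n i" by (intro monoD[OF grid_mono[OF tT]])
      then show ?case using 2 c by simp
    qed
  qed
qed

text \<open>An L2 bound makes the sequence uniformly integrable: truncation at level
  \<open>D\<close> changes each expectation by at most \<open>K / D\<close>, and the truncated
  variables converge by domination.\<close>

lemma (in prob_space) expectation_tendsto_of_L2_bounded:
  fixes X :: "nat \<Rightarrow> 'a \<Rightarrow> real"
  assumes X: "\<And>n. X n \<in> borel_measurable M" "\<And>n. integrable M (\<lambda>\<omega>. (X n \<omega>)\<^sup>2)"
    "\<And>n. expectation (\<lambda>\<omega>. (X n \<omega>)\<^sup>2) \<le> K"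
    and lim: "\<And>\<omega>. \<omega> \<in> space M \<Longrightarrow> (\<lambda>n. X n \<omega>) \<longlonglongrightarrow> Y \<omega>"
    and Y: "\<And>\<omega>. \<omega> \<in> space M \<Longrightarrow> \<bar>Y \<omega>\<bar> \<le> C"
  shows "(\<lambda>n. expectation (X n)) \<longlonglongrightarrow> expectation Y"
proof (rule LIMSEQ_I)
  fix r :: real assume r: "0 < r"
  have K: "0 \<le> K" using X(3)[of 0] by (rule order_trans[rotated]) simp
  \<comment> \<open>Large enough that truncation leaves the bounded limit \<open>Y\<close> untouched
    and costs less than half of the tolerance.\<close>
  define D where "D = max (max C 1) (2 * K / r + 1)"
  have D: "D > 0" "C \<le> D" "K / D < r / 2"
  proof -
    show D0: "D > 0" by (simp add: D_def)
    have "2 * K / r < D" by (simp add: D_def)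
    then show "K / D < r / 2" using D0 r by (simp add: field_simps)
  qed (simp add: D_def)
  define tr where "tr y = max (-D) (min D y)" for y :: real
  have trb: "\<bar>tr y\<bar> \<le> D" for y using D by (auto simp: tr_def)
  have trd: "\<bar>y - tr y\<bar> \<le> y\<^sup>2 / D" for y
  proof (cases "\<bar>y\<bar> \<le> D")
    case True then show ?thesis using D by (auto simp: tr_def)
  next
    case False
    then have "\<bar>y - tr y\<bar> \<le> \<bar>y\<bar>" using D by (auto simp: tr_def)
    also have "\<bar>y\<bar> * D \<le> \<bar>y\<bar> * \<bar>y\<bar>" using False by (intro mult_left_mono) auto
    then have "\<bar>y\<bar> \<le> y\<^sup>2 / D" using D by (simp add: pos_le_divide_eq power2_eq_square)
    finally show ?thesis .
  qed
  have [measurable]: "X n \<in> borel_measurable M" for n by fact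
  have intX: "integrable M (X n)" for n
    by (rule square_integrable_imp_integrable[OF X(1) X(2)])
  have tmeas: "(\<lambda>\<omega>. tr (X n \<omega>)) \<in> borel_measurable M" for n unfolding tr_def by measurable
  have intT: "integrable M (\<lambda>\<omega>. tr (X n \<omega>))" for n
    using tmeas trb by (intro integrable_const_bound[of _ D]) auto
  have Ytr: "tr (Y \<omega>) = Y \<omega>" if "\<omega> \<in> space M" for \<omega>
    using Y[OF that] D by (auto simp: tr_def)
  have Ym: "Y \<in> borel_measurable M" by (rule borel_measurable_LIMSEQ_real[OF lim X(1)])
  have "(\<lambda>n. expectation (\<lambda>\<omega>. tr (X n \<omega>))) \<longlonglongrightarrow> expectation Y"
  proof (rule integral_dominated_convergence[where w="\<lambda>_. D"])
    show "AE \<omega> in M. (\<lambda>n. tr (X n \<omega>)) \<longlonglongrightarrow> Y \<omega>"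
    proof (rule AE_I2)
      fix \<omega> assume w: "\<omega> \<in> space M"
      have "(\<lambda>n. tr (X n \<omega>)) \<longlonglongrightarrow> tr (Y \<omega>)"
        unfolding tr_def by (intro tendsto_max tendsto_min tendsto_const lim w)
      then show "(\<lambda>n. tr (X n \<omega>)) \<longlonglongrightarrow> Y \<omega>" using Ytr[OF w] by simp
    qed
  qed (use tmeas trb Ym in auto)
  from LIMSEQ_D[OF this half_gt_zero[OF r]]
  obtain n0 where n0: "\<And>n. n \<ge> n0 \<Longrightarrow> \<bar>expectation (\<lambda>\<omega>. tr (X n \<omega>)) - expectation Y\<bar> < r / 2"
    unfolding real_norm_def by blast
  have "\<bar>expectation (X n) - expectation (\<lambda>\<omega>. tr (X n \<omega>))\<bar> < r / 2" for n
  proof -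
    have "\<bar>expectation (X n) - expectation (\<lambda>\<omega>. tr (X n \<omega>))\<bar> = \<bar>expectation (\<lambda>\<omega>. X n \<omega> - tr (X n \<omega>))\<bar>"
      using intX intT by simp
    also have "\<dots> \<le> expectation (\<lambda>\<omega>. \<bar>X n \<omega> - tr (X n \<omega>)\<bar>)" by (rule integral_abs_bound)
    also have "\<dots> \<le> expectation (\<lambda>\<omega>. (X n \<omega>)\<^sup>2 / D)"
      using intX intT X(2) trd by (intro integral_mono) auto
    also have "\<dots> \<le> K / D" using X(3)[of n] D by (simp add: divide_right_mono)
    finally show ?thesis using D(3) by linarith
  qed
  note close = this
  have "norm (expectation (X n) - expectation Y) < r" if "n0 \<le> n" for n
    using n0[OF that] close[of n] unfolding real_norm_def by linarith
  then show "\<exists>n0. \<forall>n\<ge>n0. norm (expectation (X n) - expectation Y) < r" by blast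
qed

section \<open>Optional stopping in continuous time by refining grids\<close>

context brownian_filtration
begin

lemma grid_index_stopping:
  assumes tT: "0 \<le> t" "t \<le> T" and P: "\<And>s. t \<le> s \<Longrightarrow> s \<le> T \<Longrightarrow> {\<omega>\<in>space M. P s \<omega>} \<in> sets (F s)"
    and i: "i \<le> Suc n"
  shows "{\<omega>\<in>space M. grid_index P t T n \<omega> \<le> i} \<in> sets (F (grid t T n i))"
proof -
  have g: "t \<le> grid t T n j" "0 \<le> grid t T n j" for j using grid_bounds(1)[of t T n j] tT by auto
  have "{\<omega>\<in>space M. P (grid t T n j) \<omega>} \<in> sets (F (grid t T n i))" if "j \<le> i" for j
  proof -
    have "{\<omega>\<in>space M. P (grid t T n j) \<omega>} \<in> sets (F (grid t T n j))"
      using that i grid_bounds[OF tT(2)] by (intro P) auto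
    then show ?thesis using filt_mono[OF g(2)] monoD[OF grid_mono[OF tT(2)] that] by blast
  qed
  then have "(\<Union>j\<in>{..i} \<inter> {..<Suc n}. {\<omega>\<in>space M. P (grid t T n j) \<omega>}) \<in> sets (F (grid t T n i))" by auto
  moreover have "{\<omega>\<in>space M. grid_index P t T n \<omega> \<le> i}
      = (if Suc n \<le> i then space M else (\<Union>j\<in>{..i} \<inter> {..<Suc n}. {\<omega>\<in>space M. P (grid t T n j) \<omega>}))"
    unfolding grid_index_le_iff by auto
  ultimately show ?thesis using sets.top[of "F (grid t T n i)"] space_F[OF g(2)] by simp
qed

lemma hit_measurable:
  assumes tT: "0 \<le> t" "t \<le> T" and P: "\<And>s. t \<le> s \<Longrightarrow> s \<le> T \<Longrightarrow> {\<omega>\<in>space M. P s \<omega>} \<in> sets (F s)"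
    and op: "\<And>\<omega>. \<omega> \<in> space M \<Longrightarrow> right_open t T (\<lambda>s. P s \<omega>)"
  shows "hit P t T \<in> borel_measurable (F T)"
proof (rule borel_measurable_LIMSEQ_real)
  have T0: "0 \<le> T" using tT by simp
  fix n
  have P': "{\<omega>\<in>space M. P (grid t T n i) \<omega>} \<in> sets (F T)" if "i < Suc n" for i
    using P[of "grid t T n i"] grid_bounds[OF tT(2)] that filt_mono[of "grid t T n i" T] tT
    by (meson less_imp_le order_trans subsetD)
  have "grid_index P t T n \<in> measurable (F T) (count_space UNIV)"
    unfolding grid_index_def
  proof (rule measurable_Least)
    fix i
    have "{\<omega> \<in> space (F T). i = Suc n \<or> i < Suc n \<and> P (grid t T n i) \<omega>}
       = (if i = Suc n then space M else if i < Suc n then {\<omega>\<in>space M. P (grid t T n i) \<omega>} else {})"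
      using T0 by auto
    also have "\<dots> \<in> sets (F T)" using P'[of i] sets.top[of "F T"] T0 by auto
    finally show "Measurable.pred (F T) (\<lambda>\<omega>. i = Suc n \<or> i < Suc n \<and> P (grid t T n i) \<omega>)"
      unfolding pred_def .
  qed
  then show "(\<lambda>\<omega>. grid t T n (grid_index P t T n \<omega>)) \<in> borel_measurable (F T)"
    by (rule measurable_compose) simp
next
  fix \<omega> assume "\<omega> \<in> space (F T)"
  then show "(\<lambda>n. grid t T n (grid_index P t T n \<omega>)) \<longlonglongrightarrow> hit P t T \<omega>"
    using tT op by (intro grid_tendsto_hit) auto
qed

text \<open>Optional stopping for the negative of the exponential martingale. With the exponent
  doubled, this controls second moments at grid times uniformly in \<open>n\<close>.\<close>

lemma grid_exp_moment:
  fixes n :: nat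
  assumes tT: "0 \<le> t" "t \<le> T" and P: "\<And>s. t \<le> s \<Longrightarrow> s \<le> T \<Longrightarrow> {\<omega>\<in>space M. P s \<omega>} \<in> sets (F s)"
  defines "\<tau> \<equiv> \<lambda>\<omega>. grid t T n (grid_index P t T n \<omega>)"
  shows "integrable M (\<lambda>\<omega>. exp (\<theta> * (W (\<tau> \<omega>) \<omega> - W t \<omega>) - \<theta>\<^sup>2 / 2 * (\<tau> \<omega> - t)))"
    "expectation (\<lambda>\<omega>. exp (\<theta> * (W (\<tau> \<omega>) \<omega> - W t \<omega>) - \<theta>\<^sup>2 / 2 * (\<tau> \<omega> - t))) \<le> 1"
proof -
  define N where "N s \<omega> = exp (\<theta> * (W s \<omega> - W t \<omega>) - \<theta>\<^sup>2 / 2 * (s - t))" for s \<omega>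
  have N_meas: "N s \<in> borel_measurable (F s)" if "t \<le> s" for s
  proof -
    have "W s \<in> borel_measurable (F s)" "W t \<in> borel_measurable (F s)"
      using adapted[of s] F_measurable_mono[OF tT(1) that adapted] that tT by auto
    then have "(\<lambda>\<omega>. \<theta> * (W s \<omega> - W t \<omega>) - \<theta>\<^sup>2 / 2 * (s - t)) \<in> borel_measurable (F s)"
      by (intro borel_measurable_diff borel_measurable_times borel_measurable_const)
    from measurable_compose[OF this borel_measurable_exp] show ?thesis unfolding N_def .
  qed
  have N_int: "integrable M (N s)" "expectation (N s) = 1" if "t \<le> s" for s
  proof -
    have 1: "(\<lambda>_. 1::real) \<in> borel_measurable (F t)" "integrable M (\<lambda>_. 1::real)" by simp_all
    show "integrable M (N s)" "expectation (N s) = 1"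
      using exp_incr_times[OF tT(1) that 1, where \<theta>=\<theta>] unfolding N_def[abs_def]
      by (simp_all only: mult_1 lebesgue_integral_const prob_space scaleR_one)
  qed
  have sub: "submartingale_on {t..T} (\<lambda>s \<omega>. - N s \<omega>)"
  proof (rule submartingale_onI[where \<theta>=\<theta>])
    fix s s' \<omega> assume "s \<in> {t..T}" "s' \<in> {t..T}" "s \<le> s'"
    have "N s \<omega> * exp (\<theta> * (W s' \<omega> - W s \<omega>) - \<theta>\<^sup>2 / 2 * (s' - s)) = N s' \<omega>"
      unfolding N_def exp_add[symmetric] by (simp add: field_simps)
    then show "- N s \<omega> * exp (\<theta> * (W s' \<omega> - W s \<omega>) - \<theta>\<^sup>2 / 2 * (s' - s)) \<le> - N s' \<omega>" by simp
  qed (use tT N_meas N_int in auto)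
  have sub': "submartingale_on (grid t T n ` {..Suc n}) (\<lambda>s \<omega>. - N s \<omega>)"
    using grid_bounds[OF tT(2)] by (intro submartingale_on_subset[OF sub]) auto
  \<comment> \<open>The comparison time is index 0, where the grid sits at \<open>t\<close> and the
    martingale equals one.\<close>
  have le0: "(0::nat) \<le> grid_index P t T n \<omega>" for \<omega> by simp
  have st0: "{\<omega> \<in> space M. (0::nat) \<le> i} \<in> sets (F (grid t T n i))" for i
    using sets.top[of "F (grid t T n i)"] space_F[of "grid t T n i"] grid_bounds(1)[OF tT(2), of n i] tT by simp
  note os = discrete_optional_stopping[OF sub' grid_mono[OF tT(2)] _ st0 grid_index_stopping[OF tT P] le0 grid_index_le]
  have "integrable M (\<lambda>\<omega>. - N (\<tau> \<omega>) \<omega>)" unfolding \<tau>_def by (rule os(2)) (use tT in simp_all)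
  moreover have "expectation (\<lambda>\<omega>. - N t \<omega>) \<le> expectation (\<lambda>\<omega>. - N (\<tau> \<omega>) \<omega>)"
    using os(3) tT unfolding \<tau>_def by simp
  ultimately have "integrable M (\<lambda>\<omega>. - N (\<tau> \<omega>) \<omega>)" "expectation (\<lambda>\<omega>. - N t \<omega>) \<le> expectation (\<lambda>\<omega>. - N (\<tau> \<omega>) \<omega>)"
    by blast+
  then show "integrable M (\<lambda>\<omega>. exp (\<theta> * (W (\<tau> \<omega>) \<omega> - W t \<omega>) - \<theta>\<^sup>2 / 2 * (\<tau> \<omega> - t)))"
    "expectation (\<lambda>\<omega>. exp (\<theta> * (W (\<tau> \<omega>) \<omega> - W t \<omega>) - \<theta>\<^sup>2 / 2 * (\<tau> \<omega> - t))) \<le> 1"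
    using N_int(2)[of t] by (auto simp: N_def prob_space)
qed

text \<open>\<open>D\<close> bounds \<open>N\<close> only at the two hitting times; on grids
  \<open>N\<close> may be unbounded. Domination by an exponential of \<open>W\<close> supplies the
  second moments needed to pass from grid times to hitting times. Since \<open>Q\<close> implies
  \<open>P\<close>, the \<open>P\<close> time comes first.\<close>

lemma optional_stopping:
  fixes N :: "real \<Rightarrow> 'w \<Rightarrow> real"
  assumes tT: "0 \<le> t" "t \<le> T" and sub: "submartingale_on {t..T} N"
    and N_cont: "\<And>\<omega>. \<omega> \<in> space M \<Longrightarrow> continuous_on {t..T} (\<lambda>s. N s \<omega>)"
    and N_le: "\<And>s \<omega>. t \<le> s \<Longrightarrow> s \<le> T \<Longrightarrow> \<omega> \<in> space M \<Longrightarrow> \<bar>N s \<omega>\<bar> \<le> C * exp (\<theta> * (W s \<omega> - W t \<omega>))"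
    and P: "\<And>s. t \<le> s \<Longrightarrow> s \<le> T \<Longrightarrow> {\<omega>\<in>space M. P s \<omega>} \<in> sets (F s)"
      "\<And>\<omega>. \<omega> \<in> space M \<Longrightarrow> right_open t T (\<lambda>s. P s \<omega>)"
    and Q: "\<And>s. t \<le> s \<Longrightarrow> s \<le> T \<Longrightarrow> {\<omega>\<in>space M. Q s \<omega>} \<in> sets (F s)"
      "\<And>\<omega>. \<omega> \<in> space M \<Longrightarrow> right_open t T (\<lambda>s. Q s \<omega>)"
    and QP: "\<And>s \<omega>. Q s \<omega> \<Longrightarrow> P s \<omega>"
    and bd: "\<And>\<omega>. \<omega> \<in> space M \<Longrightarrow> \<bar>N (hit P t T \<omega>) \<omega>\<bar> \<le> D" "\<And>\<omega>. \<omega> \<in> space M \<Longrightarrow> \<bar>N (hit Q t T \<omega>) \<omega>\<bar> \<le> D"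
  shows "expectation (\<lambda>\<omega>. N (hit P t T \<omega>) \<omega>) \<le> expectation (\<lambda>\<omega>. N (hit Q t T \<omega>) \<omega>)"
proof -
  have sub': "submartingale_on (grid t T n ` {..Suc n}) N" for n
    using grid_bounds[OF tT(2)] by (intro submartingale_on_subset[OF sub]) auto
  let ?g = "\<lambda>P n \<omega>. grid t T n (grid_index P t T n \<omega>)"
  have os: "integrable M (\<lambda>\<omega>. N (?g P n \<omega>) \<omega>)" "integrable M (\<lambda>\<omega>. N (?g Q n \<omega>) \<omega>)"
     "expectation (\<lambda>\<omega>. N (?g P n \<omega>) \<omega>) \<le> expectation (\<lambda>\<omega>. N (?g Q n \<omega>) \<omega>)" for n
  proof -
    note * = discrete_optional_stopping[OF sub' grid_mono[OF tT(2)] _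
        grid_index_stopping[OF tT P(1)] grid_index_stopping[OF tT Q(1)] grid_index_antimono[of Q _ P, OF QP] grid_index_le]
    show "integrable M (\<lambda>\<omega>. N (?g P n \<omega>) \<omega>)" "integrable M (\<lambda>\<omega>. N (?g Q n \<omega>) \<omega>)"
       "expectation (\<lambda>\<omega>. N (?g P n \<omega>) \<omega>) \<le> expectation (\<lambda>\<omega>. N (?g Q n \<omega>) \<omega>)"
      by (rule *; use tT in simp)+
  qed
  have lim: "(\<lambda>n. expectation (\<lambda>\<omega>. N (?g R n \<omega>) \<omega>)) \<longlonglongrightarrow> expectation (\<lambda>\<omega>. N (hit R t T \<omega>) \<omega>)"
    if R: "\<And>s. t \<le> s \<Longrightarrow> s \<le> T \<Longrightarrow> {\<omega>\<in>space M. R s \<omega>} \<in> sets (F s)"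
      "\<And>\<omega>. \<omega> \<in> space M \<Longrightarrow> right_open t T (\<lambda>s. R s \<omega>)"
      "\<And>\<omega>. \<omega> \<in> space M \<Longrightarrow> \<bar>N (hit R t T \<omega>) \<omega>\<bar> \<le> D"
      and meas: "\<And>n. integrable M (\<lambda>\<omega>. N (?g R n \<omega>) \<omega>)" for R
  proof (rule expectation_tendsto_of_L2_bounded[where C=D])
    \<comment> \<open>Squaring doubles the exponent; the compensator
      \<open>(2 * \<theta>)\<^sup>2 / 2 = 2 * \<theta>\<^sup>2\<close>, accumulated over at most
      \<open>T - t\<close>, is the price of returning to a martingale.\<close>
    let ?K = "C\<^sup>2 * exp (2 * \<theta>\<^sup>2 * (T - t))"
    fix n
    let ?E = "\<lambda>\<omega>. exp ((2 * \<theta>) * (W (?g R n \<omega>) \<omega> - W t \<omega>) - (2 * \<theta>)\<^sup>2 / 2 * (?g R n \<omega> - t))"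
    note E = grid_exp_moment[OF tT R(1), where n=n and \<theta>="2 * \<theta>"]
    have dom: "(N (?g R n \<omega>) \<omega>)\<^sup>2 \<le> ?K * ?E \<omega>" if w: "\<omega> \<in> space M" for \<omega>
    proof -
      let ?s = "?g R n \<omega>"
      have s: "t \<le> ?s" "?s \<le> T" using grid_bounds[OF tT(2)] grid_index_le[of R t T n \<omega>] by simp_all
      have "(N ?s \<omega>)\<^sup>2 \<le> (C * exp (\<theta> * (W ?s \<omega> - W t \<omega>)))\<^sup>2"
        using N_le[OF s w] by (rule abs_le_square_iff[THEN iffD1, OF order_trans[OF _ abs_ge_self]])
      also have "\<dots> = C\<^sup>2 * (exp (2 * \<theta>\<^sup>2 * (?s - t)) * ?E \<omega>)"
        unfolding exp_add[symmetric] power_mult_distrib exp_double[symmetric] by (simp add: algebra_simps power2_eq_square)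
      also have "\<dots> \<le> C\<^sup>2 * (exp (2 * \<theta>\<^sup>2 * (T - t)) * ?E \<omega>)"
        using mult_left_mono[of "?s - t" "T - t" "2 * \<theta>\<^sup>2"] s by (intro mult_left_mono mult_right_mono) auto
      finally show ?thesis by (simp add: mult.assoc)
    qed
    show m: "(\<lambda>\<omega>. N (?g R n \<omega>) \<omega>) \<in> borel_measurable M" using meas by auto
    show i: "integrable M (\<lambda>\<omega>. (N (?g R n \<omega>) \<omega>)\<^sup>2)"
      by (rule Bochner_Integration.integrable_bound[of _ "\<lambda>\<omega>. ?K * ?E \<omega>"]) (use E(1) m dom in auto)
    have "expectation (\<lambda>\<omega>. (N (?g R n \<omega>) \<omega>)\<^sup>2) \<le> expectation (\<lambda>\<omega>. ?K * ?E \<omega>)"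
      using i E(1) dom by (intro integral_mono) auto
    also have "\<dots> \<le> ?K * 1" unfolding integral_mult_right_zero using E(2) by (intro mult_left_mono) auto
    finally show "expectation (\<lambda>\<omega>. (N (?g R n \<omega>) \<omega>)\<^sup>2) \<le> ?K" by simp
  next
    fix \<omega> assume w: "\<omega> \<in> space M"
    show "(\<lambda>n. N (?g R n \<omega>) \<omega>) \<longlonglongrightarrow> N (hit R t T \<omega>) \<omega>"
    proof (rule continuous_on_tendsto_compose[OF N_cont[OF w]])
      show "(\<lambda>n. ?g R n \<omega>) \<longlonglongrightarrow> hit R t T \<omega>" using R(2)[OF w] by (intro grid_tendsto_hit[OF tT(2)])
      show "hit R t T \<omega> \<in> {t..T}" using hit_ge[OF tT(2)] hit_le[OF tT(2)] by auto
      show "\<forall>\<^sub>F n in sequentially. ?g R n \<omega> \<in> {t..T}"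
        using grid_bounds[OF tT(2)] grid_index_le[of R t T _ \<omega>] by (intro always_eventually) simp
    qed
    show "\<bar>N (hit R t T \<omega>) \<omega>\<bar> \<le> D" by (rule R(3)[OF w])
  qed
  show ?thesis
    by (rule LIMSEQ_le[OF lim[OF P bd(1) os(1)] lim[OF Q bd(2) os(2)]]) (use os(3) in auto)
qed

end

section \<open>The Laplace transform of the ruin time\<close>

lemma not_before_hit: "t \<le> s \<Longrightarrow> s < hit P t T \<omega> \<Longrightarrow> t \<le> T \<Longrightarrow> \<not> P s \<omega>"
  using hit_lower[of t s T P \<omega>] hit_le[of t T P \<omega>] by auto

lemma hit_antimono:
  assumes "t \<le> T" "\<And>s. Q s \<omega> \<Longrightarrow> P s \<omega>"
  shows "hit P t T \<omega> \<le> hit Q t T \<omega>"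
proof (rule ccontr)
  assume n: "\<not> ?thesis"
  then have "hit Q t T \<omega> < hit P t T \<omega>" "hit P t T \<omega> \<le> T" using hit_le[OF assms(1)] by auto
  then obtain s where "t \<le> s" "s < hit P t T \<omega>" "Q s \<omega>" by (rule hit_lessD)
  then show False using not_before_hit[OF _ _ assms(1), of s P \<omega>] assms(2) by auto
qed

lemma hit_Lipschitz:
  assumes "t \<le> s" "s \<le> s'"
  shows "hit P t s \<omega> \<le> hit P t s' \<omega>" "hit P t s' \<omega> \<le> hit P t s \<omega> + (s' - s)"
proof -
  have "hit P t s \<omega> \<le> y" if "y \<in> insert s' {u. t \<le> u \<and> u \<le> s' \<and> P u \<omega>}" for y
    using that hit_le[of t s P \<omega>] hit_lower[of t y s P \<omega>] assms by (cases "y \<le> s") auto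
  then show "hit P t s \<omega> \<le> hit P t s' \<omega>" unfolding hit_def[of P t s'] by (intro cInf_greatest) auto
  have "hit P t s' \<omega> - (s' - s) \<le> y" if "y \<in> insert s {u. t \<le> u \<and> u \<le> s \<and> P u \<omega>}" for y
    using that hit_le[of t s' P \<omega>] hit_lower[of t y s' P \<omega>] assms by auto
  then have "hit P t s' \<omega> - (s' - s) \<le> hit P t s \<omega>" unfolding hit_def[of P t s] by (intro cInf_greatest) auto
  then show "hit P t s' \<omega> \<le> hit P t s \<omega> + (s' - s)" by simp
qed

lemma right_open_level:
  assumes "continuous_on {t..T} f"
  shows "right_open t T (\<lambda>s. f s < (c::real))"
  unfolding right_open_def
proof (intro allI impI)
  fix s assume s: "t \<le> s" "s < T" "f s < c"
  from assms s have "\<forall>e>0. \<exists>d>0. \<forall>x'\<in>{t..T}. dist x' s < d \<longrightarrow> dist (f x') (f s) < e"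
    unfolding continuous_on_iff by auto
  then obtain e where e: "e > 0" "\<And>x'. x' \<in> {t..T} \<Longrightarrow> dist x' s < e \<Longrightarrow> dist (f x') (f s) < c - f s"
    using s by (metis diff_gt_0_iff_gt)
  have "f s' < c" if "s \<le> s'" "s' < s + min e (T - s)" for s'
  proof -
    have "\<bar>f s' - f s\<bar> < c - f s"
      using e(2)[of s'] that s unfolding dist_real_def by simp
    then show ?thesis by simp
  qed
  then show "\<exists>e>0. \<forall>s'. s \<le> s' \<longrightarrow> s' < s + e \<longrightarrow> f s' < c"
    using e s by (intro exI[of _ "min e (T - s)"]) auto
qed

text \<open>Before the hit the path is at least \<open>c\<close>, and left limits carry this to the
  hit itself. A path that starts below \<open>c\<close> is hit at once, which is why
  \<open>m\<close> must also lie below the initial value.\<close>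

lemma hit_level_ge:
  fixes f :: "real \<Rightarrow> 'w \<Rightarrow> real"
  assumes tT: "t \<le> T" and cont: "continuous_on {t..T} (\<lambda>s. f s \<omega>)" and m: "m \<le> c" "m \<le> f t \<omega>"
    and s: "t \<le> s" "s \<le> hit (\<lambda>s \<omega>. f s \<omega> < c) t T \<omega>"
  shows "m \<le> f s \<omega>"
proof (cases "s = t")
  case True then show ?thesis using m by simp
next
  case False
  have sT: "s \<le> T" using s hit_le[OF tT, of "\<lambda>s \<omega>. f s \<omega> < c" \<omega>] by simp
  have "continuous_on {t..s} (\<lambda>s. f s \<omega>)" using cont by (rule continuous_on_subset) (use sT in auto)
  then have "((\<lambda>s. f s \<omega>) \<longlongrightarrow> f s \<omega>) (at_left s)"
    using False s by (intro continuous_on_Icc_at_leftD) auto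
  moreover have "m \<le> f u \<omega>" if "t < u" "u < s" for u
    using not_before_hit[OF _ _ tT, of u "\<lambda>s \<omega>. f s \<omega> < c" \<omega>] that s m by simp
  then have "\<forall>\<^sub>F u in at_left s. m \<le> f u \<omega>"
    unfolding eventually_at_left_field using False s by (intro exI[of _ t]) auto
  ultimately show ?thesis by (intro tendsto_lowerbound[of _ _ "at_left s"]) auto
qed

text \<open>A path above \<open>c\<close> at the hitting time would stay above for a while, although
  visits of \<open>P\<close> come arbitrarily soon after it. The cap is excluded since it may be
  reached without a visit.\<close>

lemma hit_level_le:
  fixes f :: "real \<Rightarrow> 'w \<Rightarrow> real"
  assumes tT: "t \<le> T" and cont: "continuous_on {t..T} (\<lambda>s. f s \<omega>)"
    and h: "hit P t T \<omega> < T" and P: "\<And>s. P s \<omega> \<Longrightarrow> f s \<omega> \<le> c"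
  shows "f (hit P t T \<omega>) \<omega> \<le> c"
proof (rule ccontr)
  let ?h = "hit P t T \<omega>"
  assume "\<not> ?thesis"
  then have gt: "- f ?h \<omega> < - c" by simp
  have "right_open t T (\<lambda>s. - f s \<omega> < - c)" by (intro right_open_level continuous_on_minus cont)
  with gt h hit_ge[OF tT, of P \<omega>] obtain e where e: "e > 0" "\<And>s. ?h \<le> s \<Longrightarrow> s < ?h + e \<Longrightarrow> - f s \<omega> < - c"
    unfolding right_open_def by blast
  have "?h < min (?h + e) T" using e h by auto
  then obtain s where s: "t \<le> s" "s < min (?h + e) T" "P s \<omega>" by (rule hit_lessD) auto
  then have "?h \<le> s" by (intro hit_lower) auto
  then show False using e(2)[of s] s P[OF s(3)] by auto
qed

text \<open>The condition \<open>f \<le> 0\<close> may hold for a single instant, so the grid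
  argument does not apply. The hitting times of the open levels increase with \<open>k\<close>, and
  continuity makes the path nonpositive at their limit unless that limit is the cap.\<close>

lemma hit_level_tendsto:
  fixes f :: "real \<Rightarrow> 'w \<Rightarrow> real"
  assumes tT: "t \<le> T" and cont: "continuous_on {t..T} (\<lambda>s. f s \<omega>)"
  shows "(\<lambda>k. hit (\<lambda>s \<omega>. f s \<omega> < 1 / real (Suc k)) t T \<omega>) \<longlonglongrightarrow> hit (\<lambda>s \<omega>. f s \<omega> \<le> 0) t T \<omega>"
proof -
  let ?h = "\<lambda>k. hit (\<lambda>s \<omega>. f s \<omega> < 1 / real (Suc k)) t T \<omega>" and ?H = "hit (\<lambda>s \<omega>. f s \<omega> \<le> 0) t T \<omega>"
  have hH: "?h k \<le> ?H" for k by (rule hit_antimono[OF tT]) (auto intro: le_less_trans simp del: of_nat_Suc)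
  have inc: "incseq ?h"
  proof (rule incseq_SucI, rule hit_antimono[OF tT])
    fix k s assume "f s \<omega> < 1 / real (Suc (Suc k))"
    also have "\<dots> \<le> 1 / real (Suc k)" by (simp add: field_simps)
    finally show "f s \<omega> < 1 / real (Suc k)" .
  qed
  obtain L where L: "?h \<longlonglongrightarrow> L" "\<And>k. ?h k \<le> L" using incseq_convergent[OF inc, of ?H] hH by auto
  have LH: "L \<le> ?H" by (rule LIMSEQ_le_const2[OF L(1)]) (use hH in auto)
  have tL: "t \<le> L" using hit_ge[OF tT] L(2)[of 0] by (rule order_trans)
  have "L = ?H"
  proof (rule ccontr)
    assume "L \<noteq> ?H"
    then have LT: "L < ?H" "L < T" using LH hit_le[OF tT, of "\<lambda>s \<omega>. f s \<omega> \<le> 0" \<omega>] by auto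
    have "(\<lambda>k. f (?h k) \<omega>) \<longlonglongrightarrow> f L \<omega>"
    proof (rule continuous_on_tendsto_compose[OF cont L(1)])
      show "L \<in> {t..T}" using tL LT by auto
      show "\<forall>\<^sub>F k in sequentially. ?h k \<in> {t..T}" using hit_ge[OF tT] hit_le[OF tT] by (intro always_eventually) auto
    qed
    moreover have "(\<lambda>k. 1 / real (Suc k)) \<longlonglongrightarrow> 0" by (rule LIMSEQ_Suc) (rule lim_const_over_n)
    moreover have "f (?h k) \<omega> \<le> 1 / real (Suc k)" for k
    proof (rule hit_level_le[where f=f, OF tT cont])
      show "?h k < T" using L(2)[of k] LT by simp
    qed auto
    ultimately have "f L \<omega> \<le> 0" by (intro LIMSEQ_le) auto
    then have "?H \<le> L" using tL LT by (intro hit_lower) auto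
    then show False using LT by simp
  qed
  then show ?thesis using L by simp
qed

context brownian_filtration
begin

lemma hit_zero_measurable:
  fixes f :: "real \<Rightarrow> 'w \<Rightarrow> real"
  assumes tT: "0 \<le> t" "t \<le> T" and f: "\<And>s. t \<le> s \<Longrightarrow> s \<le> T \<Longrightarrow> f s \<in> borel_measurable (F s)"
    and cont: "\<And>\<omega>. \<omega> \<in> space M \<Longrightarrow> continuous_on {t..T} (\<lambda>s. f s \<omega>)"
  shows "hit (\<lambda>s \<omega>. f s \<omega> \<le> 0) t T \<in> borel_measurable (F T)"
proof (rule borel_measurable_LIMSEQ_real)
  fix \<omega> assume "\<omega> \<in> space (F T)"
  then have "\<omega> \<in> space M" using tT by simp
  then show "(\<lambda>k. hit (\<lambda>s \<omega>. f s \<omega> < 1 / real (Suc k)) t T \<omega>) \<longlonglongrightarrow> hit (\<lambda>s \<omega>. f s \<omega> \<le> 0) t T \<omega>"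
    by (intro hit_level_tendsto tT cont)
next
  fix k
  show "hit (\<lambda>s \<omega>. f s \<omega> < 1 / real (Suc k)) t T \<in> borel_measurable (F T)"
  proof (rule hit_measurable[OF tT])
    fix s assume s: "t \<le> s" "s \<le> T"
    show "{\<omega> \<in> space M. f s \<omega> < 1 / real (Suc k)} \<in> sets (F s)"
      using measurable_sets_Collect[OF f[OF s], of "\<lambda>y. y < 1 / real (Suc k)"] s tT by (simp add: lessThan_def[symmetric])
  qed (intro right_open_level cont)
qed

end

locale controlled_brownian = brownian_filtration +
  fixes a b d dbar \<epsilon> t x :: real
  assumes b: "0 < b" and d: "0 \<le> d" "d \<le> dbar" and eps: "0 \<le> \<epsilon>" and t: "0 \<le> t" and x: "0 \<le> x"
begin

text \<open>Drift \<open>a - d\<close> for a duration \<open>\<epsilon>\<close> and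
  \<open>a - dbar\<close> afterwards, in one formula through the minimum. The process continues
  after ruin and does not refer to the strategy.\<close>

definition Z :: "real \<Rightarrow> 'a \<Rightarrow> real" where
  "Z s \<omega> = x + (a - dbar) * (s - t) + (dbar - d) * min (s - t) \<epsilon> + b * (W s \<omega> - W t \<omega>)"

lemma Z_t [simp]: "Z t \<omega> = x"
  using eps by (simp add: Z_def)

lemma W_measurable_F: "t \<le> s \<Longrightarrow> W s \<in> borel_measurable (F s)" "t \<le> s \<Longrightarrow> W t \<in> borel_measurable (F s)"
  using adapted[of s] F_measurable_mono[OF t _ adapted[OF t]] t by auto

lemma Z_measurable: "t \<le> s \<Longrightarrow> Z s \<in> borel_measurable (F s)"
  unfolding Z_def[abs_def]
  by (intro borel_measurable_add borel_measurable_times borel_measurable_diff borel_measurable_const W_measurable_F)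

lemma W_cont: "\<omega> \<in> space M \<Longrightarrow> continuous_on {t..} (\<lambda>s. W s \<omega>)"
  by (rule continuous_on_subset[OF cont]) (use t in auto)

lemma Z_cont: "\<omega> \<in> space M \<Longrightarrow> continuous_on {t..} (\<lambda>s. Z s \<omega>)"
  unfolding Z_def by (intro continuous_intros W_cont)

lemma Z_cont_on: "\<omega> \<in> space M \<Longrightarrow> continuous_on {t..T} (\<lambda>s. Z s \<omega>)"
  by (rule continuous_on_subset[OF Z_cont]) auto

lemma Z_level: "t \<le> s \<Longrightarrow> {\<omega>\<in>space M. Z s \<omega> < c} \<in> sets (F s)"
  using measurable_sets_Collect[OF Z_measurable, of s "\<lambda>y. y < c"] t by (simp add: lessThan_def[symmetric])

abbreviation ruin_hit :: "real \<Rightarrow> 'a \<Rightarrow> real" where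
  "ruin_hit T \<equiv> hit (\<lambda>s \<omega>. Z s \<omega> < 0) t T"

lemma Z_nonneg:
  assumes "t \<le> T" "\<omega> \<in> space M" "t \<le> s" "s \<le> ruin_hit T \<omega>"
  shows "0 \<le> Z s \<omega>"
  by (rule hit_level_ge[OF assms(1) Z_cont_on[OF assms(2)] _ _ assms(3,4)]) (use x in auto)

text \<open>The relation between \<open>lam\<close> and \<open>r\<close> turns the expression into
  \<open>exp (r * x)\<close> times the Wald martingale with parameter \<open>r * b\<close>; the
  minimum term removes the extra drift of the perturbation. As \<open>r \<le> 0\<close> and
  \<open>Z\<close> is nonnegative up to ruin, the stopped value is bounded. Equality comes from
  stopping both the process and its negative.\<close>

lemma laplace_until:
  assumes r: "r \<le> 0" "lam = r\<^sup>2 * b\<^sup>2 / 2 + r * (a - dbar)" and tT: "t \<le> T"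
  shows "expectation (\<lambda>\<omega>. exp (r * Z (ruin_hit T \<omega>) \<omega> - lam * (ruin_hit T \<omega> - t)
            - r * (dbar - d) * min (ruin_hit T \<omega> - t) \<epsilon>)) = exp (r * x)"
proof -
  define N where "N s \<omega> = exp (r * Z s \<omega> - lam * (s - t) - r * (dbar - d) * min (s - t) \<epsilon>)" for s \<omega>
  have N_eq: "N s \<omega> = exp (r * x) * exp ((r * b) * (W s \<omega> - W t \<omega>) - (r * b)\<^sup>2 / 2 * (s - t))" for s \<omega>
    unfolding N_def exp_add[symmetric] Z_def r(2) by (rule arg_cong[where f=exp]) (simp add: field_simps power2_eq_square)
  have N_meas: "N s \<in> borel_measurable (F s)" if "t \<le> s" for s
  proof -
    have "(\<lambda>\<omega>. r * Z s \<omega> - lam * (s - t) - r * (dbar - d) * min (s - t) \<epsilon>) \<in> borel_measurable (F s)"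
      by (intro borel_measurable_times borel_measurable_diff borel_measurable_const Z_measurable that)
    from measurable_compose[OF this borel_measurable_exp] show ?thesis unfolding N_def .
  qed
  have N_int: "integrable M (N s)" if "t \<le> s" for s
    unfolding N_eq[abs_def]
    by (rule exp_incr_times(1)[OF t that]) simp_all
  have step: "N s \<omega> * exp ((r * b) * (W s' \<omega> - W s \<omega>) - (r * b)\<^sup>2 / 2 * (s' - s)) = N s' \<omega>" for s s' \<omega>
    unfolding N_eq exp_add[symmetric] by (rule arg_cong[where f=exp]) (simp add: field_simps)
  have sub: "submartingale_on {t..T} N" "submartingale_on {t..T} (\<lambda>s \<omega>. - N s \<omega>)"
    by (rule submartingale_onI[where \<theta>="r * b"]; use t N_meas N_int step in auto)+
  have N_cont: "continuous_on {t..T} (\<lambda>s. N s \<omega>)" if "\<omega> \<in> space M" for \<omega>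
    unfolding N_def by (intro continuous_intros Z_cont_on that)
  have N_le: "\<bar>N s \<omega>\<bar> \<le> exp (r * x) * exp ((r * b) * (W s \<omega> - W t \<omega>))" if "t \<le> s" for s \<omega>
    unfolding N_eq using that by (simp add: abs_mult)
  define D where "D = max (exp (r * x)) (exp (\<bar>lam\<bar> * (T - t) + \<bar>r * (dbar - d)\<bar> * (T - t)))"
  \<comment> \<open>The condition that always holds is met at \<open>t\<close>, so the earlier
    stopping time is the initial time.\<close>
  have hT: "hit (\<lambda>s \<omega>. True) t T \<omega> = t" for \<omega> :: 'a
    using hit_lower[of t t T "\<lambda>s \<omega>. True" \<omega>] hit_ge[OF tT, of "\<lambda>s \<omega>. True" \<omega>] tT by auto
  have Nt: "N t \<omega> = exp (r * x)" for \<omega> using eps by (simp add: N_def)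
  have bd1: "\<bar>N (hit (\<lambda>s \<omega>. True) t T \<omega>) \<omega>\<bar> \<le> D" for \<omega> unfolding hT Nt by (simp add: D_def)
  have bd2: "\<bar>N (ruin_hit T \<omega>) \<omega>\<bar> \<le> D" if w: "\<omega> \<in> space M" for \<omega>
  proof -
    let ?h = "ruin_hit T \<omega>"
    have h: "t \<le> ?h" "?h \<le> T" by (simp_all add: hit_ge hit_le tT)
    have "r * Z ?h \<omega> \<le> 0" using r Z_nonneg[OF tT w h(1)] by (intro mult_nonpos_nonneg) auto
    moreover have "- lam * (?h - t) \<le> \<bar>lam\<bar> * (T - t)" using h by (intro mult_mono) auto
    moreover have "- (r * (dbar - d)) * min (?h - t) \<epsilon> \<le> \<bar>r * (dbar - d)\<bar> * (T - t)"
      using h eps by (intro mult_mono) auto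
    ultimately have "N ?h \<omega> \<le> exp (\<bar>lam\<bar> * (T - t) + \<bar>r * (dbar - d)\<bar> * (T - t))"
      unfolding N_def by simp
    moreover have "0 \<le> N ?h \<omega>" by (simp add: N_def)
    ultimately show ?thesis by (simp add: D_def)
  qed
  have top: "{\<omega> \<in> space M. True} \<in> sets (F s)" if "t \<le> s" for s using sets.top[of "F s"] that t by simp
  have rT: "right_open t T (\<lambda>s. True)" by (auto simp: right_open_def intro!: exI[of _ 1])
  have rQ: "right_open t T (\<lambda>s. Z s \<omega> < 0)" if "\<omega> \<in> space M" for \<omega> by (intro right_open_level Z_cont_on that)
  have "expectation (\<lambda>\<omega>. N (hit (\<lambda>s \<omega>. True) t T \<omega>) \<omega>) \<le> expectation (\<lambda>\<omega>. N (ruin_hit T \<omega>) \<omega>)"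
    by (rule optional_stopping[OF t tT sub(1) N_cont N_le top rT Z_level rQ _ bd1 bd2]) auto
  moreover have "expectation (\<lambda>\<omega>. - N (hit (\<lambda>s \<omega>. True) t T \<omega>) \<omega>) \<le> expectation (\<lambda>\<omega>. - N (ruin_hit T \<omega>) \<omega>)"
    by (rule optional_stopping[OF t tT sub(2) _ _ top rT Z_level rQ])
      (auto intro!: continuous_on_minus N_cont N_le bd1 bd2)
  ultimately have "expectation (\<lambda>\<omega>. N (ruin_hit T \<omega>) \<omega>) = exp (r * x)"
    unfolding hT Nt by (simp add: prob_space)
  then show ?thesis by (simp add: N_def)
qed

text \<open>Links the extended-real ruin time with its capped versions. Negative values occur
  arbitrarily soon after a finite ruin time \<open>R\<close> and none before, so \<open>Z\<close>
  vanishes at \<open>R\<close> by continuity.\<close>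

lemma ruin_time_cases:
  assumes w: "\<omega> \<in> space M"
  obtains "ruin_time t Z \<omega> = \<infinity>" "\<And>s. t \<le> s \<Longrightarrow> 0 \<le> Z s \<omega>" "\<And>T. t \<le> T \<Longrightarrow> ruin_hit T \<omega> = T"
  | R where "ruin_time t Z \<omega> = ereal R" "t \<le> R" "Z R \<omega> = 0" "\<And>s. t \<le> s \<Longrightarrow> s \<le> R \<Longrightarrow> 0 \<le> Z s \<omega>"
    "\<And>T. R < T \<Longrightarrow> ruin_hit T \<omega> = R" "\<And>T. t \<le> T \<Longrightarrow> T \<le> R \<Longrightarrow> ruin_hit T \<omega> = T"
    "\<And>h. 0 < h \<Longrightarrow> \<exists>s. R \<le> s \<and> s < R + h \<and> Z s \<omega> < 0"
proof (cases "{s. t \<le> s \<and> Z s \<omega> < 0} = {}")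
  case True
  then have pos: "\<And>s. t \<le> s \<Longrightarrow> 0 \<le> Z s \<omega>" by (auto simp: not_less[symmetric])
  have "ruin_hit T \<omega> = T" if "t \<le> T" for T
  proof -
    have "insert T {s. t \<le> s \<and> s \<le> T \<and> Z s \<omega> < 0} = {T}" using True by auto
    then show ?thesis by (simp add: hit_def del: insert_subset insert_absorb2 singleton_insert_inj_eq singleton_insert_inj_eq')
  qed
  with pos that(1) True show ?thesis by (simp add: ruin_time_def top_ereal_def)
next
  case False
  let ?S = "{s. t \<le> s \<and> Z s \<omega> < 0}"
  define R where "R = Inf ?S"
  have bb: "bdd_below ?S" by (auto intro!: bdd_belowI[of _ t])
  have R: "ruin_time t Z \<omega> = ereal R"
    unfolding ruin_time_def R_def using ereal_Inf'[OF bb False] by simp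
  have tR: "t \<le> R" unfolding R_def using False by (intro cInf_greatest) auto
  have near: "\<exists>s. R \<le> s \<and> s < R + h \<and> Z s \<omega> < 0" if "0 < h" for h
  proof -
    have "Inf ?S < R + h" using that by (simp add: R_def)
    then obtain s where "s \<in> ?S" "s < R + h" using cInf_lessD[OF False] by blast
    then show ?thesis using cInf_lower[OF _ bb, of s] by (auto simp: R_def)
  qed
  have low: "R \<le> s" if "t \<le> s" "Z s \<omega> < 0" for s
    unfolding R_def using that by (intro cInf_lower bb) auto
  have big: "ruin_hit T \<omega> = R" if T: "R < T" for T
  proof (rule antisym)
    have tT: "t \<le> T" using T tR by simp
    show "ruin_hit T \<omega> \<le> R"
    proof (rule field_le_epsilon)
      fix e :: real assume "0 < e"
      then obtain s where "R \<le> s" "s < R + min e (T - R)" "Z s \<omega> < 0" using near[of "min e (T - R)"] T by auto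
      moreover from this have "s < R + e" "s < T" by linarith+
      ultimately show "ruin_hit T \<omega> \<le> R + e" using hit_lower[of t s T "\<lambda>s \<omega>. Z s \<omega> < 0" \<omega>] tR by auto
    qed
    show "R \<le> ruin_hit T \<omega>"
    proof (rule ccontr)
      assume "\<not> R \<le> ruin_hit T \<omega>"
      then have "ruin_hit T \<omega> < R" by simp
      then obtain s where "t \<le> s" "s < R" "Z s \<omega> < 0" using T by (auto elim: hit_lessD)
      then show False using low[of s] by simp
    qed
  qed
  have small: "ruin_hit T \<omega> = T" if T: "t \<le> T" "T \<le> R" for T
  proof (rule antisym[OF hit_le[OF T(1)]], rule ccontr)
    assume "\<not> T \<le> ruin_hit T \<omega>"
    then have "ruin_hit T \<omega> < T" by simp
    then obtain s where "t \<le> s" "s < T" "Z s \<omega> < 0" by (auto elim: hit_lessD)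
    then show False using low[of s] T by simp
  qed
  have nn: "0 \<le> Z s \<omega>" if "t \<le> s" "s \<le> R" for s
    using Z_nonneg[of "R + 1" \<omega> s] big[of "R + 1"] tR w that by auto
  have "Z (ruin_hit (R + 1) \<omega>) \<omega> \<le> 0"
    by (rule hit_level_le) (use tR big[of "R + 1"] Z_cont_on[OF w] in auto)
  then have "Z R \<omega> = 0" using nn[OF tR] big[of "R + 1"] by auto
  with that(2) R tR nn big small near show ?thesis by blast
qed

text \<open>The value on survival is the limit for a ruin time growing to infinity when
  \<open>lam > 0\<close>. In products it also neutralises the default value 0 of
  \<open>real_of_ereal\<close> at infinity.\<close>

definition discount :: "real \<Rightarrow> 'a \<Rightarrow> real" where
  "discount lam \<omega> = (if ruin_time t Z \<omega> = \<infinity> then 0 else exp (- lam * (real_of_ereal (ruin_time t Z \<omega>) - t)))"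

text \<open>The horizon of \<open>laplace_until\<close> grows through \<open>t + real n\<close>. On
  survival the positive \<open>lam\<close> sends the stopped expression to zero, otherwise it is
  eventually constant; \<open>exp (k * \<epsilon>)\<close> dominates throughout.\<close>

lemma laplace:
  assumes r: "r \<le> 0" "lam = r\<^sup>2 * b\<^sup>2 / 2 + r * (a - dbar)" and lam: "0 < lam"
  shows "(\<lambda>\<omega>. discount lam \<omega> * exp (- r * (dbar - d) * min (real_of_ereal (ruin_time t Z \<omega>) - t) \<epsilon>)) \<in> borel_measurable M"
    "expectation (\<lambda>\<omega>. discount lam \<omega> * exp (- r * (dbar - d) * min (real_of_ereal (ruin_time t Z \<omega>) - t) \<epsilon>)) = exp (r * x)"
proof -
  let ?L = "\<lambda>\<omega>. discount lam \<omega> * exp (- r * (dbar - d) * min (real_of_ereal (ruin_time t Z \<omega>) - t) \<epsilon>)"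
  let ?T = "\<lambda>n. t + real n"
  define k where "k = - r * (dbar - d)"
  have k: "0 \<le> k" unfolding k_def using r d by (intro mult_nonneg_nonneg) auto
  define N where "N s \<omega> = exp (r * Z s \<omega> - lam * (s - t) + k * min (s - t) \<epsilon>)" for s \<omega>
  have E: "expectation (\<lambda>\<omega>. N (ruin_hit (?T n) \<omega>) \<omega>) = exp (r * x)" for n
    using laplace_until[OF r, of "?T n"] by (simp add: N_def k_def)
  \<comment> \<open>A non-integrable function would have integral zero by convention, but the
    integral is \<open>exp (r * x) > 0\<close>; measurability is then part of integrability.\<close>
  have meas: "(\<lambda>\<omega>. N (ruin_hit (?T n) \<omega>) \<omega>) \<in> borel_measurable M" for n
  proof (rule ccontr)
    assume "\<not> ?thesis"
    then have "\<not> integrable M (\<lambda>\<omega>. N (ruin_hit (?T n) \<omega>) \<omega>)" using borel_measurable_integrable by blast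
    then show False using E[of n] by (simp add: not_integrable_integral_eq)
  qed
  have bd: "\<bar>N (ruin_hit (?T n) \<omega>) \<omega>\<bar> \<le> exp (k * \<epsilon>) * exp (- lam * (ruin_hit (?T n) \<omega> - t))" if w: "\<omega> \<in> space M" for n \<omega>
  proof -
    have h: "t \<le> ruin_hit (?T n) \<omega>" by (rule hit_ge) simp
    have "r * Z (ruin_hit (?T n) \<omega>) \<omega> \<le> 0" using r Z_nonneg[OF _ w h, of "?T n"] by (intro mult_nonpos_nonneg) auto
    moreover have "k * min (ruin_hit (?T n) \<omega> - t) \<epsilon> \<le> k * \<epsilon>" using k by (intro mult_left_mono) auto
    ultimately show ?thesis unfolding N_def exp_add[symmetric] by simp
  qed
  have lim: "(\<lambda>n. N (ruin_hit (?T n) \<omega>) \<omega>) \<longlonglongrightarrow> ?L \<omega>" if w: "\<omega> \<in> space M" for \<omega>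
    using w
  proof (cases rule: ruin_time_cases)
    case 1
    have "(\<lambda>n. exp (k * \<epsilon>) * exp (- lam) ^ n) \<longlonglongrightarrow> exp (k * \<epsilon>) * 0"
      using lam by (intro tendsto_mult tendsto_const LIMSEQ_power_zero) auto
    then have *: "(\<lambda>n. exp (k * \<epsilon>) * exp (- lam) ^ n) \<longlonglongrightarrow> 0" by simp
    have "(\<lambda>n. N (ruin_hit (?T n) \<omega>) \<omega>) \<longlonglongrightarrow> 0"
    proof (rule tendsto_rabs_zero_cancel, rule tendsto_sandwich[OF _ _ tendsto_const *])
      show "\<forall>\<^sub>F n in sequentially. \<bar>N (ruin_hit (?T n) \<omega>) \<omega>\<bar> \<le> exp (k * \<epsilon>) * exp (- lam) ^ n"
        using bd[OF w] 1(3) by (auto simp: exp_of_nat_mult[symmetric] mult.commute)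
    qed auto
    then show ?thesis using 1 by (simp add: discount_def)
  next
    case (2 R)
    obtain n0 :: nat where n0: "R - t < real n0" using reals_Archimedean2 by blast
    have "N (ruin_hit (?T n) \<omega>) \<omega> = ?L \<omega>" if "n0 \<le> n" for n
    proof -
      have "ruin_hit (?T n) \<omega> = R" using that n0 by (intro 2(5)) linarith
      then show ?thesis using 2(1,3) by (simp add: N_def discount_def exp_add[symmetric] k_def)
    qed
    then have "\<forall>\<^sub>F n in sequentially. N (ruin_hit (?T n) \<omega>) \<omega> = ?L \<omega>"
      by (auto simp: eventually_sequentially)
    then show ?thesis by (rule tendsto_eventually)
  qed
  show Lm: "?L \<in> borel_measurable M" by (rule borel_measurable_LIMSEQ_real[OF lim meas])
  have "(\<lambda>n. expectation (\<lambda>\<omega>. N (ruin_hit (?T n) \<omega>) \<omega>)) \<longlonglongrightarrow> expectation ?L"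
  proof (rule integral_dominated_convergence[where w="\<lambda>_. exp (k * \<epsilon>)"])
    show "AE \<omega> in M. norm (N (ruin_hit (?T n) \<omega>) \<omega>) \<le> exp (k * \<epsilon>)" for n
    proof (rule AE_I2)
      fix \<omega> assume w: "\<omega> \<in> space M"
      have "- lam * (ruin_hit (?T n) \<omega> - t) \<le> 0"
        using lam hit_ge[of t "?T n" "\<lambda>s \<omega>. Z s \<omega> < 0" \<omega>] by (intro mult_nonpos_nonneg) auto
      then have "exp (k * \<epsilon>) * exp (- lam * (ruin_hit (?T n) \<omega> - t)) \<le> exp (k * \<epsilon>) * 1"
        by (intro mult_left_mono) auto
      from order_trans[OF bd[OF w] this]
      show "norm (N (ruin_hit (?T n) \<omega>) \<omega>) \<le> exp (k * \<epsilon>)" by simp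
    qed
  qed (use Lm meas lim in simp_all)
  then have "(\<lambda>n::nat. exp (r * x)) \<longlonglongrightarrow> expectation ?L" unfolding E .
  from LIMSEQ_unique[OF this tendsto_const] show "expectation ?L = exp (r * x)" .
qed

end

section \<open>Immediate crossing of zero\<close>

context controlled_brownian
begin

definition hit0 :: "real \<Rightarrow> 'a \<Rightarrow> real" where
  "hit0 = hit (\<lambda>s \<omega>. Z s \<omega> \<le> 0) t"

text \<open>\<open>hit0 s\<close> is capped at \<open>s\<close>, so \<open>s - hit0 s\<close> is the
  time elapsed since \<open>Z\<close> first reached zero, and is zero before. With
  \<open>K = dbar\<close> this becomes an upper envelope for every solution that is not yet
  ruined.\<close>

definition Zup :: "real \<Rightarrow> real \<Rightarrow> 'a \<Rightarrow> real" where
  "Zup K s \<omega> = Z s \<omega> + K * (s - hit0 s \<omega>)"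

lemma hit0_le: "t \<le> s \<Longrightarrow> hit0 s \<omega> \<le> s"
  unfolding hit0_def by (rule hit_le)

lemma hit0_incr:
  assumes "t \<le> s" "s \<le> s'"
  shows "0 \<le> (s' - hit0 s' \<omega>) - (s - hit0 s \<omega>)" "(s' - hit0 s' \<omega>) - (s - hit0 s \<omega>) \<le> s' - s"
  using hit_Lipschitz[OF assms, of "\<lambda>s \<omega>. Z s \<omega> \<le> 0" \<omega>] unfolding hit0_def by linarith+

lemma hit0_t [simp]: "hit0 t \<omega> = t"
  unfolding hit0_def by (rule antisym) (simp_all add: hit_ge hit_le)

lemma Zup_t [simp]: "Zup K t \<omega> = x"
  by (simp add: Zup_def)

lemma Zup_measurable: "t \<le> s \<Longrightarrow> Zup K s \<in> borel_measurable (F s)"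
  unfolding Zup_def[abs_def] hit0_def
  by (intro borel_measurable_add borel_measurable_times borel_measurable_diff borel_measurable_const
      Z_measurable hit_zero_measurable Z_cont_on t) auto

lemma Zup_cont: "\<omega> \<in> space M \<Longrightarrow> continuous_on {t..T} (\<lambda>s. Zup K s \<omega>)"
proof -
  assume w: "\<omega> \<in> space M"
  have "1-lipschitz_on {t..T} (\<lambda>s. s - hit0 s \<omega>)"
  proof (rule lipschitz_onI)
    fix u v assume "u \<in> {t..T}" "v \<in> {t..T}"
    then show "dist (u - hit0 u \<omega>) (v - hit0 v \<omega>) \<le> 1 * dist u v"
      using hit0_incr[of u v \<omega>] hit0_incr[of v u \<omega>] by (cases "u \<le> v") (auto simp: dist_real_def)
  qed simp
  then have "continuous_on {t..T} (\<lambda>s. s - hit0 s \<omega>)" by (rule lipschitz_on_continuous_on)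
  then show ?thesis unfolding Zup_def
    by (intro continuous_on_add continuous_on_mult continuous_on_const Z_cont_on w)
qed

lemma min_incr:
  assumes "t \<le> s" "s \<le> s'"
  shows "0 \<le> min (s' - t) \<epsilon> - min (s - t) \<epsilon>" "min (s' - t) \<epsilon> - min (s - t) \<epsilon> \<le> s' - s"
  using assms by auto

lemma Zup_incr_le:
  assumes s: "t \<le> s" "s \<le> s'" and K: "0 \<le> K"
  shows "Zup K s' \<omega> - Zup K s \<omega> \<le> (\<bar>a - dbar\<bar> + (dbar - d) + K) * (s' - s) + b * (W s' \<omega> - W s \<omega>)"
proof -
  have "(a - dbar) * (s' - s) \<le> \<bar>a - dbar\<bar> * (s' - s)" using s by (intro mult_right_mono) auto
  moreover have "(dbar - d) * (min (s' - t) \<epsilon> - min (s - t) \<epsilon>) \<le> (dbar - d) * (s' - s)"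
    using min_incr[OF s] d by (intro mult_left_mono) auto
  moreover have "K * ((s' - hit0 s' \<omega>) - (s - hit0 s \<omega>)) \<le> K * (s' - s)"
    using hit0_incr[OF s] K by (intro mult_left_mono) auto
  ultimately show ?thesis unfolding Zup_def Z_def by (simp add: algebra_simps)
qed

lemma Zup_ge:
  assumes s: "t \<le> s" and K: "0 \<le> K"
  shows "x - \<bar>a - dbar\<bar> * (s - t) + b * (W s \<omega> - W t \<omega>) \<le> Zup K s \<omega>"
proof -
  have "- \<bar>a - dbar\<bar> * (s - t) \<le> (a - dbar) * (s - t)" using s by (intro mult_right_mono) auto
  moreover have "0 \<le> (dbar - d) * min (s - t) \<epsilon>" using s d eps by (intro mult_nonneg_nonneg) auto
  moreover have "0 \<le> K * (s - hit0 s \<omega>)" using hit0_le[OF s] K by (intro mult_nonneg_nonneg) auto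
  ultimately show ?thesis unfolding Zup_def Z_def by simp
qed

text \<open>The submartingale \<open>exp (r Zup - (s - t))\<close> equals \<open>exp (- (s - t))\<close> whenever \<open>Zup\<close> vanishes,
  so that no time can pass between reaching zero and becoming negative.\<close>

lemma Zup_crosses_until:
  assumes K: "0 \<le> K" and T: "t \<le> T"
  shows "AE \<omega> in M. hit (\<lambda>s \<omega>. Zup K s \<omega> < 0) t T \<omega> = hit (\<lambda>s \<omega>. Zup K s \<omega> \<le> 0) t T \<omega>"
proof -
  define K' where "K' = \<bar>a - dbar\<bar> + (dbar - d) + K"
  have K': "0 \<le> K'" using K d by (simp add: K'_def)
  \<comment> \<open>Chosen so that
    \<open>(r * b)\<^sup>2 / 2 + r * K' = (- r) * (1 + b\<^sup>2 / 2)\<close>, which is at least 1: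
    the quadratic term outweighs both the worst drift \<open>K'\<close> and the discount rate
    1.\<close>
  define r where "r = - (2 * (K' + 1) / b\<^sup>2 + 1)"
  have r: "r \<le> - 1" using K' b by (simp add: r_def)
  have rK: "(r * b)\<^sup>2 / 2 + r * K' - 1 \<ge> 0"
  proof -
    have "(r * b)\<^sup>2 / 2 + r * K' = (- r) * (1 + b\<^sup>2 / 2)"
      using b by (simp add: r_def field_simps power2_eq_square)
    also have "\<dots> \<ge> 1 * 1" using r by (intro mult_mono) auto
    finally show ?thesis by simp
  qed
  define N where "N s \<omega> = exp (r * Zup K s \<omega> - (s - t))" for s \<omega>
  have N_meas: "N s \<in> borel_measurable (F s)" if "t \<le> s" for s
  proof -
    have "(\<lambda>\<omega>. r * Zup K s \<omega> - (s - t)) \<in> borel_measurable (F s)"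
      by (intro borel_measurable_times borel_measurable_diff borel_measurable_const Zup_measurable that)
    from measurable_compose[OF this borel_measurable_exp] show ?thesis unfolding N_def .
  qed
  define C where "C = exp (r * x + (- r) * \<bar>a - dbar\<bar> * (T - t))"
  have N_le: "\<bar>N s \<omega>\<bar> \<le> C * exp ((r * b) * (W s \<omega> - W t \<omega>))" if "t \<le> s" "s \<le> T" for s \<omega>
  proof -
    have "r * Zup K s \<omega> \<le> r * (x - \<bar>a - dbar\<bar> * (s - t) + b * (W s \<omega> - W t \<omega>))"
      using Zup_ge[OF that(1) K] r by (intro mult_left_mono_neg) auto
    moreover have "(- r) * \<bar>a - dbar\<bar> * (s - t) \<le> (- r) * \<bar>a - dbar\<bar> * (T - t)"
      using that r by (intro mult_left_mono mult_nonneg_nonneg) auto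
    ultimately show ?thesis
      unfolding N_def C_def abs_exp_cancel exp_add[symmetric] using that by (simp add: algebra_simps)
  qed
  have N_int: "integrable M (N s)" if "t \<le> s" "s \<le> T" for s
  proof (rule Bochner_Integration.integrable_bound)
    show "integrable M (\<lambda>\<omega>. C * exp ((r * b) * (W s \<omega> - W t \<omega>)))"
      using exp_incr(1)[OF t that(1)] by (rule integrable_mult_right)
    show "N s \<in> borel_measurable M" using F_measurable[OF _ N_meas] that t by auto
    show "AE \<omega> in M. norm (N s \<omega>) \<le> norm (C * exp ((r * b) * (W s \<omega> - W t \<omega>)))"
      using N_le[OF that] by (intro AE_I2) (simp add: abs_mult C_def)
  qed
  have sub: "submartingale_on {t..T} N"
  proof (rule submartingale_onI[where \<theta>="r * b"])
    fix s s' \<omega> assume s: "s \<in> {t..T}" "s' \<in> {t..T}" "s \<le> s'"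
    have "r * (Zup K s' \<omega> - Zup K s \<omega>) \<ge> r * (K' * (s' - s) + b * (W s' \<omega> - W s \<omega>))"
      using Zup_incr_le[of s s' K \<omega>] s K r by (intro mult_left_mono_neg) (auto simp: K'_def)
    moreover have "0 \<le> ((r * b)\<^sup>2 / 2 + r * K' - 1) * (s' - s)"
      using rK s by (intro mult_nonneg_nonneg) auto
    ultimately show "N s \<omega> * exp ((r * b) * (W s' \<omega> - W s \<omega>) - (r * b)\<^sup>2 / 2 * (s' - s)) \<le> N s' \<omega>"
      unfolding N_def exp_add[symmetric] by (simp add: algebra_simps)
  qed (use t N_meas N_int in auto)
  have N_cont: "continuous_on {t..T} (\<lambda>s. N s \<omega>)" if "\<omega> \<in> space M" for \<omega>
    unfolding N_def by (intro continuous_intros Zup_cont that)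
  let ?h = "\<lambda>c. hit (\<lambda>s \<omega>. Zup K s \<omega> < c) t T" and ?H = "hit (\<lambda>s \<omega>. Zup K s \<omega> \<le> 0) t T"
  have N_hit: "\<bar>N (?h c \<omega>) \<omega>\<bar> \<le> exp (- (?h c \<omega> - t))" "0 \<le> Zup K (?h c \<omega>) \<omega>"
    if "\<omega> \<in> space M" "0 \<le> c" for c \<omega>
  proof -
    show *: "0 \<le> Zup K (?h c \<omega>) \<omega>"
      by (rule hit_level_ge[where c=c and f="Zup K", OF T Zup_cont]) (use x that in \<open>auto simp: hit_ge T\<close>)
    have "r * Zup K (?h c \<omega>) \<omega> \<le> 0" using * r by (intro mult_nonpos_nonneg) auto
    then show "\<bar>N (?h c \<omega>) \<omega>\<bar> \<le> exp (- (?h c \<omega> - t))" by (simp add: N_def)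
  qed
  have N_hit1: "\<bar>N (?h c \<omega>) \<omega>\<bar> \<le> 1" if "\<omega> \<in> space M" "0 \<le> c" for c \<omega>
  proof -
    have "exp (- (?h c \<omega> - t)) \<le> 1" using hit_ge[OF T, of "\<lambda>s \<omega>. Zup K s \<omega> < c" \<omega>] by simp
    then show ?thesis using N_hit(1)[OF that] by linarith
  qed
  have lev: "{\<omega>\<in>space M. Zup K s \<omega> < c} \<in> sets (F s)" if "t \<le> s" for s c
    using measurable_sets_Collect[OF Zup_measurable[OF that], of "\<lambda>y. y < c"] t that by (simp add: lessThan_def[symmetric])
  have ro: "right_open t T (\<lambda>s. Zup K s \<omega> < c)" if "\<omega> \<in> space M" for c \<omega>
    by (intro right_open_level Zup_cont that)
  \<comment> \<open>Reaching zero is not a right open condition, but falling below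
    \<open>1 / real (Suc k)\<close> is; \<open>k\<close> grows afterwards.\<close>
  have ost: "expectation (\<lambda>\<omega>. N (?h (1 / real (Suc k)) \<omega>) \<omega>) \<le> expectation (\<lambda>\<omega>. N (?h 0 \<omega>) \<omega>)" for k
  proof (rule optional_stopping[OF t T sub N_cont N_le lev ro lev ro])
    show "Zup K s \<omega> < 1 / real (Suc k)" if "Zup K s \<omega> < 0" for s \<omega>
      using that by (rule less_trans) simp
  qed (use N_hit1 in auto)
  have integrand_meas: "(\<lambda>\<omega>. N (?h c \<omega>) \<omega>) \<in> borel_measurable M" for c
  proof -
    have "(\<lambda>n. N (grid t T n (grid_index (\<lambda>s \<omega>. Zup K s \<omega> < c) t T n \<omega>)) \<omega>) \<longlonglongrightarrow> N (?h c \<omega>) \<omega>"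
      if w: "\<omega> \<in> space M" for \<omega>
    proof (rule continuous_on_tendsto_compose[OF N_cont[OF w] grid_tendsto_hit[OF T]])
      show "right_open t T (\<lambda>s. Zup K s \<omega> < c)" by (rule ro[OF w])
      show "?h c \<omega> \<in> {t..T}" by (simp add: hit_ge hit_le T)
      show "\<forall>\<^sub>F n in sequentially. grid t T n (grid_index (\<lambda>s \<omega>. Zup K s \<omega> < c) t T n \<omega>) \<in> {t..T}"
        using grid_bounds[OF T] grid_index_le[of "\<lambda>s \<omega>. Zup K s \<omega> < c" t T _ \<omega>] by (intro always_eventually) simp
    qed
    moreover have "(\<lambda>\<omega>. N (grid t T n (grid_index (\<lambda>s \<omega>. Zup K s \<omega> < c) t T n \<omega>)) \<omega>) \<in> borel_measurable M" for n
    proof -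
      have le0: "(0::nat) \<le> grid_index (\<lambda>s \<omega>. Zup K s \<omega> < c) t T n \<omega>" for \<omega> by simp
      have sub': "submartingale_on (grid t T n ` {..Suc n}) N"
        using grid_bounds[OF T] by (intro submartingale_on_subset[OF sub]) auto
      have st: "{\<omega>\<in>space M. grid_index (\<lambda>s \<omega>. Zup K s \<omega> < c) t T n \<omega> \<le> i} \<in> sets (F (grid t T n i))" if "i \<le> Suc n" for i
        using lev by (intro grid_index_stopping[OF t T _ that])
      have "integrable M (\<lambda>\<omega>. N (grid t T n (grid_index (\<lambda>s \<omega>. Zup K s \<omega> < c) t T n \<omega>)) \<omega>)"
        by (rule discrete_optional_stopping(1)[OF sub' grid_mono[OF T] _ st st order_refl grid_index_le]) (use t in auto)
      then show ?thesis by simp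
    qed
    ultimately show ?thesis by (rule borel_measurable_LIMSEQ_real)
  qed
  have lim: "(\<lambda>k. N (?h (1 / real (Suc k)) \<omega>) \<omega>) \<longlonglongrightarrow> N (?H \<omega>) \<omega>" if w: "\<omega> \<in> space M" for \<omega>
  proof (rule continuous_on_tendsto_compose[OF N_cont[OF w] hit_level_tendsto[where f="Zup K", OF T Zup_cont[OF w]]])
    show "?H \<omega> \<in> {t..T}" by (simp add: hit_ge hit_le T)
    show "\<forall>\<^sub>F k in sequentially. ?h (1 / real (Suc k)) \<omega> \<in> {t..T}"
      by (intro always_eventually) (simp add: hit_ge hit_le T)
  qed
  have HM: "(\<lambda>\<omega>. N (?H \<omega>) \<omega>) \<in> borel_measurable M" by (rule borel_measurable_LIMSEQ_real[OF lim integrand_meas])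
  have "(\<lambda>k. expectation (\<lambda>\<omega>. N (?h (1 / real (Suc k)) \<omega>) \<omega>)) \<longlonglongrightarrow> expectation (\<lambda>\<omega>. N (?H \<omega>) \<omega>)"
    by (rule integral_dominated_convergence[where w="\<lambda>_. 1"])
      (use HM integrand_meas lim N_hit1 in auto)
  then have le: "expectation (\<lambda>\<omega>. N (?H \<omega>) \<omega>) \<le> expectation (\<lambda>\<omega>. N (?h 0 \<omega>) \<omega>)"
    by (rule LIMSEQ_le_const2) (use ost in auto)
  have Hh: "?H \<omega> \<le> ?h 0 \<omega>" for \<omega> by (rule hit_antimono[OF T]) simp
  \<comment> \<open>If there is a delay, \<open>Zup\<close> is zero at \<open>?H\<close>, so
    \<open>N\<close> is the pure discount factor there, and waiting until \<open>?h 0\<close> lowers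
    it strictly. The means are ordered the other way by \<open>le\<close>, so a delay has
    probability zero.\<close>
  have strict: "N (?h 0 \<omega>) \<omega> < N (?H \<omega>) \<omega>" if w: "\<omega> \<in> space M" and lt: "?H \<omega> < ?h 0 \<omega>" for \<omega>
  proof -
    have "?H \<omega> < T" using lt hit_le[OF T, of "\<lambda>s \<omega>. Zup K s \<omega> < 0" \<omega>] by simp
    then have "Zup K (?H \<omega>) \<omega> \<le> 0" by (rule hit_level_le[where f="Zup K", OF T Zup_cont[OF w]]) simp
    moreover have "0 \<le> Zup K (?H \<omega>) \<omega>"
      by (rule hit_level_ge[where c=0 and f="Zup K", OF T Zup_cont[OF w]]) (use x lt in \<open>auto simp: hit_ge T\<close>)
    ultimately have "N (?H \<omega>) \<omega> = exp (- (?H \<omega> - t))" by (simp add: N_def)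
    moreover have "exp (- (?h 0 \<omega> - t)) < exp (- (?H \<omega> - t))" using lt by simp
    moreover have "N (?h 0 \<omega>) \<omega> \<le> exp (- (?h 0 \<omega> - t))" using N_hit(1)[OF w order_refl] by linarith
    ultimately show ?thesis by linarith
  qed
  have le': "N (?h 0 \<omega>) \<omega> \<le> N (?H \<omega>) \<omega>" if "\<omega> \<in> space M" for \<omega>
    using strict[OF that] Hh[of \<omega>] by (cases "?H \<omega> = ?h 0 \<omega>") auto
  have int0: "integrable M (\<lambda>\<omega>. N (?h 0 \<omega>) \<omega>)"
    using integrand_meas N_hit1 by (intro integrable_const_bound[of _ 1]) auto
  have intH: "integrable M (\<lambda>\<omega>. N (?H \<omega>) \<omega>)"
  proof (rule integrable_const_bound[of _ 1])
    show "AE \<omega> in M. norm (N (?H \<omega>) \<omega>) \<le> 1"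
    proof (rule AE_I2)
      fix \<omega> assume w: "\<omega> \<in> space M"
      show "norm (N (?H \<omega>) \<omega>) \<le> 1"
        by (rule LIMSEQ_le_const2[OF tendsto_norm[OF lim[OF w]]]) (use N_hit1[OF w] in auto)
    qed
  qed (rule HM)
  have "expectation (\<lambda>\<omega>. N (?H \<omega>) \<omega> - N (?h 0 \<omega>) \<omega>) \<le> 0" using le int0 intH by simp
  moreover have "0 \<le> expectation (\<lambda>\<omega>. N (?H \<omega>) \<omega> - N (?h 0 \<omega>) \<omega>)" using le' by (intro integral_nonneg_AE) auto
  ultimately have "AE \<omega> in M. N (?H \<omega>) \<omega> - N (?h 0 \<omega>) \<omega> = 0"
    using le' int0 intH by (subst integral_nonneg_eq_0_iff_AE[symmetric]) auto
  then show ?thesis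
  proof (rule AE_mp, intro AE_I2 impI)
    fix \<omega> assume "\<omega> \<in> space M" "N (?H \<omega>) \<omega> - N (?h 0 \<omega>) \<omega> = 0"
    then show "?h 0 \<omega> = ?H \<omega>" using strict[of \<omega>] Hh[of \<omega>] by (cases "?H \<omega> = ?h 0 \<omega>") auto
  qed
qed

text \<open>From the first zero \<open>S\<close> on, \<open>hit0\<close> equals \<open>S\<close>, so
  \<open>Zup\<close> becomes \<open>Z s + K * (s - S)\<close>. Integer horizons cover every
  \<open>S\<close> and \<open>h\<close>, and being countable they leave one common null set.\<close>

lemma immediate_crossing:
  assumes K: "0 \<le> K"
  shows "AE \<omega> in M. \<forall>S\<ge>t. Z S \<omega> = 0 \<longrightarrow> (\<forall>s\<in>{t..<S}. 0 < Z s \<omega>) \<longrightarrow>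
    (\<forall>h>0. \<exists>s. S < s \<and> s < S + h \<and> Z s \<omega> + K * (s - S) < 0)"
proof -
  have "AE \<omega> in M. \<forall>n::nat. hit (\<lambda>s \<omega>. Zup K s \<omega> < 0) t (t + real n) \<omega> = hit (\<lambda>s \<omega>. Zup K s \<omega> \<le> 0) t (t + real n) \<omega>"
    using Zup_crosses_until[OF K] by (subst AE_all_countable) auto
  then show ?thesis
  proof (rule AE_mp, intro AE_I2 impI allI)
    fix \<omega> S h assume eq: "\<forall>n::nat. hit (\<lambda>s \<omega>. Zup K s \<omega> < 0) t (t + real n) \<omega> = hit (\<lambda>s \<omega>. Zup K s \<omega> \<le> 0) t (t + real n) \<omega>"
      and S: "t \<le> S" "Z S \<omega> = 0" "\<forall>s\<in>{t..<S}. 0 < Z s \<omega>" and h: "(0::real) < h"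
    have h0: "hit0 s \<omega> = S" if "S \<le> s" for s
    proof (rule antisym)
      show "hit0 s \<omega> \<le> S" unfolding hit0_def using S that by (intro hit_lower) auto
      show "S \<le> hit0 s \<omega>" unfolding hit0_def hit_def using S that by (intro cInf_greatest) (auto simp: not_less[symmetric])
    qed
    have h0': "hit0 s \<omega> = s" if "t \<le> s" "s < S" for s
    proof (rule antisym[OF hit0_le[OF that(1)]])
      show "s \<le> hit0 s \<omega>" unfolding hit0_def hit_def using S that by (intro cInf_greatest) (auto simp: not_less[symmetric])
    qed
    obtain n :: nat where n: "S + h - t < real n" using reals_Archimedean2 by blast
    then have T: "S + h < t + real n" by simp
    have "hit (\<lambda>s \<omega>. Zup K s \<omega> \<le> 0) t (t + real n) \<omega> \<le> S"
      using S T h h0[of S] by (intro hit_lower) (auto simp: Zup_def)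
    then have "hit (\<lambda>s \<omega>. Zup K s \<omega> < 0) t (t + real n) \<omega> < S + h" using eq h by simp
    then obtain s where s: "t \<le> s" "s < S + h" "Zup K s \<omega> < 0" using T by (auto elim: hit_lessD)
    have "S < s"
    proof (rule ccontr)
      assume "\<not> S < s"
      then have "0 \<le> Zup K s \<omega>" using s S h0[of s] h0'[of s] by (cases "s = S") (auto simp: Zup_def less_imp_le)
      then show False using s by simp
    qed
    then show "\<exists>s. S < s \<and> s < S + h \<and> Z s \<omega> + K * (s - S) < 0"
      using s h0[of s] by (intro exI[of _ s]) (auto simp: Zup_def)
  qed
qed

end

section \<open>Solutions up to ruin\<close>

lemma ruin_time_less_iff: "ruin_time t X \<omega> < c \<longleftrightarrow> (\<exists>s\<ge>t. X s \<omega> < 0 \<and> ereal s < c)"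
  unfolding ruin_time_def Inf_less_iff by auto

lemma ruin_time_ge: "ereal t \<le> ruin_time t X \<omega>"
  unfolding ruin_time_def by (rule Inf_greatest) auto

lemma nonneg_before_ruin: "t \<le> s \<Longrightarrow> ereal s < ruin_time t X \<omega> \<Longrightarrow> 0 \<le> X s \<omega>"
proof (rule ccontr)
  assume "t \<le> s" "ereal s < ruin_time t X \<omega>" "\<not> 0 \<le> X s \<omega>"
  moreover from this have "ruin_time t X \<omega> \<le> ereal s"
    unfolding ruin_time_def by (intro Inf_lower) auto
  ultimately show False by simp
qed

lemma at_left_nonneg:
  fixes f :: "real \<Rightarrow> real"
  assumes "continuous_on {t..} f" "t < s" "\<And>u. t \<le> u \<Longrightarrow> u < s \<Longrightarrow> 0 \<le> f u"
  shows "0 \<le> f s"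
proof -
  have "continuous_on {t..s} f" using assms(1) by (rule continuous_on_subset) auto
  then have "(f \<longlongrightarrow> f s) (at_left s)" using assms(2) by (intro continuous_on_Icc_at_leftD)
  moreover have "\<forall>\<^sub>F u in at_left s. 0 \<le> f u"
    unfolding eventually_at_left_field using assms by (intro exI[of _ t]) auto
  ultimately show ?thesis by (intro tendsto_lowerbound[of _ _ "at_left s"]) auto
qed

lemma first_zero:
  fixes f :: "real \<Rightarrow> real"
  assumes f: "continuous_on {t..} f" "0 \<le> f t" and s: "t \<le> s" "f s \<le> 0"
  obtains S where "t \<le> S" "f S = 0" "\<And>u. t \<le> u \<Longrightarrow> u < S \<Longrightarrow> 0 < f u"
proof -
  let ?A = "{u\<in>{t..}. f u \<le> 0}"
  define S where "S = Inf ?A"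
  have ne: "?A \<noteq> {}" and bb: "bdd_below ?A" using s by (auto intro!: bdd_belowI[of _ t])
  have "closed ({t..} \<inter> f -` {..0})" using f(1) by (intro continuous_closed_preimage) auto
  also have "{t..} \<inter> f -` {..0} = ?A" by auto
  finally have "closed ?A" .
  then have SA: "S \<in> ?A" unfolding S_def using ne bb by (intro closed_contains_Inf)
  have pos: "0 < f u" if "t \<le> u" "u < S" for u
  proof (rule ccontr)
    assume "\<not> 0 < f u"
    then have "S \<le> u" unfolding S_def using that bb by (intro cInf_lower) auto
    then show False using that by simp
  qed
  have "0 \<le> f S"
  proof (cases "S = t")
    case False
    have "0 \<le> f u" if "t \<le> u" "u < S" for u using pos[OF that] by simp
    then show ?thesis using at_left_nonneg[OF f(1), of S] False SA by simp
  qed (use f in simp)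
  then show ?thesis using that SA pos by auto
qed

lemma ruin_time_first_zero:
  assumes S: "t \<le> S" "X S \<omega> = 0" "\<And>u. t \<le> u \<Longrightarrow> u < S \<Longrightarrow> 0 < X u \<omega>"
    and cr: "\<And>h. 0 < h \<Longrightarrow> \<exists>s. S < s \<and> s < S + h \<and> X s \<omega> < 0"
  shows "ruin_time t X \<omega> = ereal S"
proof (rule antisym)
  show "ereal S \<le> ruin_time t X \<omega>" unfolding ruin_time_def
  proof (rule Inf_greatest)
    fix y assume "y \<in> ereal ` {s. t \<le> s \<and> X s \<omega> < 0}"
    then obtain s where "y = ereal s" "t \<le> s" "X s \<omega> < 0" by auto
    then show "ereal S \<le> y" using S(3)[of s] by (cases "s < S") auto
  qed
  show "ruin_time t X \<omega> \<le> ereal S"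
  proof (rule ereal_le_epsilon2)
    fix h :: real assume "0 < h"
    then obtain s where s: "S < s" "s < S + h" "X s \<omega> < 0" using cr by blast
    then have "ruin_time t X \<omega> < ereal (S + h)" unfolding ruin_time_less_iff using S(1) by (intro exI[of _ s]) auto
    then show "ruin_time t X \<omega> \<le> ereal S + ereal h" by simp
  qed
qed

lemma ruin_time_positive: "(\<And>s. t \<le> s \<Longrightarrow> 0 < X s \<omega>) \<Longrightarrow> ruin_time t X \<omega> = \<infinity>"
proof -
  assume "\<And>s. t \<le> s \<Longrightarrow> 0 < X s \<omega>"
  then have "{s. t \<le> s \<and> X s \<omega> < 0} = {}" by (auto simp: not_less[symmetric] dest: less_imp_not_less)
  then show ?thesis unfolding ruin_time_def by (simp only: image_empty Inf_empty top_ereal_def)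
qed

text \<open>Strategies are only constrained on the closed quadrant; clamping both arguments turns them
  into Borel functions on the plane.\<close>

lemma admissible_clamp_measurable:
  assumes "admissible dbar \<delta>"
  shows "(\<lambda>p::real \<times> real. \<delta> (max 0 (fst p)) (max 0 (snd p))) \<in> borel_measurable borel"
proof -
  have "(\<lambda>p::real \<times> real. (max 0 (fst p), max 0 (snd p))) \<in> measurable borel (restrict_space borel ({0..} \<times> {0..}))"
    by (intro measurable_restrict_space2 borel_measurable_continuous_onI continuous_intros) auto
  moreover have "(\<lambda>(x, t). \<delta> x t) \<in> borel_measurable (restrict_space borel ({0..} \<times> {0..}))"
    using assms by (simp add: admissible_def)
  ultimately have "(\<lambda>p. (\<lambda>(x, t). \<delta> x t) (max 0 (fst p), max 0 (snd p))) \<in> borel_measurable (borel :: (real \<times> real) measure)"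
    by (rule measurable_compose)
  then show ?thesis by simp
qed

lemma admissible_bounds: "admissible dbar \<delta> \<Longrightarrow> 0 \<le> y \<Longrightarrow> 0 \<le> s \<Longrightarrow> 0 \<le> \<delta> y s \<and> \<delta> y s \<le> dbar"
  by (auto simp: admissible_def)

lemma set_integrable_bounded_Icc:
  fixes f g :: "real \<Rightarrow> real"
  assumes "g \<in> borel_measurable borel" "\<And>u. t \<le> u \<Longrightarrow> u \<le> s \<Longrightarrow> f u = g u" "\<And>u. t \<le> u \<Longrightarrow> u \<le> s \<Longrightarrow> \<bar>g u\<bar> \<le> C"
  shows "set_integrable lborel {t..s} f"
proof -
  have "set_integrable lborel {t..s} g"
    unfolding set_integrable_def
    by (rule integrableI_bounded_set_indicator[where B=C]) (use assms in \<open>auto simp: emeasure_lborel_Icc_eq\<close>)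
  then show ?thesis
    by (rule set_integrable_cong[THEN iffD1, rotated -1]) (use assms in auto)
qed

lemma abs_diff_le_add: "0 \<le> d \<Longrightarrow> d \<le> D \<Longrightarrow> \<bar>a - d\<bar> \<le> \<bar>a\<bar> + D" for a d D :: real
  by linarith

text \<open>Fixes one outcome, after which the equation is deterministic: \<open>w\<close> is the
  noise and \<open>z\<close> the candidate with rate \<open>e\<close> at all times. The margin
  \<open>dbar * (s - S)\<close> in the crossing hypothesis is the most by which a solution can
  outrun \<open>z\<close> after the first zero, as \<open>e \<le> dbar\<close> and rates are
  nonnegative.\<close>

locale surplus_path =
  fixes a dbar t x :: real and \<delta> :: "real \<Rightarrow> real \<Rightarrow> real" and e w z :: "real \<Rightarrow> real"
  assumes adm: "admissible dbar \<delta>" and t0: "0 \<le> t" and x0: "0 \<le> x"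
    and e: "e \<in> borel_measurable borel" "\<And>u. 0 \<le> e u" "\<And>u. e u \<le> dbar"
    and \<delta>e: "\<And>y u. 0 < y \<Longrightarrow> t \<le> u \<Longrightarrow> \<delta> y u = e u"
    and wt: "w t = 0"
    and z: "\<And>s. t \<le> s \<Longrightarrow> z s = x + (LINT u:{t..s}|lborel. a - e u) + w s"
    and z_cont: "continuous_on {t..} z"
    and crossing: "\<And>S h. t \<le> S \<Longrightarrow> z S = 0 \<Longrightarrow> (\<And>u. t \<le> u \<Longrightarrow> u < S \<Longrightarrow> 0 < z u) \<Longrightarrow> 0 < h \<Longrightarrow>
      \<exists>s. S < s \<and> s < S + h \<and> z s + dbar * (s - S) < 0"
begin

lemma dbar0: "0 \<le> dbar" using e by (meson order_trans)

lemma zt: "z t = x"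
proof -
  have "(LINT u:{t..t}|lborel. a - e u) = 0"
    unfolding set_lebesgue_integral_def
    by (rule integral_eq_zero_AE) (use AE_lborel_singleton[of t] in \<open>auto elim!: eventually_mono\<close>)
  then show ?thesis using z[of t] wt by simp
qed

lemma e_integrable: "set_integrable lborel {t..s} (\<lambda>u. a - e u)"
proof (rule set_integrable_bounded_Icc[where g="\<lambda>u. a - e u" and C="\<bar>a\<bar> + dbar"])
  show "(\<lambda>u. a - e u) \<in> borel_measurable borel" using e(1) by (intro borel_measurable_diff borel_measurable_const)
  show "\<bar>a - e u\<bar> \<le> \<bar>a\<bar> + dbar" for u
    using abs_triangle_ineq4[of a "e u"] e(2,3)[of u] abs_of_nonneg[OF e(2)[of u]] by simp
qed simp

lemma \<delta>_integrable:
  assumes X: "continuous_on {t..} X" "\<And>u. t \<le> u \<Longrightarrow> u \<le> s \<Longrightarrow> 0 \<le> X u"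
  shows "set_integrable lborel {t..s} (\<lambda>u. a - \<delta> (X u) u)"
proof (rule set_integrable_bounded_Icc[where g="\<lambda>u. a - \<delta> (max 0 (X (max t u))) (max 0 u)" and C="\<bar>a\<bar> + dbar"])
  have "continuous_on UNIV (\<lambda>u. X (max t u))"
    by (rule continuous_on_compose2[OF X(1)]) (auto intro!: continuous_intros)
  then have Xm: "(\<lambda>u. X (max t u)) \<in> borel_measurable borel" by (rule borel_measurable_continuous_onI)
  have "(\<lambda>u. (X (max t u), u)) \<in> borel_measurable borel" using Xm by measurable
  from measurable_compose[OF this admissible_clamp_measurable[OF adm]]
  show "(\<lambda>u. a - \<delta> (max 0 (X (max t u))) (max 0 u)) \<in> borel_measurable borel"
    by (intro borel_measurable_diff borel_measurable_const) simp
  fix u assume u: "t \<le> u" "u \<le> s"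
  then show "a - \<delta> (X u) u = a - \<delta> (max 0 (X (max t u))) (max 0 u)" using X(2)[of u] t0 by simp
  show "\<bar>a - \<delta> (max 0 (X (max t u))) (max 0 u)\<bar> \<le> \<bar>a\<bar> + dbar"
    using admissible_bounds[OF adm max.cobounded1 max.cobounded1] by (intro abs_diff_le_add) blast+
qed

text \<open>At positive surplus \<open>\<delta>\<close> and \<open>e\<close> agree; only the
  endpoint \<open>s\<close>, a null set, can have zero surplus.\<close>

lemma drift_integral_eq:
  assumes X: "continuous_on {t..} X" "0 \<le> X t" and s: "t \<le> s" and pos: "\<And>u. t \<le> u \<Longrightarrow> u < s \<Longrightarrow> 0 < X u"
  shows "(LINT u:{t..s}|lborel. a - \<delta> (X u) u) = (LINT u:{t..s}|lborel. a - e u)"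
proof -
  have nn: "0 \<le> X u" if u: "t \<le> u" "u \<le> s" for u
  proof (cases "u = t")
    case False
    have "0 \<le> X v" if "t \<le> v" "v < u" for v using pos[of v] that u by simp
    then show ?thesis using at_left_nonneg[OF X(1), of u] False u by simp
  qed (use X in simp)
  show ?thesis unfolding set_lebesgue_integral_def
  proof (rule integral_cong_AE)
    show "(\<lambda>u. indicator {t..s} u *\<^sub>R (a - \<delta> (X u) u)) \<in> borel_measurable lborel"
      using \<delta>_integrable[OF X(1) nn, of s] unfolding set_integrable_def by simp
    show "(\<lambda>u. indicator {t..s} u *\<^sub>R (a - e u)) \<in> borel_measurable lborel"
      using e_integrable[of s] unfolding set_integrable_def by simp
    show "AE u in lborel. indicator {t..s} u *\<^sub>R (a - \<delta> (X u) u) = indicator {t..s} u *\<^sub>R (a - e u)"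
      using AE_lborel_singleton[of s]
      by eventually_elim (use pos \<delta>e in \<open>auto simp: indicator_def\<close>)
  qed
qed

lemma z_ruin:
  assumes "t \<le> S" "z S = 0" "\<And>u. t \<le> u \<Longrightarrow> u < S \<Longrightarrow> 0 < z u"
  shows "ruin_time t (\<lambda>s _. z s) \<omega> = ereal S"
proof (rule ruin_time_first_zero)
  fix h :: real assume "0 < h"
  with crossing[OF assms] obtain s where s: "S < s" "s < S + h" "z s + dbar * (s - S) < 0" by blast
  moreover have "0 \<le> dbar * (s - S)" using dbar0 s by (intro mult_nonneg_nonneg) auto
  ultimately show "\<exists>s. S < s \<and> s < S + h \<and> z s < 0" by (intro exI[of _ s]) auto
qed (use assms in auto)

lemma z_positive:
  assumes "t \<le> s" "ereal s < ruin_time t (\<lambda>s _. z s) \<omega>"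
  shows "0 < z s"
proof (rule ccontr)
  assume "\<not> 0 < z s"
  then obtain S where S: "t \<le> S" "z S = 0" "\<And>u. t \<le> u \<Longrightarrow> u < S \<Longrightarrow> 0 < z u"
    using first_zero[OF z_cont _ assms(1)] zt x0 by auto
  then have "s < S" using assms z_ruin[OF S, of \<omega>] by simp
  then show False using S(3)[OF assms(1)] \<open>\<not> 0 < z s\<close> by simp
qed

lemma z_solves:
  assumes "t \<le> s" "ereal s \<le> ruin_time t (\<lambda>s _. z s) \<omega>"
  shows "z s = x + (LINT u:{t..s}|lborel. a - \<delta> (z u) u) + w s"
proof -
  have "0 < z u" if "t \<le> u" "u < s" for u
  proof (rule z_positive[OF that(1)])
    have "ereal u < ereal s" using that by simp
    then show "ereal u < ruin_time t (\<lambda>s _. z s) \<omega>" using assms(2) by (rule less_le_trans)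
  qed
  then show ?thesis using drift_integral_eq[OF z_cont _ assms(1)] zt x0 z[OF assms(1)] by simp
qed

text \<open>Up to the first zero \<open>S\<close> the solution coincides with \<open>z\<close>.
  Afterwards the two may separate, since the rate at zero is not prescribed, but before ruin by at
  most \<open>dbar * (s - S)\<close>; as \<open>z\<close> crosses with that margin, \<open>X\<close>
  is forced below zero immediately. Ruin time and positivity are all that the payoff depends
  on.\<close>

lemma solution_unique:
  fixes X :: "real \<Rightarrow> real" and \<omega> :: 'b
  assumes X: "continuous_on {t..} X"
    and eq: "\<And>s. t \<le> s \<Longrightarrow> ereal s \<le> ruin_time t (\<lambda>s _. X s) \<omega> \<Longrightarrow>
      X s = x + (LINT u:{t..s}|lborel. a - \<delta> (X u) u) + w s"
  shows "ruin_time t (\<lambda>s _. X s) \<omega> = ruin_time t (\<lambda>s _. z s) \<omega>"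
    "\<And>s. t \<le> s \<Longrightarrow> ereal s < ruin_time t (\<lambda>s _. X s) \<omega> \<Longrightarrow> 0 < X s"
proof -
  let ?R = "ruin_time t (\<lambda>s _. X s) \<omega>" and ?Rz = "ruin_time t (\<lambda>s _. z s) \<omega>"
  have "(LINT u:{t..t}|lborel. a - \<delta> (X u) u) = 0"
    unfolding set_lebesgue_integral_def
    by (rule integral_eq_zero_AE) (use AE_lborel_singleton[of t] in \<open>auto elim!: eventually_mono\<close>)
  then have Xt: "X t = x" using eq[OF order_refl ruin_time_ge] wt by simp
  have same: "X s = z s" if "t \<le> s" "ereal s \<le> ?R" "\<And>u. t \<le> u \<Longrightarrow> u < s \<Longrightarrow> 0 < X u" for s
    using eq[OF that(1,2)] z[OF that(1)] drift_integral_eq[OF X _ that(1,3)] Xt x0 by simp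
  have "?R = ?Rz \<and> (\<forall>s. t \<le> s \<longrightarrow> ereal s < ?R \<longrightarrow> 0 < X s)"
  proof (cases "\<exists>s\<ge>t. X s \<le> 0")
    case False
    then have pos: "\<And>s. t \<le> s \<Longrightarrow> 0 < X s" using not_le by blast
    then have R: "?R = \<infinity>" by (rule ruin_time_positive)
    have "\<And>s. t \<le> s \<Longrightarrow> 0 < z s" using same R pos by (metis ereal_less_eq(1))
    then have "?Rz = \<infinity>" by (rule ruin_time_positive)
    then show ?thesis using R pos by simp
  next
    case True
    then obtain S where S: "t \<le> S" "X S = 0" "\<And>u. t \<le> u \<Longrightarrow> u < S \<Longrightarrow> 0 < X u"
      using first_zero[OF X] Xt x0 by metis
    have SR: "ereal S \<le> ?R" unfolding ruin_time_def
    proof (rule Inf_greatest)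
      fix y assume "y \<in> ereal ` {s. t \<le> s \<and> X s < 0}"
      then obtain s where "y = ereal s" "t \<le> s" "X s < 0" by auto
      then show "ereal S \<le> y" using S(3)[of s] by (cases "s < S") auto
    qed
    have XZ: "X s = z s" if "t \<le> s" "s \<le> S" for s
      by (rule same) (use that S SR in \<open>auto intro: order_trans[of _ "ereal S"]\<close>)
    have zS: "z S = 0" "\<And>u. t \<le> u \<Longrightarrow> u < S \<Longrightarrow> 0 < z u"
      using XZ[of S] XZ S by auto
    have Rz: "?Rz = ereal S" by (rule z_ruin[OF S(1) zS])
    have "?R \<le> ereal S"
    proof (rule ccontr)
      assume "\<not> ?R \<le> ereal S"
      then have lt: "ereal S < ?R" by simp
      \<comment> \<open>Room before the supposed later ruin, within which the equation still holds
        and \<open>X\<close> is nonnegative.\<close>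
      obtain h where h: "0 < h" "ereal (S + h) \<le> ?R"
      proof (cases ?R)
        case (real r)
        then show ?thesis using that[of "r - S"] lt by simp
      next
        case PInf
        then show ?thesis using that[of 1] by simp
      qed (use lt in simp)
      obtain s where s: "S < s" "s < S + h" "z s + dbar * (s - S) < 0"
        using crossing[OF S(1) zS h(1)] by blast
      have "ereal s < ereal (S + h)" using s by simp
      then have sR: "ereal s < ?R" using h(2) by (rule less_le_trans)
      have nn: "0 \<le> X u" if "t \<le> u" "u \<le> s" for u
      proof (rule nonneg_before_ruin[of t u "\<lambda>s _. X s" \<omega>])
        show "ereal u < ?R" using that sR by (auto intro: le_less_trans[of _ "ereal s"])
      qed (use that in simp)
      have ts: "t \<le> s" using S s by simp
      have "X s - z s = (LINT u:{t..s}|lborel. a - \<delta> (X u) u) - (LINT u:{t..s}|lborel. a - e u)"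
        using eq[OF ts] sR z[OF ts] by simp
      also have "\<dots> = (LINT u:{t..s}|lborel. (a - \<delta> (X u) u) - (a - e u))"
        by (rule set_integral_diff(2)[symmetric]) (use \<delta>_integrable[OF X nn] e_integrable in auto)
      \<comment> \<open>Before \<open>S\<close> both rates agree; from \<open>S\<close> on the gap
        \<open>e u - \<delta> (X u) u\<close> is at most \<open>dbar\<close>.\<close>
      also have "\<dots> \<le> (LINT u:{t..s}|lborel. indicator {S..s} u * dbar)"
      proof (rule set_integral_mono)
        show "set_integrable lborel {t..s} (\<lambda>u. (a - \<delta> (X u) u) - (a - e u))"
          by (rule set_integral_diff(1)) (use \<delta>_integrable[OF X nn] e_integrable in auto)
        show "set_integrable lborel {t..s} (\<lambda>u. indicator {S..s} u * dbar)"
          by (rule set_integrable_bounded_Icc[where g="\<lambda>u. indicator {S..s} u * dbar" and C=dbar])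
             (use dbar0 in \<open>auto simp: indicator_def\<close>)
        fix u assume u: "u \<in> {t..s}"
        show "(a - \<delta> (X u) u) - (a - e u) \<le> indicator {S..s} u * dbar"
        proof (cases "u < S")
          case True
          then show ?thesis using u S(3)[of u] \<delta>e[of "X u" u] by simp
        next
          case False
          then show ?thesis using u e(3)[of u] admissible_bounds[OF adm nn[of u], of u] t0 by simp
        qed
      qed
      also have "\<dots> = (LINT u|lborel. indicator {S..s} u * dbar)"
        unfolding set_lebesgue_integral_def by (rule Bochner_Integration.integral_cong) (use S in \<open>auto simp: indicator_def\<close>)
      also have "\<dots> = dbar * (s - S)" using s by simp
      finally show False using s(3) nn[of s] ts by simp
    qed
    then have "?R = ereal S" using SR by simp
    then show ?thesis using Rz S by simp
  qed
  then show "?R = ?Rz" "\<And>s. t \<le> s \<Longrightarrow> ereal s < ?R \<Longrightarrow> 0 < X s" by auto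
qed

end

section \<open>Measurability and discounting\<close>

text \<open>A negative value persists for a short time by continuity, so some rational time
  witnesses it and a countable union is enough.\<close>

lemma ruin_time_measurable:
  assumes X: "\<And>s. t \<le> s \<Longrightarrow> X s \<in> borel_measurable M"
    and cont: "\<And>\<omega>. \<omega> \<in> space M \<Longrightarrow> continuous_on {t..} (\<lambda>s. X s \<omega>)"
  shows "ruin_time t X \<in> borel_measurable M"
  unfolding borel_measurable_ereal_iff_Iio
proof
  fix c :: ereal
  let ?Q = "{q. t \<le> real_of_rat q \<and> ereal (real_of_rat q) < c}"
  have "ruin_time t X -` {..<c} \<inter> space M = (\<Union>q\<in>?Q. {\<omega>\<in>space M. X (real_of_rat q) \<omega> < 0})"
  proof (intro set_eqI iffI)
    fix \<omega> assume "\<omega> \<in> ruin_time t X -` {..<c} \<inter> space M"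
    then obtain s where w: "\<omega> \<in> space M" and s: "t \<le> s" "X s \<omega> < 0" "ereal s < c"
      by (auto simp: ruin_time_less_iff)
    obtain T where T: "s < T" "ereal T \<le> c"
    proof (cases c)
      case (real r) then show ?thesis using that[of r] s by simp
    next
      case PInf then show ?thesis using that[of "s + 1"] by simp
    qed (use s in simp)
    have "right_open t T (\<lambda>s. X s \<omega> < 0)"
      by (intro right_open_level continuous_on_subset[OF cont[OF w]]) auto
    then obtain h where h: "0 < h" "\<And>s'. s \<le> s' \<Longrightarrow> s' < s + h \<Longrightarrow> X s' \<omega> < 0"
      using s T unfolding right_open_def by metis
    obtain q where q: "s < real_of_rat q" "real_of_rat q < min (s + h) T"
      using of_rat_dense[of s "min (s + h) T"] h T by auto
    have "ereal (real_of_rat q) < ereal T" using q by simp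
    then have "ereal (real_of_rat q) < c" using T(2) by (rule less_le_trans)
    then show "\<omega> \<in> (\<Union>q\<in>?Q. {\<omega>\<in>space M. X (real_of_rat q) \<omega> < 0})"
      using q s w h(2)[of "real_of_rat q"] by (intro UN_I[of q]) auto
  next
    fix \<omega> assume "\<omega> \<in> (\<Union>q\<in>?Q. {\<omega>\<in>space M. X (real_of_rat q) \<omega> < 0})"
    then show "\<omega> \<in> ruin_time t X -` {..<c} \<inter> space M" by (auto simp: ruin_time_less_iff)
  qed
  also have "\<dots> \<in> sets M"
  proof (rule sets.countable_UN''[OF countable_subset[OF subset_UNIV]])
    fix q assume "q \<in> ?Q"
    then have "X (real_of_rat q) \<in> borel_measurable M" by (intro X) simp
    then show "{\<omega>\<in>space M. X (real_of_rat q) \<omega> < 0} \<in> sets M" by measurable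
  qed auto
  finally show "ruin_time t X -` {..<c} \<inter> space M \<in> sets M" .
qed

text \<open>Rounding time up to a mesh of width \<open>1 / real (Suc n)\<close> makes the process
  depend on time through a countable index; the rounded times converge and continuity does the
  rest.\<close>

lemma continuous_process_joint_measurable:
  fixes X :: "real \<Rightarrow> 'w \<Rightarrow> real"
  assumes X: "\<And>s. t \<le> s \<Longrightarrow> X s \<in> borel_measurable M"
    and cont: "\<And>\<omega>. \<omega> \<in> space M \<Longrightarrow> continuous_on {t..} (\<lambda>s. X s \<omega>)"
  shows "(\<lambda>(\<omega>, s). X (max t s) \<omega>) \<in> borel_measurable (M \<Otimes>\<^sub>M lborel)"
proof (rule borel_measurable_LIMSEQ_real)
  let ?u = "\<lambda>n (s::real). t + real (nat \<lceil>(s - t) * real (Suc n)\<rceil>) / real (Suc n)"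
  fix n
  have "(\<lambda>(\<omega>, s). nat \<lceil>(s - t) * real (Suc n)\<rceil>) \<in> measurable (M \<Otimes>\<^sub>M lborel) (count_space UNIV)"
    by measurable
  moreover have "(\<lambda>(\<omega>, s::real). X (t + real i / real (Suc n)) \<omega>) \<in> borel_measurable (M \<Otimes>\<^sub>M lborel)" for i
  proof -
    have "X (t + real i / real (Suc n)) \<in> borel_measurable M" by (rule X) simp
    then show ?thesis by measurable
  qed
  ultimately show "(\<lambda>(\<omega>, s). X (?u n s) \<omega>) \<in> borel_measurable (M \<Otimes>\<^sub>M lborel)"
    using measurable_compose_countable[of "\<lambda>i (\<omega>, s::real). X (t + real i / real (Suc n)) \<omega>" "M \<Otimes>\<^sub>M lborel" borel
        "\<lambda>(\<omega>, s). nat \<lceil>(s - t) * real (Suc n)\<rceil>"]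
    by (simp add: case_prod_beta' del: of_nat_Suc)
next
  let ?u = "\<lambda>n (s::real). t + real (nat \<lceil>(s - t) * real (Suc n)\<rceil>) / real (Suc n)"
  fix p :: "'w \<times> real" assume p: "p \<in> space (M \<Otimes>\<^sub>M lborel)"
  obtain \<omega> s where ps: "p = (\<omega>, s)" by (cases p)
  have w: "\<omega> \<in> space M" using p ps by (auto simp: space_pair_measure)
  have "(\<lambda>n. ?u n s) \<longlonglongrightarrow> max t s"
  proof (rule tendsto_sandwich[where f="\<lambda>_. max t s" and h="\<lambda>n. max t s + 1 / real (Suc n)"])
    have "(\<lambda>n. 1 / real (Suc n)) \<longlonglongrightarrow> 0" by (rule LIMSEQ_Suc) (rule lim_const_over_n)
    from tendsto_add[OF tendsto_const[of "max t s"] this]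
    show "(\<lambda>n. max t s + 1 / real (Suc n)) \<longlonglongrightarrow> max t s" by simp
    show "\<forall>\<^sub>F n in sequentially. max t s \<le> ?u n s"
    proof (intro always_eventually allI)
      fix n
      have "(s - t) * real (Suc n) \<le> real (nat \<lceil>(s - t) * real (Suc n)\<rceil>)" by linarith
      then have "s - t \<le> real (nat \<lceil>(s - t) * real (Suc n)\<rceil>) / real (Suc n)"
        by (subst pos_le_divide_eq) auto
      moreover have "0 \<le> real (nat \<lceil>(s - t) * real (Suc n)\<rceil>) / real (Suc n)" by simp
      ultimately show "max t s \<le> ?u n s" by linarith
    qed
    show "\<forall>\<^sub>F n in sequentially. ?u n s \<le> max t s + 1 / real (Suc n)"
    proof (intro always_eventually allI)
      fix n
      have "real (nat \<lceil>(s - t) * real (Suc n)\<rceil>) \<le> max 0 ((s - t) * real (Suc n)) + 1" by linarith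
      also have "max 0 ((s - t) * real (Suc n)) = (max t s - t) * real (Suc n)"
        by (auto simp: max_def mult_le_0_iff zero_le_mult_iff not_le mult_less_0_iff simp del: of_nat_Suc)
      finally have "real (nat \<lceil>(s - t) * real (Suc n)\<rceil>) / real (Suc n)
          \<le> ((max t s - t) * real (Suc n) + 1) / real (Suc n)"
        by (intro divide_right_mono) auto
      also have "\<dots> = max t s - t + 1 / real (Suc n)" by (simp add: add_divide_distrib del: of_nat_Suc)
      finally show "?u n s \<le> max t s + 1 / real (Suc n)" by linarith
    qed
  qed simp
  then have "(\<lambda>n. X (?u n s) \<omega>) \<longlonglongrightarrow> X (max t s) \<omega>"
    by (rule continuous_on_tendsto_compose[OF cont[OF w]]) (auto intro!: always_eventually)
  then show "(\<lambda>n. (\<lambda>(\<omega>, s). X (?u n s) \<omega>) p) \<longlonglongrightarrow> (\<lambda>(\<omega>, s). X (max t s) \<omega>) p" by (simp add: ps)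
qed

text \<open>Before ruin the surplus is nonnegative, so the clamped strategy gives the same integrand
  while being jointly measurable; integrating out time preserves measurability.\<close>

lemma discounted_dividends_measurable:
  fixes X :: "real \<Rightarrow> 'w \<Rightarrow> real"
  assumes adm: "admissible dbar \<delta>" and t: "0 \<le> t"
    and X: "\<And>s. t \<le> s \<Longrightarrow> X s \<in> borel_measurable M"
    and cont: "\<And>\<omega>. \<omega> \<in> space M \<Longrightarrow> continuous_on {t..} (\<lambda>s. X s \<omega>)"
  shows "discounted_dividends \<rho> \<delta> t X \<in> borel_measurable M"
proof -
  let ?P = "M \<Otimes>\<^sub>M (lborel :: real measure)"
  let ?g = "\<lambda>\<omega> s. indicator {s. t \<le> s \<and> ereal s < ruin_time t X \<omega>} s *
      (exp (- \<rho> * (s - t)) * \<delta> (max 0 (X (max t s) \<omega>)) (max 0 s))"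
  have R: "(\<lambda>p. ruin_time t X (fst p)) \<in> borel_measurable ?P"
    using ruin_time_measurable[OF X cont] by measurable
  have [measurable]: "Measurable.pred ?P (\<lambda>p. t \<le> snd p \<and> ereal (snd p) < ruin_time t X (fst p))"
    using R by measurable
  have ind: "(\<lambda>p. indicator {s. t \<le> s \<and> ereal s < ruin_time t X (fst p)} (snd p) :: real) \<in> borel_measurable ?P"
  proof -
    have "(\<lambda>p. indicator {p\<in>space ?P. t \<le> snd p \<and> ereal (snd p) < ruin_time t X (fst p)} p :: real) \<in> borel_measurable ?P"
      by measurable
    then show ?thesis by (rule measurable_cong[THEN iffD1, rotated]) (auto simp: indicator_def)
  qed
  have Xj: "(\<lambda>p. X (max t (snd p)) (fst p)) \<in> borel_measurable ?P"
    using continuous_process_joint_measurable[OF X cont] by (simp add: case_prod_beta')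
  then have "(\<lambda>p. (X (max t (snd p)) (fst p), snd p)) \<in> borel_measurable ?P" by measurable
  from measurable_compose[OF this admissible_clamp_measurable[OF adm]]
  have D: "(\<lambda>p. \<delta> (max 0 (X (max t (snd p)) (fst p))) (max 0 (snd p))) \<in> borel_measurable ?P" by simp
  have E: "(\<lambda>p. exp (- \<rho> * (snd p - t))) \<in> borel_measurable ?P" by measurable
  have "case_prod ?g \<in> borel_measurable ?P"
    unfolding case_prod_beta' by (intro borel_measurable_times ind D E)
  then have "(\<lambda>\<omega>. \<integral>s. ?g \<omega> s \<partial>lborel) \<in> borel_measurable M"
    by (rule lborel.borel_measurable_lebesgue_integral)
  moreover have "(\<integral>s. ?g \<omega> s \<partial>lborel) = discounted_dividends \<rho> \<delta> t X \<omega>" for \<omega>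
    unfolding discounted_dividends_def set_lebesgue_integral_def
  proof (intro Bochner_Integration.integral_cong refl)
    fix s
    show "?g \<omega> s = indicator {s. t \<le> s \<and> ereal s < ruin_time t X \<omega>} s *\<^sub>R (exp (- \<rho> * (s - t)) * \<delta> (X s \<omega>) s)"
      using nonneg_before_ruin[of t s X \<omega>] t by (auto simp: indicator_def)
  qed
  ultimately show ?thesis by simp
qed

lemma has_bochner_integral_discount:
  fixes \<rho> :: real
  assumes \<rho>: "0 < \<rho>" and T: "T = \<infinity> \<or> (\<exists>r\<ge>t. T = ereal r)"
  shows "has_bochner_integral lborel (\<lambda>s. indicator {s. t \<le> s \<and> ereal s < T} s * exp (- \<rho> * (s - t)))
     ((1 - (if T = \<infinity> then 0 else exp (- \<rho> * (real_of_ereal T - t)))) / \<rho>)"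
proof -
  let ?F = "\<lambda>s. - exp (- \<rho> * (s - t)) / \<rho>"
  have deriv: "DERIV ?F s :> exp (- \<rho> * (s - t))" for s
    using \<rho> by (auto intro!: derivative_eq_intros)
  show ?thesis
  proof (cases "T = \<infinity>")
    case True
    have lim: "(?F \<longlongrightarrow> 0) at_top" using \<rho> by real_asymp
    have "(\<integral>\<^sup>+s. ennreal (exp (- \<rho> * (s - t))) * indicator {t..} s \<partial>lborel) = 0 - ?F t"
      by (rule nn_integral_FTC_atLeast[OF _ deriv _ lim]) auto
    then have "(\<integral>\<^sup>+s. ennreal (indicator {s. t \<le> s \<and> ereal s < T} s * exp (- \<rho> * (s - t))) \<partial>lborel) = ennreal (1 / \<rho>)"
      using True by (auto simp: indicator_def intro!: nn_integral_cong elim!: trans[rotated])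
    then show ?thesis using True \<rho> by (intro has_bochner_integral_nn_integral) auto
  next
    case False
    then obtain r where r: "T = ereal r" "t \<le> r" using T by auto
    have "has_bochner_integral lborel (\<lambda>s. exp (- \<rho> * (s - t)) * indicator {t..r} s) (?F r - ?F t)"
      by (rule has_bochner_integral_FTC_Icc_real[OF r(2) deriv]) (intro continuous_intros)
    moreover have "?F r - ?F t = (1 - exp (- \<rho> * (r - t))) / \<rho>" by (simp add: diff_divide_distrib)
    ultimately have "has_bochner_integral lborel (\<lambda>s. exp (- \<rho> * (s - t)) * indicator {t..r} s) ((1 - exp (- \<rho> * (r - t))) / \<rho>)"
      by metis
    then have "has_bochner_integral lborel (\<lambda>s. indicator {s. t \<le> s \<and> ereal s < T} s * exp (- \<rho> * (s - t))) ((1 - exp (- \<rho> * (r - t))) / \<rho>)"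
    proof (rule has_bochner_integral_cong_AE[THEN iffD1, rotated -1])
      show "AE s in lborel. exp (- \<rho> * (s - t)) * indicator {t..r} s = indicator {s. t \<le> s \<and> ereal s < T} s * exp (- \<rho> * (s - t))"
        using AE_lborel_singleton[of r] by eventually_elim (auto simp: indicator_def r)
    qed (use r in measurable)
    then show ?thesis using r by simp
  qed
qed

section \<open>Moments of the payoff\<close>

text \<open>On a null set containing the discontinuous paths, \<open>B\<close> is replaced by zero.
  That set already belongs to the filtration, and the laws and independence of increments do not
  change under almost sure equality.\<close>

lemma brownian_version:
  assumes bm: "standard_brownian_motion M B"
  obtains W where "brownian_filtration M (natural_filtration M B) W" "AE \<omega> in M. \<forall>s. W s \<omega> = B s \<omega>"
proof -
  interpret prob_space M using bm by (simp add: standard_brownian_motion_def)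
  have meas: "B u \<in> borel_measurable M" if "0 \<le> u" for u
    using bm that by (auto simp: standard_brownian_motion_def)
  have "AE \<omega> in M. continuous_on {0..} (\<lambda>s. B s \<omega>)" using bm by (simp add: standard_brownian_motion_def)
  then obtain N where N: "N \<in> null_sets M" "{\<omega>\<in>space M. \<not> continuous_on {0..} (\<lambda>s. B s \<omega>)} \<subseteq> N"
    by (auto simp: eventually_ae_filter)
  define W where "W s \<omega> = (if \<omega> \<in> N then 0 else B s \<omega>)" for s \<omega>
  have WB: "AE \<omega> in M. \<forall>s. W s \<omega> = B s \<omega>"
    using AE_not_in[OF N(1)] by eventually_elim (simp add: W_def)
  have W_F: "W s \<in> borel_measurable (natural_filtration M B s)" if "0 \<le> s" for s
    unfolding W_def[abs_def]
    by (intro measurable_If_set borel_measurable_const borel_measurable_natural_filtration that)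
       (use N(1) in \<open>simp add: Int_absorb2 sets.sets_into_space null_setsD2 null_set_natural_filtration\<close>)
  have W_meas: "W s \<in> borel_measurable M" if "0 \<le> s" for s
    by (rule measurable_from_subalg[OF subalgebra_natural_filtration[OF meas] W_F[OF that]])
  have "brownian_filtration M (natural_filtration M B) W"
  proof unfold_locales
    show "subalgebra M (natural_filtration M B s)" for s
      by (rule subalgebra_natural_filtration[OF meas])
    show "sets (natural_filtration M B s) \<subseteq> sets (natural_filtration M B s')" if "s \<le> s'" for s s'
      by (rule natural_filtration_mono[OF that])
    show "continuous_on {0..} (\<lambda>s. W s \<omega>)" if "\<omega> \<in> space M" for \<omega>
      using N(2) that by (cases "\<omega> \<in> N") (auto simp: W_def)
    fix s s' :: real assume s: "0 \<le> s" "s < s'"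
    then have s': "0 \<le> s'" by simp
    have Wm: "(\<lambda>\<omega>. W s' \<omega> - W s \<omega>) \<in> borel_measurable M"
      and Bm: "(\<lambda>\<omega>. B s' \<omega> - B s \<omega>) \<in> borel_measurable M"
      by (intro borel_measurable_diff W_meas meas s s')+
    have ae: "AE \<omega> in M. B s' \<omega> - B s \<omega> = W s' \<omega> - W s \<omega>"
      using WB by eventually_elim simp
    have dB: "distributed M lborel (\<lambda>\<omega>. B s' \<omega> - B s \<omega>) (normal_density 0 (sqrt (s' - s)))"
      using bm s by (simp add: standard_brownian_motion_def)
    have "distr M lborel (\<lambda>\<omega>. B s' \<omega> - B s \<omega>) = distr M lborel (\<lambda>\<omega>. W s' \<omega> - W s \<omega>)"
      using ae Wm Bm by (intro distr_cong_AE) auto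
    then show "distributed M lborel (\<lambda>\<omega>. W s' \<omega> - W s \<omega>) (normal_density 0 (sqrt (s' - s)))"
      using dB Wm unfolding distributed_def by simp
    let ?C = "\<lambda>B. {(\<lambda>\<omega>. B s' \<omega> - B s \<omega>) -` D \<inter> space M | D. D \<in> sets (borel :: real measure)}"
    note indB = natural_filtration_indep[OF bm s]
    show "indep_set (sets (natural_filtration M B s)) (?C W)"
    proof (rule indep_setI)
      show ev: "sets (natural_filtration M B s) \<subseteq> events" by (rule indep_setD_ev1[OF indB])
      show "?C W \<subseteq> events" using measurable_sets[OF Wm] by auto
      fix E c assume E: "E \<in> sets (natural_filtration M B s)" and c: "c \<in> ?C W"
      then obtain D where D: "D \<in> sets borel" "c = (\<lambda>\<omega>. W s' \<omega> - W s \<omega>) -` D \<inter> space M" by auto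
      define c' where "c' = (\<lambda>\<omega>. B s' \<omega> - B s \<omega>) -` D \<inter> space M"
      have cm: "c \<in> events" "c' \<in> events" "E \<in> events"
        using measurable_sets[OF Wm D(1)] measurable_sets[OF Bm D(1)] D(2) ev E by (auto simp: c'_def)
      have cc: "AE \<omega> in M. \<omega> \<in> c \<longleftrightarrow> \<omega> \<in> c'"
        using ae by eventually_elim (simp add: D(2) c'_def)
      have "prob c = prob c'" using cc cm by (intro finite_measure_eq_AE) auto
      moreover have "prob (E \<inter> c) = prob (E \<inter> c')"
        by (intro finite_measure_eq_AE) (use cc cm in \<open>auto elim!: eventually_mono\<close>)
      moreover have "prob (E \<inter> c') = prob E * prob c'"
        by (rule indep_setD[OF indB E]) (use D(1) in \<open>auto simp: c'_def\<close>)
      ultimately show "prob (E \<inter> c) = prob E * prob c" by simp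
    qed
  qed (use W_F in auto)
  with that WB show ?thesis by blast
qed

lemma drift_integral:
  fixes a d dbar \<epsilon> t s :: real
  assumes "t \<le> s" "0 \<le> \<epsilon>"
  shows "(LINT u:{t..s}|lborel. a - (if u < t + \<epsilon> then d else dbar)) = (a - dbar) * (s - t) + (dbar - d) * min (s - t) \<epsilon>"
proof -
  have meas: "measure lborel ({t..s} \<inter> {..<t + \<epsilon>}) = min (s - t) \<epsilon>"
  proof (cases "s < t + \<epsilon>")
    case True
    then have "{t..s} \<inter> {..<t + \<epsilon>} = {t..s}" by auto
    then show ?thesis using True assms by simp
  next
    case False
    then have "{t..s} \<inter> {..<t + \<epsilon>} = {t..<t + \<epsilon>}" by auto
    then show ?thesis using False assms by simp
  qed
  have "emeasure lborel ({t..s} \<inter> {..<t + \<epsilon>}) \<le> emeasure lborel {t..s}" by (intro emeasure_mono) auto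
  also have "\<dots> < \<infinity>" by (simp add: emeasure_lborel_Icc_eq)
  finally have fin: "emeasure lborel ({t..s} \<inter> {..<t + \<epsilon>}) < \<infinity>" .
  have i: "integrable lborel (\<lambda>u. indicator {t..s} u * (a - dbar))"
    "integrable lborel (\<lambda>u. indicator ({t..s} \<inter> {..<t + \<epsilon>}) u * (dbar - d))"
    using fin by (auto intro!: integrable_mult_left integrable_real_indicator simp: emeasure_lborel_Icc_eq)
  have "(LINT u:{t..s}|lborel. a - (if u < t + \<epsilon> then d else dbar))
    = (LINT u|lborel. indicator {t..s} u * (a - dbar) + indicator ({t..s} \<inter> {..<t + \<epsilon>}) u * (dbar - d))"
    unfolding set_lebesgue_integral_def by (intro Bochner_Integration.integral_cong) (auto simp: indicator_def)
  also have "\<dots> = (a - dbar) * (s - t) + (dbar - d) * min (s - t) \<epsilon>"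
    using i meas assms by simp
  finally show ?thesis .
qed

text \<open>Serves the candidate and its perturbations alike: \<open>dstar\<close> itself is the
  instance \<open>d = dbar\<close>, \<open>\<epsilon> = 0\<close>. As in the theorem, the rate is
  prescribed at positive surplus only.\<close>

locale dividend_problem = controlled_brownian M "natural_filtration M B" W a b d dbar \<epsilon> t x
  for M :: "'w measure" and B W a b d dbar \<epsilon> t x +
  fixes \<rho> :: real and \<delta> :: "real \<Rightarrow> real \<Rightarrow> real"
  assumes WB: "AE \<omega> in M. \<forall>s. W s \<omega> = B s \<omega>"
    and rho: "0 < \<rho>" and dbar: "0 < dbar" and adm: "admissible dbar \<delta>"
    and \<delta>: "\<And>y s. 0 < y \<Longrightarrow> t \<le> s \<Longrightarrow> \<delta> y s = (if s < t + \<epsilon> then d else dbar)"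
begin

section \<open>The payoff as a functional of the ruin time of \<open>Z\<close>\<close>

lemma AE_surplus_path:
  "AE \<omega> in M. (\<forall>s. W s \<omega> = B s \<omega>) \<and>
    surplus_path a dbar t x \<delta> (\<lambda>u. if u < t + \<epsilon> then d else dbar) (\<lambda>s. b * (W s \<omega> - W t \<omega>)) (\<lambda>s. Z s \<omega>)"
  using immediate_crossing[OF less_imp_le[OF dbar]] WB AE_space
proof eventually_elim
  fix \<omega>
  assume cr: "\<forall>S\<ge>t. Z S \<omega> = 0 \<longrightarrow> (\<forall>s\<in>{t..<S}. 0 < Z s \<omega>) \<longrightarrow>
        (\<forall>h>0. \<exists>s>S. s < S + h \<and> Z s \<omega> + dbar * (s - S) < 0)"
    and eq: "\<forall>s. W s \<omega> = B s \<omega>" and w: "\<omega> \<in> space M"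
  have "surplus_path a dbar t x \<delta> (\<lambda>u. if u < t + \<epsilon> then d else dbar) (\<lambda>s. b * (W s \<omega> - W t \<omega>)) (\<lambda>s. Z s \<omega>)"
  proof
    show "(\<lambda>u. if u < t + \<epsilon> then d else dbar) \<in> borel_measurable borel" by measurable
    show "Z s \<omega> = x + (LINT u:{t..s}|lborel. a - (if u < t + \<epsilon> then d else dbar)) + b * (W s \<omega> - W t \<omega>)"
      if "t \<le> s" for s
      unfolding drift_integral[OF that eps] Z_def by simp
    show "\<exists>s>S. s < S + h \<and> Z s \<omega> + dbar * (s - S) < 0"
      if "t \<le> S" "Z S \<omega> = 0" "\<And>u. t \<le> u \<Longrightarrow> u < S \<Longrightarrow> 0 < Z u \<omega>" "0 < h" for S h
      using cr that by auto
  qed (use adm t x d dbar \<delta> Z_cont[OF w] in auto)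
  with eq show "(\<forall>s. W s \<omega> = B s \<omega>) \<and>
    surplus_path a dbar t x \<delta> (\<lambda>u. if u < t + \<epsilon> then d else dbar) (\<lambda>s. b * (W s \<omega> - W t \<omega>)) (\<lambda>s. Z s \<omega>)"
    by blast
qed

lemma ruin_time_path: "ruin_time t (\<lambda>s _. X s \<omega>) \<omega>' = ruin_time t X \<omega>"
  by (simp add: ruin_time_def)

text \<open>Existence of one solution guarantees that the choice operator in \<open>surplus\<close>
  returns a solution; beyond \<open>is_surplus\<close> nothing is known about the one
  returned.\<close>

lemma is_surplus_Z: "is_surplus M B a b \<delta> x t Z"
  unfolding is_surplus_def
proof (intro conjI)
  show "AE \<omega> in M. \<forall>s\<ge>t. ereal s \<le> ruin_time t Z \<omega> \<longrightarrow>
      Z s \<omega> = x + (LINT u:{t..s}|lborel. a - \<delta> (Z u \<omega>) u) + b * (B s \<omega> - B t \<omega>)"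
    using AE_surplus_path
  proof eventually_elim
    case (elim \<omega>)
    then interpret surplus_path a dbar t x \<delta> "\<lambda>u. if u < t + \<epsilon> then d else dbar" "\<lambda>s. b * (W s \<omega> - W t \<omega>)" "\<lambda>s. Z s \<omega>"
      by blast
    show ?case using z_solves[of _ \<omega>] elim by (simp add: ruin_time_path)
  qed
qed (use Z_measurable Z_cont in auto)

lemma is_surplus_surplus: "is_surplus M B a b \<delta> x t (surplus M B a b \<delta> x t)"
  unfolding surplus_def by (rule someI[where P="is_surplus M B a b \<delta> x t", OF is_surplus_Z])

lemma payoff_measurable [measurable]: "payoff M B a b \<rho> \<delta> x t \<in> borel_measurable M"
  unfolding payoff_def
proof (rule discounted_dividends_measurable[OF adm t])
  show "surplus M B a b \<delta> x t s \<in> borel_measurable M" if "t \<le> s" for s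
    using is_surplus_surplus that t F_measurable[of s] unfolding is_surplus_def by auto
  show "continuous_on {t..} (\<lambda>s. surplus M B a b \<delta> x t s \<omega>)" if "\<omega> \<in> space M" for \<omega>
    using is_surplus_surplus that unfolding is_surplus_def by auto
qed

text \<open>By \<open>solution_unique\<close> the chosen surplus is ruined together with
  \<open>Z\<close> and positive before, hence pays the deterministic rate until ruin.\<close>

lemma AE_payoff:
  "AE \<omega> in M. payoff M B a b \<rho> \<delta> x t \<omega> =
     (LINT s|lborel. indicator {s. t \<le> s \<and> ereal s < ruin_time t Z \<omega>} s * (exp (- \<rho> * (s - t)) * (if s < t + \<epsilon> then d else dbar)))"
proof -
  let ?X = "surplus M B a b \<delta> x t"
  have "AE \<omega> in M. \<forall>s\<ge>t. ereal s \<le> ruin_time t ?X \<omega> \<longrightarrow>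
        ?X s \<omega> = x + (LINT u:{t..s}|lborel. a - \<delta> (?X u \<omega>) u) + b * (B s \<omega> - B t \<omega>)"
    using is_surplus_surplus unfolding is_surplus_def by blast
  then show ?thesis using AE_surplus_path AE_space
  proof eventually_elim
    case (elim \<omega>)
    then interpret surplus_path a dbar t x \<delta> "\<lambda>u. if u < t + \<epsilon> then d else dbar" "\<lambda>s. b * (W s \<omega> - W t \<omega>)" "\<lambda>s. Z s \<omega>"
      by blast
    have cont: "continuous_on {t..} (\<lambda>s. ?X s \<omega>)"
      using is_surplus_surplus elim unfolding is_surplus_def by auto
    have sol: "?X s \<omega> = x + (LINT u:{t..s}|lborel. a - \<delta> (?X u \<omega>) u) + b * (W s \<omega> - W t \<omega>)"
      if "t \<le> s" "ereal s \<le> ruin_time t (\<lambda>s _. ?X s \<omega>) \<omega>" for s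
      using elim that unfolding ruin_time_path by simp
    have R: "ruin_time t ?X \<omega> = ruin_time t Z \<omega>"
      using solution_unique(1)[OF cont sol] unfolding ruin_time_path by simp
    have pos: "0 < ?X s \<omega>" if "t \<le> s" "ereal s < ruin_time t ?X \<omega>" for s
      using solution_unique(2)[OF cont sol that(1)] that(2) unfolding ruin_time_path by simp
    show ?case
      unfolding payoff_def discounted_dividends_def set_lebesgue_integral_def R[symmetric]
      by (intro Bochner_Integration.integral_cong) (auto simp: indicator_def \<delta>[OF pos])
  qed
qed

lemma ruin_time_Z_cases: "ruin_time t Z \<omega> = \<infinity> \<or> (\<exists>r\<ge>t. ruin_time t Z \<omega> = ereal r)"
  using ruin_time_ge[of t Z \<omega>] by (cases "ruin_time t Z \<omega>") auto

lemma ruin_time_Z_measurable [measurable]: "ruin_time t Z \<in> borel_measurable M"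
  using F_measurable[OF _ Z_measurable] t Z_cont by (intro ruin_time_measurable) auto

lemma discount_measurable [measurable]: "discount lam \<in> borel_measurable M"
proof -
  have "Measurable.pred M (\<lambda>\<omega>. ruin_time t Z \<omega> = \<infinity>)" by measurable
  then show ?thesis unfolding discount_def[abs_def] by measurable
qed

lemma discount_bounds: "0 \<le> lam \<Longrightarrow> 0 \<le> discount lam \<omega> \<and> discount lam \<omega> \<le> 1"
  using ruin_time_Z_cases[of \<omega>] by (auto simp: discount_def)

text \<open>\<open>\<alpha>\<close> is the present value of paying \<open>d\<close> for a duration
  \<open>\<epsilon>\<close> and \<open>dbar\<close> for ever after; \<open>\<beta>\<close> is that
  of \<open>dbar\<close> for ever, the amount lost at ruin.\<close>

abbreviation \<alpha> :: real where "\<alpha> \<equiv> (d + (dbar - d) * exp (- \<rho> * \<epsilon>)) / \<rho>"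
abbreviation \<beta> :: real where "\<beta> \<equiv> dbar / \<rho>"

lemma \<beta>_pos: "0 < \<beta>" using rho dbar by simp

lemma \<alpha>_bounds: "0 \<le> \<alpha>" "\<alpha> \<le> \<beta>"
proof -
  have "0 \<le> exp (- \<rho> * \<epsilon>)" "exp (- \<rho> * \<epsilon>) \<le> 1" using rho eps by auto
  then have "0 \<le> (dbar - d) * exp (- \<rho> * \<epsilon>)" "(dbar - d) * exp (- \<rho> * \<epsilon>) \<le> (dbar - d) * 1"
    using d by (intro mult_nonneg_nonneg mult_left_mono; simp)+
  then have "0 \<le> d + (dbar - d) * exp (- \<rho> * \<epsilon>)" "d + (dbar - d) * exp (- \<rho> * \<epsilon>) \<le> dbar"
    using d by auto
  then show "0 \<le> \<alpha>" "\<alpha> \<le> \<beta>" using rho by (auto intro: divide_right_mono)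
qed

text \<open>Ruin after the perturbation cuts off a perpetuity worth \<open>\<beta>\<close> at the
  ruin time. Earlier ruin is met only by the crude bounds, as its probability is the error
  term.\<close>

lemma AE_payoff_bounds:
  "AE \<omega> in M. 0 \<le> payoff M B a b \<rho> \<delta> x t \<omega> \<and> payoff M B a b \<rho> \<delta> x t \<omega> \<le> \<beta> \<and>
     (ereal (t + \<epsilon>) \<le> ruin_time t Z \<omega> \<longrightarrow> payoff M B a b \<rho> \<delta> x t \<omega> = \<alpha> - \<beta> * discount \<rho> \<omega>)"
  using AE_payoff
proof eventually_elim
  case (elim \<omega>)
  let ?R = "ruin_time t Z \<omega>"
  let ?f = "\<lambda>T s. indicator {s. t \<le> s \<and> ereal s < T} s * exp (- \<rho> * (s - t))"
  let ?g = "\<lambda>s. indicator {s. t \<le> s \<and> ereal s < ?R} s * (exp (- \<rho> * (s - t)) * (if s < t + \<epsilon> then d else dbar))"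
  have hR: "has_bochner_integral lborel (?f ?R) ((1 - discount \<rho> \<omega>) / \<rho>)"
    unfolding discount_def by (rule has_bochner_integral_discount[OF rho ruin_time_Z_cases])
  have ge0: "0 \<le> ?g s" for s using d by (auto simp: indicator_def)
  have le: "?g s \<le> dbar * ?f ?R s" for s using d by (auto simp: indicator_def)
  have gm: "?g \<in> borel_measurable lborel" by measurable
  have gi: "integrable lborel ?g"
  proof (rule Bochner_Integration.integrable_bound[OF _ gm])
    show "integrable lborel (\<lambda>s. dbar * ?f ?R s)"
      using hR by (intro integrable_mult_right) (simp add: has_bochner_integral_iff)
    have "norm (?g s) \<le> norm (dbar * ?f ?R s)" for s
      using ge0[of s] le[of s] unfolding real_norm_def by linarith
    then show "AE s in lborel. norm (?g s) \<le> norm (dbar * ?f ?R s)" by simp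
  qed
  have "(LINT s|lborel. ?g s) \<le> (LINT s|lborel. dbar * ?f ?R s)"
    using gi hR le by (intro integral_mono) (auto simp: has_bochner_integral_iff)
  also have "\<dots> = \<beta> * (1 - discount \<rho> \<omega>)" using hR by (simp add: has_bochner_integral_iff)
  also have "\<dots> \<le> \<beta> * 1" using discount_bounds[of \<rho> \<omega>] rho \<beta>_pos by (intro mult_left_mono) auto
  finally have 1: "(LINT s|lborel. ?g s) \<le> \<beta>" by simp
  have 2: "0 \<le> (LINT s|lborel. ?g s)" using ge0 by (intro integral_nonneg_AE) auto
  have 3: "(LINT s|lborel. ?g s) = \<alpha> - \<beta> * discount \<rho> \<omega>" if late: "ereal (t + \<epsilon>) \<le> ?R"
  proof -
    have hE: "has_bochner_integral lborel (?f (ereal (t + \<epsilon>))) ((1 - exp (- \<rho> * \<epsilon>)) / \<rho>)"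
      using has_bochner_integral_discount[OF rho, of "ereal (t + \<epsilon>)" t] eps by simp
    have "?g s = dbar * ?f ?R s - (dbar - d) * ?f (ereal (t + \<epsilon>)) s" for s
    proof -
      have "ereal s < ?R" if "s < t + \<epsilon>"
        by (rule less_le_trans[OF _ late]) (use that in simp)
      then show ?thesis by (auto simp: indicator_def algebra_simps)
    qed
    then have "(LINT s|lborel. ?g s) = (LINT s|lborel. dbar * ?f ?R s - (dbar - d) * ?f (ereal (t + \<epsilon>)) s)" by simp
    also have "\<dots> = dbar * ((1 - discount \<rho> \<omega>) / \<rho>) - (dbar - d) * ((1 - exp (- \<rho> * \<epsilon>)) / \<rho>)"
      using hR hE by (simp add: has_bochner_integral_iff)
    also have "\<dots> = \<alpha> - \<beta> * discount \<rho> \<omega>" using rho by (simp add: field_simps)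
    finally show ?thesis .
  qed
  show ?case unfolding elim using 1 2 3 by blast
qed

section \<open>Errors caused by ruin during the perturbation\<close>

definition early_ruin :: real where
  "early_ruin = prob {\<omega>\<in>space M. ruin_time t Z \<omega> < ereal (t + \<epsilon>)}"

lemma early_event [measurable]: "{\<omega>\<in>space M. ruin_time t Z \<omega> < ereal (t + \<epsilon>)} \<in> events"
  by measurable

lemma early_integrable: "integrable M (indicator {\<omega>\<in>space M. ruin_time t Z \<omega> < ereal (t + \<epsilon>)} :: 'w \<Rightarrow> real)"
  by (rule integrable_real_indicator[OF early_event]) (simp add: less_top[symmetric])

lemma expectation_early: "expectation (indicator {\<omega>\<in>space M. ruin_time t Z \<omega> < ereal (t + \<epsilon>)}) = early_ruin"
  unfolding early_ruin_def by (simp add: Int_absorb2)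

text \<open>Functions that agree unless ruin is early differ by at most \<open>2 * C\<close> on that
  event; every error term originates here.\<close>

lemma expectation_near:
  assumes f: "f \<in> borel_measurable M" "AE \<omega> in M. \<bar>f \<omega>\<bar> \<le> C" and g: "g \<in> borel_measurable M" "AE \<omega> in M. \<bar>g \<omega>\<bar> \<le> C"
    and eq: "AE \<omega> in M. ereal (t + \<epsilon>) \<le> ruin_time t Z \<omega> \<longrightarrow> f \<omega> = g \<omega>" and C: "0 \<le> C"
  shows "\<bar>expectation f - expectation g\<bar> \<le> 2 * C * early_ruin"
proof -
  let ?A = "{\<omega>\<in>space M. ruin_time t Z \<omega> < ereal (t + \<epsilon>)}"
  have i: "integrable M f" "integrable M g" using f g by (auto intro!: integrable_const_bound)
  have "\<bar>expectation f - expectation g\<bar> = \<bar>expectation (\<lambda>\<omega>. f \<omega> - g \<omega>)\<bar>" using i by simp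
  also have "\<dots> \<le> expectation (\<lambda>\<omega>. \<bar>f \<omega> - g \<omega>\<bar>)" by (rule integral_abs_bound)
  also have "\<dots> \<le> expectation (\<lambda>\<omega>. 2 * C * indicator ?A \<omega>)"
  proof (rule integral_mono_AE)
    show "AE \<omega> in M. \<bar>f \<omega> - g \<omega>\<bar> \<le> 2 * C * indicator ?A \<omega>"
      using f(2) g(2) eq AE_space
    proof eventually_elim
      case (elim \<omega>)
      then show ?case using C by (cases "ruin_time t Z \<omega> < ereal (t + \<epsilon>)") (auto simp: indicator_def not_less)
    qed
  qed (use i early_integrable in auto)
  also have "\<dots> = 2 * C * early_ruin" using expectation_early by simp
  finally show ?thesis .
qed

text \<open>In \<open>laplace\<close> the minimum equals \<open>\<epsilon>\<close> when ruin is
  finite and not early, so a constant factor isolates \<open>discount lam\<close> up to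
  \<open>early_ruin\<close>. The second bound is a Markov inequality, with \<open>r\<close> left
  free for later optimisation.\<close>

lemma discount_near:
  assumes r: "r \<le> 0" "lam = r\<^sup>2 * b\<^sup>2 / 2 + r * (a - dbar)" and lam: "0 < lam"
  shows "\<bar>expectation (discount lam) - exp (r * x + r * (dbar - d) * \<epsilon>)\<bar> \<le> 2 * early_ruin"
    "early_ruin \<le> exp (lam * \<epsilon> + r * x)"
proof -
  let ?m = "\<lambda>\<omega>. min (real_of_ereal (ruin_time t Z \<omega>) - t) \<epsilon>"
  define k where "k = - r * (dbar - d)"
  have k: "0 \<le> k" unfolding k_def using r d by (intro mult_nonneg_nonneg) auto
  note L = laplace[OF r lam, folded k_def]
  have bd: "0 \<le> discount lam \<omega> * exp (k * ?m \<omega>)" "discount lam \<omega> * exp (k * ?m \<omega>) \<le> exp (k * \<epsilon>)"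
    "ruin_time t Z \<omega> \<noteq> \<infinity> \<Longrightarrow> 0 \<le> ?m \<omega>" for \<omega>
  proof -
    show "0 \<le> discount lam \<omega> * exp (k * ?m \<omega>)" using discount_bounds[of lam \<omega>] lam by simp
    have "k * ?m \<omega> \<le> k * \<epsilon>" using k by (intro mult_left_mono) auto
    then have "discount lam \<omega> * exp (k * ?m \<omega>) \<le> 1 * exp (k * \<epsilon>)"
      using discount_bounds[of lam \<omega>] lam by (intro mult_mono) auto
    then show "discount lam \<omega> * exp (k * ?m \<omega>) \<le> exp (k * \<epsilon>)" by simp
    show "ruin_time t Z \<omega> \<noteq> \<infinity> \<Longrightarrow> 0 \<le> ?m \<omega>" using ruin_time_Z_cases[of \<omega>] eps by auto
  qed
  \<comment> \<open>Normalised so that it coincides with the discount when ruin is late or absent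
    and never exceeds 1.\<close>
  define Y where "Y \<omega> = exp (- k * \<epsilon>) * (discount lam \<omega> * exp (k * ?m \<omega>))" for \<omega>
  have Ym: "Y \<in> borel_measurable M" unfolding Y_def[abs_def] using L(1) by measurable
  have Yb: "\<bar>Y \<omega>\<bar> \<le> 1" for \<omega>
  proof -
    have "Y \<omega> \<le> exp (- k * \<epsilon>) * exp (k * \<epsilon>)" unfolding Y_def using bd by (intro mult_left_mono) auto
    also have "\<dots> = 1" by (simp add: exp_add[symmetric])
    finally show ?thesis using bd by (simp add: Y_def)
  qed
  have "expectation Y = exp (- k * \<epsilon>) * exp (r * x)" unfolding Y_def integral_mult_right_zero L(2) ..
  also have "\<dots> = exp (r * x + r * (dbar - d) * \<epsilon>)" unfolding k_def exp_add[symmetric] by (simp add: algebra_simps)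
  finally have EY: "expectation Y = exp (r * x + r * (dbar - d) * \<epsilon>)" .
  have "\<bar>expectation (discount lam) - expectation Y\<bar> \<le> 2 * 1 * early_ruin"
  proof (rule expectation_near[OF discount_measurable _ Ym])
    show "AE \<omega> in M. ereal (t + \<epsilon>) \<le> ruin_time t Z \<omega> \<longrightarrow> discount lam \<omega> = Y \<omega>"
    proof (intro AE_I2 impI)
      fix \<omega> assume "ereal (t + \<epsilon>) \<le> ruin_time t Z \<omega>"
      then show "discount lam \<omega> = Y \<omega>"
        by (cases "ruin_time t Z \<omega>") (auto simp: Y_def discount_def exp_add[symmetric] min_def)
    qed
  qed (use Yb discount_bounds lam in auto)
  then show "\<bar>expectation (discount lam) - exp (r * x + r * (dbar - d) * \<epsilon>)\<bar> \<le> 2 * early_ruin"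
    unfolding EY by simp
  let ?A = "{\<omega>\<in>space M. ruin_time t Z \<omega> < ereal (t + \<epsilon>)}"
  \<comment> \<open>On early ruin the discount is at least \<open>exp (- lam * \<epsilon>)\<close>
    and the remaining factor is at least 1.\<close>
  have "exp (- lam * \<epsilon>) * early_ruin = expectation (\<lambda>\<omega>. exp (- lam * \<epsilon>) * indicator ?A \<omega>)"
    using expectation_early by simp
  also have "\<dots> \<le> expectation (\<lambda>\<omega>. discount lam \<omega> * exp (k * ?m \<omega>))"
  proof (rule integral_mono_AE)
    show "integrable M (\<lambda>\<omega>. discount lam \<omega> * exp (k * ?m \<omega>))"
      using L(1) bd by (intro integrable_const_bound[where B="exp (k * \<epsilon>)"]) auto
    show "AE \<omega> in M. exp (- lam * \<epsilon>) * indicator ?A \<omega> \<le> discount lam \<omega> * exp (k * ?m \<omega>)"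
    proof (rule AE_I2)
      fix \<omega>
      show "exp (- lam * \<epsilon>) * indicator ?A \<omega> \<le> discount lam \<omega> * exp (k * ?m \<omega>)"
      proof (cases "\<omega> \<in> ?A")
        case True
        then obtain R where R: "ruin_time t Z \<omega> = ereal R" "t \<le> R" "R < t + \<epsilon>"
          using ruin_time_Z_cases[of \<omega>] by auto
        have "lam * (R - t) \<le> lam * \<epsilon>" using R lam by (intro mult_left_mono) auto
        then have "exp (- lam * \<epsilon>) \<le> discount lam \<omega>" using R by (simp add: discount_def)
        moreover have "1 \<le> exp (k * ?m \<omega>)" using bd(3)[of \<omega>] R k by simp
        ultimately have "exp (- lam * \<epsilon>) * 1 \<le> discount lam \<omega> * exp (k * ?m \<omega>)"
          using discount_bounds[of lam \<omega>] lam by (intro mult_mono) auto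
        then show ?thesis using True by simp
      next
        case False
        then show ?thesis using bd(1)[of \<omega>] by simp
      qed
    qed
  qed (use early_integrable in auto)
  also have "\<dots> = exp (r * x)" by (rule L(2))
  finally have "exp (lam * \<epsilon>) * (exp (- lam * \<epsilon>) * early_ruin) \<le> exp (lam * \<epsilon>) * exp (r * x)"
    by (intro mult_left_mono) auto
  then show "early_ruin \<le> exp (lam * \<epsilon> + r * x)"
    by (simp add: exp_add mult.assoc[symmetric] exp_minus)
qed

text \<open>With an empty perturbation the errors vanish, and the approximate formulas become the
  exact moments of \<open>dstar\<close>.\<close>

lemma early_ruin_0: "\<epsilon> = 0 \<Longrightarrow> early_ruin = 0"
  unfolding early_ruin_def using ruin_time_ge[of t Z] by (simp add: not_less[symmetric])

lemma early_ruin_bounds: "0 \<le> early_ruin" "early_ruin \<le> 1"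
  by (auto simp: early_ruin_def)

lemma payoff_variance:
  "variance (payoff M B a b \<rho> \<delta> x t) = expectation (\<lambda>\<omega>. (payoff M B a b \<rho> \<delta> x t \<omega>)\<^sup>2) - (expectation (payoff M B a b \<rho> \<delta> x t))\<^sup>2"
proof (rule variance_eq)
  show "integrable M (payoff M B a b \<rho> \<delta> x t)"
  proof (rule integrable_const_bound)
    show "AE \<omega> in M. norm (payoff M B a b \<rho> \<delta> x t \<omega>) \<le> \<beta>"
      using AE_payoff_bounds by eventually_elim simp
  qed measurable
  have "AE \<omega> in M. norm ((payoff M B a b \<rho> \<delta> x t \<omega>)\<^sup>2) \<le> \<beta>\<^sup>2"
    using AE_payoff_bounds by eventually_elim (simp only: real_norm_def abs_power2, intro power_mono, auto)
  then show "integrable M (\<lambda>\<omega>. (payoff M B a b \<rho> \<delta> x t \<omega>)\<^sup>2)"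
    by (rule integrable_const_bound) measurable
qed

section \<open>Mean, second moment and objective up to early ruin\<close>

context
  fixes r6 r8 :: real
  assumes r6: "r6 < 0" "\<rho> = r6\<^sup>2 * b\<^sup>2 / 2 + r6 * (a - dbar)"
    and r8: "r8 < 0" "2 * \<rho> = r8\<^sup>2 * b\<^sup>2 / 2 + r8 * (a - dbar)"
begin

abbreviation E6 :: real where "E6 \<equiv> exp (r6 * x + r6 * (dbar - d) * \<epsilon>)"
abbreviation E8 :: real where "E8 \<equiv> exp (r8 * x + r8 * (dbar - d) * \<epsilon>)"

lemma affine_bounds: "\<bar>\<alpha> - \<beta> * discount \<rho> \<omega>\<bar> \<le> \<beta>"
proof -
  have "0 \<le> \<beta> * discount \<rho> \<omega>" "\<beta> * discount \<rho> \<omega> \<le> \<beta> * 1"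
    using discount_bounds[of \<rho> \<omega>] rho \<beta>_pos by (intro mult_left_mono mult_nonneg_nonneg; simp)+
  then show ?thesis using \<alpha>_bounds by linarith
qed

lemma discount_integrable: "0 \<le> lam \<Longrightarrow> integrable M (discount lam)"
  using discount_bounds by (intro integrable_const_bound[of _ 1]) auto

text \<open>One \<open>2 * \<beta>\<close> pays for replacing the payoff by an affine function of
  the discount, the other for replacing the mean of the discount by \<open>E6\<close>.\<close>

lemma payoff_mean: "\<bar>expectation (payoff M B a b \<rho> \<delta> x t) - (\<alpha> - \<beta> * E6)\<bar> \<le> 4 * \<beta> * early_ruin"
proof -
  have "\<bar>expectation (payoff M B a b \<rho> \<delta> x t) - expectation (\<lambda>\<omega>. \<alpha> - \<beta> * discount \<rho> \<omega>)\<bar> \<le> 2 * \<beta> * early_ruin"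
  proof (rule expectation_near[OF payoff_measurable])
    show "(\<lambda>\<omega>. \<alpha> - \<beta> * discount \<rho> \<omega>) \<in> borel_measurable M" by measurable
    show "AE \<omega> in M. \<bar>payoff M B a b \<rho> \<delta> x t \<omega>\<bar> \<le> \<beta>" using AE_payoff_bounds by eventually_elim simp
    show "AE \<omega> in M. ereal (t + \<epsilon>) \<le> ruin_time t Z \<omega> \<longrightarrow> payoff M B a b \<rho> \<delta> x t \<omega> = \<alpha> - \<beta> * discount \<rho> \<omega>"
      using AE_payoff_bounds by eventually_elim simp
  qed (use affine_bounds \<beta>_pos in auto)
  moreover have "expectation (\<lambda>\<omega>. \<alpha> - \<beta> * discount \<rho> \<omega>) = \<alpha> - \<beta> * expectation (discount \<rho>)"
    using discount_integrable[of \<rho>] rho by (simp add: prob_space)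
  moreover have "\<bar>\<beta> * expectation (discount \<rho>) - \<beta> * E6\<bar> \<le> \<beta> * (2 * early_ruin)"
    using discount_near(1)[OF less_imp_le[OF r6(1)] r6(2) rho] \<beta>_pos
    unfolding right_diff_distrib[symmetric] abs_mult by (intro mult_mono) auto
  moreover have "\<bar>P - (A - C * E)\<bar> \<le> 4 * C * p"
    if "\<bar>P - Q\<bar> \<le> 2 * C * p" "Q = A - C * D" "\<bar>C * D - C * E\<bar> \<le> C * (2 * p)" for P Q A C D E p :: real
    using that by linarith
  ultimately show ?thesis by blast
qed

text \<open>Squaring doubles the discount rate; this is why the second moment is governed by
  \<open>r8\<close>, the root for \<open>2 * \<rho>\<close>.\<close>

lemma discount_square: "(discount \<rho> \<omega>)\<^sup>2 = discount (2 * \<rho>) \<omega>"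
  by (auto simp: discount_def exp_double[symmetric] mult.assoc)

text \<open>The constant 8 is 2 for the payoff, 4 for the cross term by
  \<open>\<alpha> \<le> \<beta>\<close>, and 2 for the squared discount.\<close>

lemma payoff_second_moment:
  "\<bar>expectation (\<lambda>\<omega>. (payoff M B a b \<rho> \<delta> x t \<omega>)\<^sup>2) - (\<alpha>\<^sup>2 - 2 * \<alpha> * \<beta> * E6 + \<beta>\<^sup>2 * E8)\<bar> \<le> 8 * \<beta>\<^sup>2 * early_ruin"
proof -
  have "\<bar>expectation (\<lambda>\<omega>. (payoff M B a b \<rho> \<delta> x t \<omega>)\<^sup>2) - expectation (\<lambda>\<omega>. (\<alpha> - \<beta> * discount \<rho> \<omega>)\<^sup>2)\<bar> \<le> 2 * \<beta>\<^sup>2 * early_ruin"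
  proof (rule expectation_near)
    show "(\<lambda>\<omega>. (payoff M B a b \<rho> \<delta> x t \<omega>)\<^sup>2) \<in> borel_measurable M" by measurable
    show "(\<lambda>\<omega>. (\<alpha> - \<beta> * discount \<rho> \<omega>)\<^sup>2) \<in> borel_measurable M" by measurable
    show "AE \<omega> in M. \<bar>(payoff M B a b \<rho> \<delta> x t \<omega>)\<^sup>2\<bar> \<le> \<beta>\<^sup>2"
      using AE_payoff_bounds by eventually_elim (simp only: abs_power2, intro power_mono, auto)
    show "AE \<omega> in M. ereal (t + \<epsilon>) \<le> ruin_time t Z \<omega> \<longrightarrow> (payoff M B a b \<rho> \<delta> x t \<omega>)\<^sup>2 = (\<alpha> - \<beta> * discount \<rho> \<omega>)\<^sup>2"
      using AE_payoff_bounds by eventually_elim simp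
    show "AE \<omega> in M. \<bar>(\<alpha> - \<beta> * discount \<rho> \<omega>)\<^sup>2\<bar> \<le> \<beta>\<^sup>2"
      using abs_le_square_iff[THEN iffD1, OF order_trans[OF affine_bounds abs_ge_self]] by (intro AE_I2) (simp only: abs_power2)
  qed simp
  moreover have "expectation (\<lambda>\<omega>. (\<alpha> - \<beta> * discount \<rho> \<omega>)\<^sup>2)
      = \<alpha>\<^sup>2 - 2 * \<alpha> * \<beta> * expectation (discount \<rho>) + \<beta>\<^sup>2 * expectation (discount (2 * \<rho>))"
  proof -
    have "(\<alpha> - \<beta> * discount \<rho> \<omega>)\<^sup>2 = \<alpha>\<^sup>2 - 2 * \<alpha> * \<beta> * discount \<rho> \<omega> + \<beta>\<^sup>2 * discount (2 * \<rho>) \<omega>" for \<omega>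
    proof -
      have "(A - C * q)\<^sup>2 = A\<^sup>2 - 2 * A * C * q + C\<^sup>2 * q\<^sup>2" for A C q :: real
        by (simp add: power2_eq_square algebra_simps)
      then show ?thesis unfolding discount_square[symmetric] by blast
    qed
    then show ?thesis using discount_integrable[of \<rho>] discount_integrable[of "2 * \<rho>"] rho by (simp add: prob_space)
  qed
  moreover have "\<bar>2 * \<alpha> * \<beta> * expectation (discount \<rho>) - 2 * \<alpha> * \<beta> * E6\<bar> \<le> (2 * \<beta> * \<beta>) * (2 * early_ruin)"
    using discount_near(1)[OF less_imp_le[OF r6(1)] r6(2) rho] \<beta>_pos \<alpha>_bounds
    unfolding right_diff_distrib[symmetric] abs_mult by (intro mult_mono) auto
  moreover have "\<bar>\<beta>\<^sup>2 * expectation (discount (2 * \<rho>)) - \<beta>\<^sup>2 * E8\<bar> \<le> \<beta>\<^sup>2 * (2 * early_ruin)"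
    using discount_near(1)[OF less_imp_le[OF r8(1)] r8(2)] rho
    unfolding right_diff_distrib[symmetric] abs_mult by (intro mult_mono) auto
  moreover have "\<bar>P - (A - u' + v')\<bar> \<le> 8 * C\<^sup>2 * p"
    if "\<bar>P - Q\<bar> \<le> 2 * C\<^sup>2 * p" "Q = A - u + v" "\<bar>u - u'\<bar> \<le> (2 * C * C) * (2 * p)" "\<bar>v - v'\<bar> \<le> C\<^sup>2 * (2 * p)"
    for P Q A C u u' v v' p :: real
    using that unfolding power2_eq_square by linarith
  ultimately show ?thesis by blast
qed

text \<open>In units of \<open>\<beta>\<^sup>2 * early_ruin\<close> the variance error is 8 from the
  second moment plus 24 from the square of the mean; half of 32 gives the 16.\<close>

lemma objective_near:
  assumes "0 \<le> \<gamma>"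
  shows "\<bar>mv_objective M B a b \<rho> \<gamma> x t \<delta> - (\<alpha> - \<beta> * E6 - \<gamma> / 2 * (\<beta>\<^sup>2 * (E8 - E6\<^sup>2)))\<bar>
    \<le> (4 * \<beta> + 16 * \<gamma> * \<beta>\<^sup>2) * early_ruin"
proof -
  define E where "E = expectation (payoff M B a b \<rho> \<delta> x t)"
  define S where "S = expectation (\<lambda>\<omega>. (payoff M B a b \<rho> \<delta> x t \<omega>)\<^sup>2)"
  define m where "m = \<alpha> - \<beta> * E6"
  define s2 where "s2 = \<alpha>\<^sup>2 - 2 * \<alpha> * \<beta> * E6 + \<beta>\<^sup>2 * E8"
  define C where "C = \<beta>"
  define p where "p = early_ruin"
  have p: "0 \<le> p" "p \<le> 1" using early_ruin_bounds by (auto simp: p_def)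
  have C: "0 \<le> C" using \<beta>_pos by (simp add: C_def)
  have E: "\<bar>E - m\<bar> \<le> 4 * C * p" unfolding E_def m_def C_def p_def by (rule payoff_mean)
  have S: "\<bar>S - s2\<bar> \<le> 8 * C\<^sup>2 * p" unfolding S_def s2_def C_def p_def by (rule payoff_second_moment)
  have "r6 * x + r6 * (dbar - d) * \<epsilon> \<le> 0"
    using r6(1) x d eps by (intro add_nonpos_nonpos mult_nonpos_nonneg) auto
  then have "\<beta> * E6 \<le> \<beta> * 1" by (intro mult_left_mono less_imp_le[OF \<beta>_pos]) simp
  moreover have "0 \<le> \<beta> * E6" by (intro mult_nonneg_nonneg less_imp_le[OF \<beta>_pos]) simp
  ultimately have m: "\<bar>m\<bar> \<le> C" using \<alpha>_bounds unfolding m_def C_def by linarith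
  \<comment> \<open>Since \<open>p \<le> 1\<close>, the sum \<open>E + m\<close> is bounded, and the
    bound on \<open>E\<^sup>2 - m\<^sup>2\<close> stays linear in \<open>p\<close>.\<close>
  have "4 * C * p \<le> 4 * C * 1" using p C by (intro mult_left_mono) auto
  then have "\<bar>E + m\<bar> \<le> 6 * C" using E m by linarith
  then have "\<bar>E - m\<bar> * \<bar>E + m\<bar> \<le> (4 * C * p) * (6 * C)"
    using E p C by (intro mult_mono) auto
  also have "\<bar>E - m\<bar> * \<bar>E + m\<bar> = \<bar>E\<^sup>2 - m\<^sup>2\<bar>"
    unfolding abs_mult[symmetric] by (simp add: power2_eq_square algebra_simps)
  also have "(4 * C * p) * (6 * C) = 24 * (C\<^sup>2 * p)" by (simp add: power2_eq_square)
  finally have "\<bar>(S - E\<^sup>2) - (s2 - m\<^sup>2)\<bar> \<le> 32 * (C\<^sup>2 * p)"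
    using S by linarith
  then have "\<gamma> / 2 * \<bar>(S - E\<^sup>2) - (s2 - m\<^sup>2)\<bar> \<le> \<gamma> / 2 * (32 * (C\<^sup>2 * p))"
    using assms by (intro mult_left_mono) auto
  then have V: "\<bar>\<gamma> / 2 * (S - E\<^sup>2) - \<gamma> / 2 * (s2 - m\<^sup>2)\<bar> \<le> \<gamma> / 2 * (32 * (C\<^sup>2 * p))"
    unfolding right_diff_distrib[symmetric] abs_mult using assms by simp
  \<comment> \<open>A variance ignores a deterministic shift, so \<open>\<alpha>\<close>
    cancels.\<close>
  have s2m: "s2 - m\<^sup>2 = \<beta>\<^sup>2 * (E8 - E6\<^sup>2)"
  proof -
    have "(A\<^sup>2 - 2 * A * D * P + D\<^sup>2 * Q) - (A - D * P)\<^sup>2 = D\<^sup>2 * (Q - P\<^sup>2)" for A D P Q :: real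
      by (simp add: power2_eq_square algebra_simps)
    then show ?thesis unfolding s2_def m_def by blast
  qed
  have "mv_objective M B a b \<rho> \<gamma> x t \<delta> = E - \<gamma> / 2 * (S - E\<^sup>2)"
    unfolding mv_objective_def payoff_variance E_def S_def ..
  then have "\<bar>mv_objective M B a b \<rho> \<gamma> x t \<delta> - (m - \<gamma> / 2 * (s2 - m\<^sup>2))\<bar> \<le> 4 * C * p + \<gamma> / 2 * (32 * (C\<^sup>2 * p))"
    using E V by linarith
  also have "\<dots> = (4 * C + 16 * \<gamma> * C\<^sup>2) * p" by (simp add: algebra_simps)
  finally show ?thesis unfolding s2m unfolding m_def C_def p_def .
qed

end

text \<open>The initial time is already the first zero of \<open>Z\<close>, so crossing gives ruin
  at \<open>t\<close>. The error estimates cannot treat this case: for \<open>\<epsilon> > 0\<close>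
  early ruin is then almost sure.\<close>

lemma payoff_at_0:
  assumes x_eq: "x = 0"
  shows "AE \<omega> in M. payoff M B a b \<rho> \<delta> x t \<omega> = 0"
  using AE_payoff AE_surplus_path
proof eventually_elim
  case (elim \<omega>)
  then interpret surplus_path a dbar t x \<delta> "\<lambda>u. if u < t + \<epsilon> then d else dbar" "\<lambda>s. b * (W s \<omega> - W t \<omega>)" "\<lambda>s. Z s \<omega>"
    by blast
  have "Z t \<omega> = 0" by (rule trans[OF Z_t x_eq])
  then have "ruin_time t (\<lambda>s _. Z s \<omega>) \<omega> = ereal t" by (rule z_ruin[OF order_refl]) linarith
  then have "ruin_time t Z \<omega> = ereal t" unfolding ruin_time_path .
  then have "{s. t \<le> s \<and> ereal s < ruin_time t Z \<omega>} = {}" by auto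
  then show ?case using elim(1) by simp
qed

end

section \<open>The equilibrium\<close>

text \<open>\<open>r\<close> is the smaller root of
  \<open>b\<^sup>2 / 2 * r\<^sup>2 + m * r = c\<close>, the characteristic equation of the generator
  with drift \<open>m\<close>; positivity of \<open>c\<close> gives the roots opposite
  signs.\<close>

lemma negative_root:
  fixes b c m r :: real
  assumes "0 < b" "0 < c" "r = 1 / b\<^sup>2 * (- m - sqrt (m\<^sup>2 + 2 * c * b\<^sup>2))"
  shows "r < 0" "c = r\<^sup>2 * b\<^sup>2 / 2 + r * m"
proof -
  let ?s = "sqrt (m\<^sup>2 + 2 * c * b\<^sup>2)"
  have pos: "0 < 2 * c * b\<^sup>2" using assms by simp
  have sq: "?s\<^sup>2 = m\<^sup>2 + 2 * c * b\<^sup>2" using pos by (simp add: add_nonneg_nonneg less_imp_le)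
  have "sqrt (m\<^sup>2) < ?s" using pos by (intro real_sqrt_less_mono) simp
  then have "- m - ?s < 0" by simp
  then show "r < 0" unfolding assms(3) using assms(1) by (simp add: mult_pos_neg divide_neg_pos)
  have rb: "r * b\<^sup>2 = - m - ?s" unfolding assms(3) using assms(1) by simp
  have "b\<^sup>2 * (r\<^sup>2 * b\<^sup>2 / 2 + r * m) = (r * b\<^sup>2)\<^sup>2 / 2 + (r * b\<^sup>2) * m"
    by (simp add: power2_eq_square algebra_simps)
  also have "\<dots> = (?s\<^sup>2 - m\<^sup>2) / 2" unfolding rb by (simp add: power2_eq_square field_simps)
  also have "\<dots> = b\<^sup>2 * c" unfolding sq by simp
  finally show "c = r\<^sup>2 * b\<^sup>2 / 2 + r * m" using assms(1) by simp
qed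

lemma admissible_perturbed:
  assumes "admissible dbar \<delta>" "0 \<le> d" "d \<le> dbar"
  shows "admissible dbar (perturbed \<delta> d t \<epsilon>)"
  unfolding admissible_def
proof (intro conjI)
  let ?Q = "restrict_space borel ({0..} \<times> {0..}) :: (real \<times> real) measure"
  have "snd \<in> borel_measurable ?Q" 
    by (intro measurable_restrict_space1 borel_measurable_continuous_onI continuous_on_snd continuous_on_id)
  then have "Measurable.pred ?Q (\<lambda>p. t \<le> snd p \<and> snd p < t + \<epsilon>)" by measurable
  moreover have "(\<lambda>p. \<delta> (fst p) (snd p)) \<in> borel_measurable ?Q"
    using assms unfolding admissible_def case_prod_beta' by blast
  ultimately have "(\<lambda>p. if t \<le> snd p \<and> snd p < t + \<epsilon> then d else \<delta> (fst p) (snd p)) \<in> borel_measurable ?Q"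
    by (intro measurable_If) auto
  then show "(\<lambda>(x, s). perturbed \<delta> d t \<epsilon> x s) \<in> borel_measurable ?Q"
    by (simp add: perturbed_def case_prod_beta')
  show "\<forall>x\<ge>0. \<forall>s\<ge>0. 0 \<le> perturbed \<delta> d t \<epsilon> x s \<and> perturbed \<delta> d t \<epsilon> x s \<le> dbar"
    using assms by (auto simp: perturbed_def admissible_def)
qed

text \<open>The numerator is the bound on \<open>early_ruin\<close> from
  \<open>discount_near\<close> for \<open>r = - 1 / sqrt \<epsilon>\<close>: at this scale
  \<open>lam * \<epsilon>\<close> stays bounded while \<open>r * x\<close> tends to minus
  infinity.\<close>

lemma early_ruin_rate:
  fixes b m x :: real
  assumes "0 < x"
  shows "((\<lambda>\<epsilon>. exp (b\<^sup>2 / 2 - m * sqrt \<epsilon> - x / sqrt \<epsilon>) / \<epsilon>) \<longlongrightarrow> 0) (at_right 0)"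
  using assms by real_asymp

theorem theorem3p3:
  fixes M :: "'w measure" and B :: "real \<Rightarrow> 'w \<Rightarrow> real"
    and a b \<rho> dbar r6 r8 :: real
  assumes "standard_brownian_motion M B"
    and "b > 0" and "\<rho> > 0" and "dbar > 0"
    and "r6 = 1 / b^2 * (- (a - dbar) - sqrt ((a - dbar)^2 + 2 * \<rho> * b^2))"
    and "r8 = 1 / b^2 * (- (a - dbar) - sqrt ((a - dbar)^2 + 4 * \<rho> * b^2))"
    and "dbar / \<rho> + 1 / r6 < 0"
  shows "r6 < 0 \<and> r8 < 0 \<and>
    (\<exists>\<epsilon>>0. \<forall>\<gamma>>0. \<gamma> < \<epsilon> \<longrightarrow>
      (\<forall>dstar. admissible dbar dstar \<and> (\<forall>x>0. \<forall>t\<ge>0. dstar x t = dbar) \<longrightarrow>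
        equilibrium_strategy M B a b \<rho> \<gamma> dbar dstar \<and>
        (let G = (\<lambda>x. prob_space.expectation M (payoff M B a b \<rho> dstar x 0));
             H = (\<lambda>x. prob_space.expectation M (\<lambda>\<omega>. (payoff M B a b \<rho> dstar x 0 \<omega>)^2))
         in \<forall>x\<ge>0.
           G x = dbar / \<rho> * (1 - exp (r6 * x)) \<and>
           H x = (dbar / \<rho>)^2 * (1 - 2 * exp (r6 * x) + exp (r8 * x)) \<and>
           (\<forall>t\<ge>0. mv_objective M B a b \<rho> \<gamma> x t dstar = G x - \<gamma> / 2 * (H x - (G x)^2)))))"
proof -
  obtain W where W: "brownian_filtration M (natural_filtration M B) W" "AE \<omega> in M. \<forall>s. W s \<omega> = B s \<omega>"
    using brownian_version[OF assms(1)] .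
  define c where "c = dbar / \<rho>"
  have c: "0 < c" using assms(3,4) by (simp add: c_def)
  have r6: "r6 < 0" "\<rho> = r6\<^sup>2 * b\<^sup>2 / 2 + r6 * (a - dbar)"
    using negative_root[OF assms(2,3,5)] by auto
  have r8: "r8 < 0" "2 * \<rho> = r8\<^sup>2 * b\<^sup>2 / 2 + r8 * (a - dbar)"
    using negative_root[of b "2 * \<rho>" r8 "a - dbar"] assms(2,3,6) by auto
  \<comment> \<open>The last assumption multiplied by the negative \<open>r6\<close>.\<close>
  have slope: "0 < 1 + c * r6"
    using mult_strict_right_mono_neg[OF assms(7) r6(1)] r6(1) by (simp add: c_def distrib_right)
  \<comment> \<open>For \<open>\<gamma>\<close> below this value the lower bound
    \<open>1 + c * r6 + \<gamma> / 2 * c\<^sup>2 * r8\<close> of \<open>L\<close>, which does not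
    depend on \<open>x\<close>, \<open>t\<close> or \<open>d\<close>, stays positive.\<close>
  define \<gamma>0 where "\<gamma>0 = 2 * (1 + c * r6) / (c\<^sup>2 * (- r8))"
  have \<gamma>0: "0 < \<gamma>0" unfolding \<gamma>0_def using slope c r8(1) by (intro divide_pos_pos mult_pos_pos) auto
  have problem: "dividend_problem M B W b d dbar \<epsilon> t x \<rho> \<delta>"
    if "0 \<le> d" "d \<le> dbar" "0 \<le> \<epsilon>" "0 \<le> t" "0 \<le> x" "admissible dbar \<delta>"
      "\<And>y s. 0 < y \<Longrightarrow> t \<le> s \<Longrightarrow> \<delta> y s = (if s < t + \<epsilon> then d else dbar)" for d \<epsilon> t x \<delta>
    using that W assms(2-4)
    by (intro dividend_problem.intro controlled_brownian.intro controlled_brownian_axioms.intro dividend_problem_axioms.intro)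
  have main: "equilibrium_strategy M B a b \<rho> \<gamma> dbar dstar \<and>
      (\<forall>x\<ge>0. \<forall>t\<ge>0. prob_space.expectation M (payoff M B a b \<rho> dstar x t) = c * (1 - exp (r6 * x)) \<and>
        prob_space.expectation M (\<lambda>\<omega>. (payoff M B a b \<rho> dstar x t \<omega>)\<^sup>2) = c\<^sup>2 * (1 - 2 * exp (r6 * x) + exp (r8 * x)) \<and>
        mv_objective M B a b \<rho> \<gamma> x t dstar = c * (1 - exp (r6 * x))
          - \<gamma> / 2 * (c\<^sup>2 * (1 - 2 * exp (r6 * x) + exp (r8 * x)) - (c * (1 - exp (r6 * x)))\<^sup>2))"
    if \<gamma>: "0 < \<gamma>" "\<gamma> < \<gamma>0" and adm: "admissible dbar dstar" and dstar: "\<forall>x>0. \<forall>t\<ge>0. dstar x t = dbar" for \<gamma> dstar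
  proof
    have exact: "prob_space.expectation M (payoff M B a b \<rho> dstar x t) = c * (1 - exp (r6 * x))"
       "prob_space.expectation M (\<lambda>\<omega>. (payoff M B a b \<rho> dstar x t \<omega>)\<^sup>2) = c\<^sup>2 * (1 - 2 * exp (r6 * x) + exp (r8 * x))"
       "mv_objective M B a b \<rho> \<gamma> x t dstar = c * (1 - exp (r6 * x))
          - \<gamma> / 2 * (c\<^sup>2 * (1 - 2 * exp (r6 * x) + exp (r8 * x)) - (c * (1 - exp (r6 * x)))\<^sup>2)"
      if "0 \<le> x" "0 \<le> t" for x t
    proof -
      interpret dividend_problem M B W a b dbar dbar 0 t x \<rho> dstar
        by (rule problem) (use that assms(4) adm dstar in auto)
      have \<alpha>c: "(dbar + (dbar - dbar) * exp (- \<rho> * 0)) / \<rho> = c" by (simp add: c_def)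
      have p: "early_ruin = 0" by (rule early_ruin_0) simp
      show 1: "expectation (payoff M B a b \<rho> dstar x t) = c * (1 - exp (r6 * x))"
        using payoff_mean[OF r6 r8] unfolding p \<alpha>c c_def[symmetric] by (simp add: algebra_simps)
      show 2: "expectation (\<lambda>\<omega>. (payoff M B a b \<rho> dstar x t \<omega>)\<^sup>2) = c\<^sup>2 * (1 - 2 * exp (r6 * x) + exp (r8 * x))"
        using payoff_second_moment[OF r6 r8] unfolding p \<alpha>c c_def[symmetric]
        by (simp add: algebra_simps power2_eq_square)
      show "mv_objective M B a b \<rho> \<gamma> x t dstar = c * (1 - exp (r6 * x))
          - \<gamma> / 2 * (c\<^sup>2 * (1 - 2 * exp (r6 * x) + exp (r8 * x)) - (c * (1 - exp (r6 * x)))\<^sup>2)"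
        unfolding mv_objective_def payoff_variance unfolding 1 2 ..
    qed
    then show "\<forall>x\<ge>0. \<forall>t\<ge>0. prob_space.expectation M (payoff M B a b \<rho> dstar x t) = c * (1 - exp (r6 * x)) \<and>
        prob_space.expectation M (\<lambda>\<omega>. (payoff M B a b \<rho> dstar x t \<omega>)\<^sup>2) = c\<^sup>2 * (1 - 2 * exp (r6 * x) + exp (r8 * x)) \<and>
        mv_objective M B a b \<rho> \<gamma> x t dstar = c * (1 - exp (r6 * x))
          - \<gamma> / 2 * (c\<^sup>2 * (1 - 2 * exp (r6 * x) + exp (r8 * x)) - (c * (1 - exp (r6 * x)))\<^sup>2)"
      by blast
    show "equilibrium_strategy M B a b \<rho> \<gamma> dbar dstar"
      unfolding equilibrium_strategy_def
    proof (intro conjI adm allI impI ballI)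
      fix x t d :: real assume x: "0 \<le> x" and t: "0 \<le> t" and d: "d \<in> {0..dbar}"
      let ?J = "mv_objective M B a b \<rho> \<gamma> x t"
      have pert: "dividend_problem M B W b d dbar \<epsilon> t x \<rho> (perturbed dstar d t \<epsilon>)" if "0 < \<epsilon>" for \<epsilon>
      proof (rule problem)
        show "admissible dbar (perturbed dstar d t \<epsilon>)" using adm d by (intro admissible_perturbed) auto
        show "perturbed dstar d t \<epsilon> y s = (if s < t + \<epsilon> then d else dbar)" if "0 < y" "t \<le> s" for y s
          using that t dstar by (simp add: perturbed_def)
      qed (use that x t d in auto)
      show "0 \<le> Liminf (at_right 0) (\<lambda>\<epsilon>. ereal ((?J dstar - ?J (perturbed dstar d t \<epsilon>)) / \<epsilon>))"
      proof (cases "x = 0")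
        case True
        have "?J dstar = 0" using exact(3)[OF x t] True by simp
        moreover have "?J (perturbed dstar d t \<epsilon>) = 0" if "0 < \<epsilon>" for \<epsilon>
        proof -
          interpret dividend_problem M B W a b d dbar \<epsilon> t x \<rho> "perturbed dstar d t \<epsilon>" by (rule pert[OF that])
          have "expectation (payoff M B a b \<rho> (perturbed dstar d t \<epsilon>) x t) = 0"
            by (rule integral_eq_zero_AE[OF payoff_at_0[OF True]])
          moreover have "expectation (\<lambda>\<omega>. (payoff M B a b \<rho> (perturbed dstar d t \<epsilon>) x t \<omega>)\<^sup>2) = 0"
            by (rule integral_eq_zero_AE) (use payoff_at_0[OF True] in \<open>auto elim!: eventually_mono\<close>)
          ultimately show ?thesis unfolding mv_objective_def payoff_variance by simp
        qed
        ultimately have "\<forall>\<^sub>F \<epsilon> in at_right 0. ereal 0 \<le> ereal ((?J dstar - ?J (perturbed dstar d t \<epsilon>)) / \<epsilon>)"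
          by (auto simp: eventually_at_right_field intro!: exI[of _ 1])
        then show ?thesis by (intro Liminf_bounded) (simp add: zero_ereal_def)
      next
        case False
        then have x0: "0 < x" using x by simp
        \<comment> \<open>The explicit part of the perturbed objective in
          \<open>objective_near\<close>, viewed as a function of the perturbation length.\<close>
        define j where "j \<epsilon> = (d + (dbar - d) * exp (- \<rho> * \<epsilon>)) / \<rho> - c * exp (r6 * x + r6 * (dbar - d) * \<epsilon>)
          - \<gamma> / 2 * (c\<^sup>2 * (exp (r8 * x + r8 * (dbar - d) * \<epsilon>) - (exp (r6 * x + r6 * (dbar - d) * \<epsilon>))\<^sup>2))" for \<epsilon>
        \<comment> \<open>Rate of loss per unit of dividends withheld: the derivative of
          \<open>j\<close> at 0 is \<open>- (dbar - d) * L\<close>.\<close>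
        define L where "L = 1 + c * r6 * exp (r6 * x) + \<gamma> / 2 * c\<^sup>2 * (r8 * exp (r8 * x) - 2 * r6 * (exp (r6 * x))\<^sup>2)"
        have j0: "j 0 = ?J dstar"
          unfolding exact(3)[OF x t] j_def c_def using assms(3) by (simp add: power2_eq_square field_simps)
        have "DERIV j 0 :> - (dbar - d) * L"
          unfolding j_def L_def using assms(3)
          by (auto intro!: derivative_eq_intros simp: power2_eq_square field_simps)
        then have "((\<lambda>\<epsilon>. (j (0 + \<epsilon>) - j 0) / \<epsilon>) \<longlongrightarrow> - (dbar - d) * L) (at_right 0)"
          unfolding DERIV_def by (rule filterlim_mono) (auto intro: at_le)
        then have dj: "((\<lambda>\<epsilon>. (j \<epsilon> - j 0) / \<epsilon>) \<longlongrightarrow> - (dbar - d) * L) (at_right 0)" by simp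
        have L: "0 \<le> L"
        proof -
          have e6: "0 < exp (r6 * x)" "exp (r6 * x) \<le> 1" and e8: "0 < exp (r8 * x)" "exp (r8 * x) \<le> 1"
            using r6(1) r8(1) x by (auto simp: mult_nonpos_nonneg)
          have "c * r6 * 1 \<le> c * r6 * exp (r6 * x)"
            using e6 c r6(1) by (intro mult_left_mono_neg) (auto intro: mult_nonneg_nonpos)
          moreover have "r8 * 1 \<le> r8 * exp (r8 * x)" using e8 r8(1) by (intro mult_left_mono_neg) auto
          \<comment> \<open>This term has a favourable sign and is discarded; the other two are
            smallest at \<open>x = 0\<close>.\<close>
          moreover have "0 \<le> - 2 * r6 * (exp (r6 * x))\<^sup>2" by (rule mult_nonneg_nonneg) (use r6(1) in auto)
          ultimately have "\<gamma> / 2 * c\<^sup>2 * r8 \<le> \<gamma> / 2 * c\<^sup>2 * (r8 * exp (r8 * x) - 2 * r6 * (exp (r6 * x))\<^sup>2)"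
            using \<gamma> by (intro mult_left_mono) auto
          moreover have "\<gamma> * (c\<^sup>2 * (- r8)) < 2 * (1 + c * r6)"
            using \<gamma>(2) c r8(1) unfolding \<gamma>0_def by (subst (asm) pos_less_divide_eq) (auto intro!: mult_pos_neg)
          ultimately show ?thesis
            using \<open>c * r6 * 1 \<le> c * r6 * exp (r6 * x)\<close> unfolding L_def by (simp add: field_simps)
        qed
        define K where "K = 4 * c + 16 * \<gamma> * c\<^sup>2"
        define pb where "pb \<epsilon> = exp (b\<^sup>2 / 2 - (a - dbar) * sqrt \<epsilon> - x / sqrt \<epsilon>)" for \<epsilon>
        have K: "0 \<le> K" using c \<gamma> by (simp add: K_def)
        have lim0: "((\<lambda>\<epsilon>. pb \<epsilon> / \<epsilon>) \<longlongrightarrow> 0) (at_right 0)" unfolding pb_def by (rule early_ruin_rate[OF x0])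
        have "((\<lambda>\<epsilon>. - ((j \<epsilon> - j 0) / \<epsilon>) - K * (pb \<epsilon> / \<epsilon>)) \<longlongrightarrow> - (- (dbar - d) * L) - K * 0) (at_right 0)"
          by (intro tendsto_diff tendsto_minus tendsto_mult tendsto_const dj lim0)
        moreover have "- (- (dbar - d) * L) - K * 0 = (dbar - d) * L" by (simp add: algebra_simps)
        ultimately have lim: "((\<lambda>\<epsilon>. ereal (- ((j \<epsilon> - j 0) / \<epsilon>) - K * (pb \<epsilon> / \<epsilon>))) \<longlongrightarrow> ereal ((dbar - d) * L)) (at_right 0)"
          by (intro tendsto_ereal) (simp only:)
        \<comment> \<open>\<open>discount_near\<close> demands a positive rate, and \<open>lam *
          \<epsilon> = b\<^sup>2 / 2 - (a - dbar) * sqrt \<epsilon>\<close> is positive for small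
          \<open>\<epsilon>\<close>.\<close>
        have "((\<lambda>\<epsilon>. (a - dbar) * sqrt \<epsilon>) \<longlongrightarrow> (a - dbar) * sqrt 0) (at_right 0)"
          by (intro tendsto_intros)
        then have "\<forall>\<^sub>F \<epsilon> in at_right 0. (a - dbar) * sqrt \<epsilon> < b\<^sup>2 / 2"
          using assms(2) by (intro order_tendstoD(2)) auto
        then have "\<forall>\<^sub>F \<epsilon> in at_right 0. - ((j \<epsilon> - j 0) / \<epsilon>) - K * (pb \<epsilon> / \<epsilon>) \<le> (?J dstar - ?J (perturbed dstar d t \<epsilon>)) / \<epsilon>"
          using eventually_at_right_less[of 0]
        proof eventually_elim
          case (elim \<epsilon>)
          interpret dividend_problem M B W a b d dbar \<epsilon> t x \<rho> "perturbed dstar d t \<epsilon>" by (rule pert[OF elim(2)])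
          define lam where "lam = (- 1 / sqrt \<epsilon>)\<^sup>2 * b\<^sup>2 / 2 + (- 1 / sqrt \<epsilon>) * (a - dbar)"
          have lam\<epsilon>: "lam * \<epsilon> = b\<^sup>2 / 2 - (a - dbar) * sqrt \<epsilon>"
          proof -
            have "((- 1 / q)\<^sup>2 * b\<^sup>2 / 2 + (- 1 / q) * (a - dbar)) * (q * q) = b\<^sup>2 / 2 - (a - dbar) * q"
              if "0 < q" for q :: real
              using that by (simp add: field_simps power2_eq_square)
            from this[of "sqrt \<epsilon>"] show ?thesis unfolding lam_def using elim(2) by simp
          qed
          have "0 < lam * \<epsilon>" unfolding lam\<epsilon> using elim(1) by simp
          then have lam: "0 < lam" using elim(2) by (simp add: zero_less_mult_iff)
          have "early_ruin \<le> exp (lam * \<epsilon> + (- 1 / sqrt \<epsilon>) * x)"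
            by (rule discount_near(2)[OF _ lam_def lam]) (use elim(2) in simp)
          then have "early_ruin \<le> pb \<epsilon>" unfolding lam\<epsilon> pb_def by simp
          then have "K * early_ruin \<le> K * pb \<epsilon>" using K by (intro mult_left_mono)
          moreover have "\<bar>?J (perturbed dstar d t \<epsilon>) - j \<epsilon>\<bar> \<le> K * early_ruin"
            using objective_near[OF r6 r8, of \<gamma>] \<gamma> unfolding j_def K_def c_def by simp
          ultimately have "j 0 - j \<epsilon> - K * pb \<epsilon> \<le> ?J dstar - ?J (perturbed dstar d t \<epsilon>)"
            unfolding j0 by linarith
          then have "(j 0 - j \<epsilon> - K * pb \<epsilon>) / \<epsilon> \<le> (?J dstar - ?J (perturbed dstar d t \<epsilon>)) / \<epsilon>"
            using elim(2) by (intro divide_right_mono) auto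
          then show ?case by (simp add: diff_divide_distrib)
        qed
        then have "Liminf (at_right 0) (\<lambda>\<epsilon>. ereal (- ((j \<epsilon> - j 0) / \<epsilon>) - K * (pb \<epsilon> / \<epsilon>)))
          \<le> Liminf (at_right 0) (\<lambda>\<epsilon>. ereal ((?J dstar - ?J (perturbed dstar d t \<epsilon>)) / \<epsilon>))"
          by (intro Liminf_mono) (auto elim: eventually_mono)
        moreover have "Liminf (at_right 0) (\<lambda>\<epsilon>. ereal (- ((j \<epsilon> - j 0) / \<epsilon>) - K * (pb \<epsilon> / \<epsilon>))) = ereal ((dbar - d) * L)"
          using lim by (intro lim_imp_Liminf) auto
        moreover have "0 \<le> ereal ((dbar - d) * L)" using L d by simp
        ultimately show ?thesis by (metis order_trans)
      qed
    qed
  qed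
  show ?thesis
    unfolding Let_def
  proof (intro conjI r6(1) r8(1) exI[of _ \<gamma>0] \<gamma>0 allI impI)
    fix \<gamma> dstar assume \<gamma>: "0 < \<gamma>" "\<gamma> < \<gamma>0" and ds: "admissible dbar dstar \<and> (\<forall>x>0. \<forall>t\<ge>0. dstar x t = dbar)"
    note m = main[OF \<gamma> conjunct1[OF ds] conjunct2[OF ds]]
    show "equilibrium_strategy M B a b \<rho> \<gamma> dbar dstar" using m by blast
    fix x :: real assume x: "0 \<le> x"
    have e0: "prob_space.expectation M (payoff M B a b \<rho> dstar x 0) = c * (1 - exp (r6 * x))"
      "prob_space.expectation M (\<lambda>\<omega>. (payoff M B a b \<rho> dstar x 0 \<omega>)\<^sup>2) = c\<^sup>2 * (1 - 2 * exp (r6 * x) + exp (r8 * x))"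
      using m x by simp_all
    show "prob_space.expectation M (payoff M B a b \<rho> dstar x 0) = dbar / \<rho> * (1 - exp (r6 * x))"
      "prob_space.expectation M (\<lambda>\<omega>. (payoff M B a b \<rho> dstar x 0 \<omega>)\<^sup>2) = (dbar / \<rho>)\<^sup>2 * (1 - 2 * exp (r6 * x) + exp (r8 * x))"
      using e0 by (simp_all add: c_def)
    fix t :: real assume "0 \<le> t"
    then show "mv_objective M B a b \<rho> \<gamma> x t dstar =
      prob_space.expectation M (payoff M B a b \<rho> dstar x 0) - \<gamma> / 2 *
       (prob_space.expectation M (\<lambda>\<omega>. (payoff M B a b \<rho> dstar x 0 \<omega>)\<^sup>2) - (prob_space.expectation M (payoff M B a b \<rho> dstar x 0))\<^sup>2)"
      unfolding e0 using m x by blast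
  qed
qed

end
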